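(* Let $w$ be a doubling weight, $r\in\mathbb{N}$, $1\le p\le\infty$, and $f\in L_p[-1,1]$. Then, for all $n\in\mathbb{N}$, $$\omega_\varphi^r(f,n^{-1})_{p,w_n}\le\frac{c}{n^{r-1/\lambda_p}}\sum_{k=1}^n k^{r-1-1/\lambda_p}E_k(f)_{p,w_k},$$ where the constant $c$ depends only on $r$, $p$ and the doubling constant of $w$.
   Context: A doubling weight is a nonnegative $w\in L_1[-1,1]$, extended by $0$ outside $[-1,1]$, for which there is a constant $L$ (the doubling constant of $w$) with $\int_{2I}w\le L\int_I w$ for all intervals $I\subset[-1,1]$, where $2I$ is the interval with the same center as $I$ and twice its length. Let $\varphi(x)=\sqrt{1-x^2}$, $\rho_n(x)=n^{-1}\sqrt{1-x^2}+n^{-2}$, and $w_n(x)=\frac{1}{\rho_n(x)}\int_{x-\rho_n(x)}^{x+\rho_n(x)}w(u)\,du$. $\lambda_p=p$ if $p<\infty$, $\lambda_\infty=1$. For a weight $v$ on $[-1,1]$: $\|g\|_{p,v}=\left(\int_{-1}^1|g|^p v\right)^{1/p}$ if $p<\infty$, $\|g\|_{\infty,v}=\operatorname{ess\,sup}_{[-1,1]}|g|v$. $\Pi_n$ is the set of algebraic polynomials of degree $\le n-1$ and $E_n(f)_{p,v}=\inf_{P\in\Pi_n}\|f-P\|_{p,v}$. Symmetric difference: $\Delta_h^r(f,x)=\sum_{i=0}^r\binom ri(-1)^{r-i}f(x-rh/2+ih)$ if $x\pm rh/2\in[-1,1]$, and $0$ otherwise. Modulus: $\omega_\varphi^r(f,t)_{p,v}=\sup_{0<h\le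 t}\|\Delta_{h\varphi(\cdot)}^r(f,\cdot)\|_{p,v}$. *)

theory Defs
  imports
    "HOL-Probability.Essential_Supremum"
    "HOL-Computational_Algebra.Polynomial"
begin

text \<open>Functions and weights on \<open>[-1,1]\<close> are total functions \<open>real \<Rightarrow> real\<close>. The values of
  \<open>f\<close> outside \<open>[-1,1]\<close> are never used; a weight is required to vanish there, which is its
  extension by \<open>0\<close>. The measure is Lebesgue measure (complete, so measurable means Lebesgue
  measurable).\<close>

text \<open>\<open>I = [a,b]\<close> has center \<open>(a + b) / 2\<close>, so \<open>2I\<close> has endpoints
  \<open>(a + b) / 2 \<plusminus> (b - a)\<close>. Open and half-open intervals give the same integrals.\<close>
definition doubling_weight :: "real \<Rightarrow> (real \<Rightarrow> real) \<Rightarrow> bool" where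
  "doubling_weight L w \<longleftrightarrow>
     integrable lebesgue w \<and>
     (\<forall>x\<in>{-1..1}. 0 \<le> w x) \<and>
     (\<forall>x. x \<notin> {-1..1} \<longrightarrow> w x = 0) \<and>
     (\<forall>a b. -1 \<le> a \<and> a < b \<and> b \<le> 1 \<longrightarrow>
        (LINT u:{(a + b) / 2 - (b - a)..(a + b) / 2 + (b - a)}|lebesgue. w u)
          \<le> L * (LINT u:{a..b}|lebesgue. w u))"

definition phi :: "real \<Rightarrow> real" where
  "phi x = sqrt (1 - x\<^sup>2)"

definition rho :: "nat \<Rightarrow> real \<Rightarrow> real" where
  "rho n x = sqrt (1 - x\<^sup>2) / real n + 1 / (real n)\<^sup>2"

definition weight_avg :: "(real \<Rightarrow> real) \<Rightarrow> nat \<Rightarrow> real \<Rightarrow> real" where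
  "weight_avg w n x = 1 / rho n x * (LINT u:{x - rho n x..x + rho n x}|lebesgue. w u)"

definition lam :: "ennreal \<Rightarrow> real" where
  "lam p = (if p = \<infinity> then 1 else enn2real p)"

text \<open>Real powers on \<open>[0,\<infinity>]\<close>, used only with a positive exponent \<open>a\<close>.\<close>
definition ennreal_powr :: "ennreal \<Rightarrow> real \<Rightarrow> ennreal" where
  "ennreal_powr y a = (if y = \<infinity> then \<infinity> else ennreal (enn2real y powr a))"

text \<open>The norms take values in \<open>[0,\<infinity>]\<close>, so that they, and the suprema and infima of them
  below, are defined without any finiteness assumption.\<close>
definition wnorm :: "ennreal \<Rightarrow> (real \<Rightarrow> real) \<Rightarrow> (real \<Rightarrow> real) \<Rightarrow> ennreal" where
  "wnorm p v g =
     (if p = \<infinity> then esssup (lebesgue_on {-1..1}) (\<lambda>x. ennreal (\<bar>g x\<bar> * v x))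
      else ennreal_powr
             (\<integral>\<^sup>+ x. ennreal (\<bar>g x\<bar> powr enn2real p * v x) \<partial>lebesgue_on {-1..1})
             (1 / enn2real p))"

definition Lp_space :: "ennreal \<Rightarrow> (real \<Rightarrow> real) set" where
  "Lp_space p = {f. f \<in> borel_measurable (lebesgue_on {-1..1}) \<and> wnorm p (\<lambda>_. 1) f < \<infinity>}"

text \<open>Only used for \<open>n \<ge> 1\<close>, where the truncated subtraction is the ordinary one.\<close>
definition Pi_poly :: "nat \<Rightarrow> real poly set" where
  "Pi_poly n = {P. degree P \<le> n - 1}"

definition best_approx :: "nat \<Rightarrow> (real \<Rightarrow> real) \<Rightarrow> ennreal \<Rightarrow> (real \<Rightarrow> real) \<Rightarrow> ennreal" where
  "best_approx n f p v = (INF P\<in>Pi_poly n. wnorm p v (\<lambda>x. f x - poly P x))"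

definition symm_difference :: "nat \<Rightarrow> real \<Rightarrow> (real \<Rightarrow> real) \<Rightarrow> real \<Rightarrow> real" where
  "symm_difference r h f x =
     (if x - real r * h / 2 \<in> {-1..1} \<and> x + real r * h / 2 \<in> {-1..1}
      then \<Sum>i=0..r. real (r choose i) * (-1) ^ (r - i) * f (x - real r * h / 2 + real i * h)
      else 0)"

definition modulus_phi :: "nat \<Rightarrow> (real \<Rightarrow> real) \<Rightarrow> real \<Rightarrow> ennreal \<Rightarrow> (real \<Rightarrow> real) \<Rightarrow> ennreal" where
  "modulus_phi r f t p v = (SUP h\<in>{0<..t}. wnorm p v (\<lambda>x. symm_difference r (h * phi x) f x))"

end

theory Submission
  imports Defs "HOL-Complex_Analysis.Complex_Analysis"
begin

text \<open>Write \<open>f\<close> as \<open>f - P\<^sub>J\<close> plus the telescoping sum of \<open>P\<^sub>j\<^sub>+\<^sub>1 - P\<^sub>j\<close>, where \<open>P\<^sub>j\<close> is nearly best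
  of degree less than \<open>2 ^ j\<close> for the weight with index \<open>2 ^ j\<close> and \<open>2 ^ J \<le> n\<close>. The first term
  is handled by boundedness of the weighted differences. A polynomial \<open>Q\<close> of degree at most \<open>m\<close>
  is bounded near \<open>x\<close>, at complex distance of order \<open>rho m x\<close>, by an average of \<open>\<bar>Q\<bar>\<close> against a
  kernel that decays at scale \<open>rho m x\<close> faster than any prescribed power; such averages are bounded on the
  weighted spaces since doubling makes the averaged weight grow at most polynomially at that scale.
  With Cauchy's estimate this gives a weighted Bernstein inequality for the \<open>r\<close>-th difference. The
  passage from index \<open>m\<close> to \<open>n\<close> costs \<open>rho m x / rho n x\<close>, which the factor
  \<open>phi x / (n * rho m x)\<close> of the difference compensates up to \<open>n / m\<close>, even near the
  endpoints; this is the source of the exponent \<open>1 / lam p\<close>.\<close>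

section \<open>The local scale and averages of doubling weights\<close>

text \<open>The kernel bound comes from the substitution z = (w + 1/w)/2, which turns Q of degree at
  most m into the polynomial w^m Q((w + 1/w)/2) of degree at most 2m. It is multiplied by w^2 - 1,
  whose modulus on the unit circle is twice the Jacobian of y = cos t, and by a power of a
  normalized geometric sum that is 1 at the evaluation point and decays away from it at scale 1/m. A
  reproducing formula, valid also outside the circle, bounds Q(z) as long as the preimage has
  modulus 1 + O(1/m). The price is a division by w^2 - 1, that is by sqrt(z^2 - 1), which
  degenerates at z = 1 and z = -1; hence the Cauchy circles must keep a distance of order
  \<open>rho m x\<close> from both endpoints. The decay also has to beat the asymmetry of the scale:
  \<open>reldist m x y\<close> is measured by the scale at x, and interchanging the points costs a
  square. This fixes the number of powers demanded of the kernel beyond those eaten by the growth of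
  the weight.\<close>

lemma phi_nonneg: "x \<in> {-1..1} \<Longrightarrow> 0 \<le> phi x"
  by (auto simp: phi_def abs_square_le_1 abs_le_iff)

lemma phi_sq: "x \<in> {-1..1} \<Longrightarrow> (phi x)\<^sup>2 = 1 - x\<^sup>2"
  by (auto simp: phi_def abs_square_le_1 abs_le_iff)

lemma phi_le_1: "phi x \<le> 1"
  by (simp add: phi_def)

lemma rho_phi: "rho n x = phi x / n + 1 / (real n)\<^sup>2"
  by (simp add: rho_def phi_def)

lemma rho_ge: "x \<in> {-1..1} \<Longrightarrow> 1 / (real n)\<^sup>2 \<le> rho n x"
  using phi_nonneg[of x] by (simp add: rho_phi)

lemma rho_pos: "x \<in> {-1..1} \<Longrightarrow> n \<ge> 1 \<Longrightarrow> 0 < rho n x"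
  using rho_ge[of x n] by (smt (verit) of_nat_0_less_iff zero_less_divide_1_iff zero_less_power less_le_trans less_numeral_extra(1))

lemma rho_le_2: "n \<ge> 1 \<Longrightarrow> rho n x \<le> 2"
proof -
  assume "n \<ge> 1"
  then have "phi x / n \<le> 1" "1 / (real n)\<^sup>2 \<le> 1"
    using phi_le_1[of x] by (auto simp: divide_le_eq_1 one_le_power)
  then show ?thesis by (simp add: rho_phi)
qed

lemma sq_add_le: "(a + b)\<^sup>2 \<le> 2 * a\<^sup>2 + 2 * b\<^sup>2" for a b :: real
  using zero_le_power2[of "a - b"] by (simp add: power2_sum power2_diff)

text \<open>The square of \<open>phi\<close> is Lipschitz with constant 2, although
  \<open>phi\<close> itself is not Lipschitz at the endpoints. Scaling by 1/n^2 \<le>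
  \<open>rho n x\<close> turns this into a bound for the squared scale that holds at every distance,
  not only for nearby points.\<close>

lemma rho_sq_le:
  assumes "x \<in> {-1..1}" "y \<in> {-1..1}" "n \<ge> 1"
  shows "(rho n y)\<^sup>2 \<le> 4 * rho n x * (rho n x + \<bar>x - y\<bar>)"
proof -
  let ?e = "1 / (real n)\<^sup>2"
  have e: "0 \<le> ?e" "?e \<le> rho n x" using rho_ge[OF assms(1)] by auto
  have "x\<^sup>2 - y\<^sup>2 = (x + y) * (x - y)" by (simp add: power2_eq_square algebra_simps)
  also have "\<dots> \<le> \<bar>x + y\<bar> * \<bar>x - y\<bar>" by (metis abs_ge_self abs_mult)
  also have "\<dots> \<le> 2 * \<bar>x - y\<bar>" using assms by (intro mult_right_mono) auto
  finally have "(phi y)\<^sup>2 \<le> (phi x)\<^sup>2 + 2 * \<bar>x - y\<bar>" using assms by (simp add: phi_sq)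
  then have "(phi y)\<^sup>2 * ?e \<le> ((phi x)\<^sup>2 + 2 * \<bar>x - y\<bar>) * ?e" by (intro mult_right_mono e)
  then have 1: "(phi y / n)\<^sup>2 \<le> (phi x / n)\<^sup>2 + 2 * \<bar>x - y\<bar> * ?e"
    by (simp add: power_divide algebra_simps)
  have "(phi x / n)\<^sup>2 \<le> (rho n x)\<^sup>2" using phi_nonneg[OF assms(1)] by (intro power_mono) (auto simp: rho_phi)
  moreover have "?e\<^sup>2 \<le> (rho n x)\<^sup>2" using e by (intro power_mono) auto
  moreover have "2 * \<bar>x - y\<bar> * ?e \<le> 2 * \<bar>x - y\<bar> * rho n x" using e by (intro mult_left_mono) auto
  moreover have "(rho n y)\<^sup>2 \<le> 2 * (phi y / n)\<^sup>2 + 2 * ?e\<^sup>2"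
    unfolding rho_phi by (rule sq_add_le)
  ultimately have "(rho n y)\<^sup>2 \<le> 4 * (rho n x)\<^sup>2 + 4 * \<bar>x - y\<bar> * rho n x" using 1 by linarith
  then show ?thesis by (simp add: power2_eq_square algebra_simps)
qed

definition reldist :: "nat \<Rightarrow> real \<Rightarrow> real \<Rightarrow> real" where
  "reldist n x y = \<bar>x - y\<bar> / rho n x"

lemma reldist_nonneg: "x \<in> {-1..1} \<Longrightarrow> n \<ge> 1 \<Longrightarrow> 0 \<le> reldist n x y"
  using rho_pos[of x n] by (simp add: reldist_def)

lemma rho_ratio_sq:
  assumes "x \<in> {-1..1}" "y \<in> {-1..1}" "n \<ge> 1"
  shows "(rho n y / rho n x)\<^sup>2 \<le> 4 * (1 + reldist n x y)"
proof -
  have p: "rho n x > 0" by (rule rho_pos[OF assms(1,3)])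
  then have "4 * rho n x * (rho n x + \<bar>x - y\<bar>) = 4 * (1 + reldist n x y) * (rho n x)\<^sup>2"
    by (simp add: reldist_def power2_eq_square field_simps)
  then show ?thesis using rho_sq_le[OF assms] p by (simp add: power_divide divide_le_eq)
qed

lemma rho_ratio_le:
  assumes "x \<in> {-1..1}" "y \<in> {-1..1}" "n \<ge> 1"
  shows "rho n y / rho n x \<le> 2 * (1 + reldist n x y)"
proof (rule power2_le_imp_le)
  have a: "0 \<le> reldist n x y" using assms reldist_nonneg by auto
  then have "4 * (1 + reldist n x y) * 1 \<le> 4 * (1 + reldist n x y) * (1 + reldist n x y)"
    by (intro mult_left_mono) auto
  then show "(rho n y / rho n x)\<^sup>2 \<le> (2 * (1 + reldist n x y))\<^sup>2"
    using rho_ratio_sq[OF assms] by (simp add: power2_eq_square algebra_simps)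
  show "0 \<le> 2 * (1 + reldist n x y)" using a by auto
qed

text \<open>\<open>reldist\<close> divides by the scale at its first point, so it is not symmetric.
  If |x - y| exceeds \<open>rho n y\<close>, then \<open>rho_sq_le\<close> gives rho(x)^2 \<le> 8
  rho(y) |x - y|, which is the quadratic bound; otherwise the left side is at most 2.\<close>

lemma reldist_swap:
  assumes "x \<in> {-1..1}" "y \<in> {-1..1}" "n \<ge> 1"
  shows "1 + reldist n y x \<le> 8 * (1 + reldist n x y)\<^sup>2"
proof -
  have p: "rho n x > 0" "rho n y > 0" using rho_pos assms by auto
  have a: "0 \<le> reldist n x y" using assms reldist_nonneg by auto
  show ?thesis
  proof (cases "\<bar>x - y\<bar> \<le> rho n y")
    case True
    then have "reldist n y x \<le> 1" using p by (simp add: reldist_def abs_minus_commute)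
    moreover have "1\<^sup>2 \<le> (1 + reldist n x y)\<^sup>2" using a by (intro power_mono) auto
    ultimately show ?thesis by simp
  next
    case False
    have "(rho n x)\<^sup>2 \<le> 4 * rho n y * (rho n y + \<bar>x - y\<bar>)"
      using rho_sq_le[of y x n] assms by (simp add: abs_minus_commute)
    also have "\<dots> \<le> 4 * rho n y * (2 * \<bar>x - y\<bar>)" using False p by (intro mult_left_mono) auto
    finally have *: "(rho n x)\<^sup>2 * \<bar>x - y\<bar> \<le> 8 * rho n y * \<bar>x - y\<bar> * \<bar>x - y\<bar>"
      by (intro mult_right_mono) auto
    define D where "D = \<bar>x - y\<bar>"
    have "(rho n x)\<^sup>2 * D \<le> 8 * rho n y * D * D" using * unfolding D_def .
    then have "D * (rho n x)\<^sup>2 \<le> 8 * rho n y * D\<^sup>2" by (simp add: power2_eq_square mult_ac)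
    then have "D / rho n y \<le> 8 * (D / rho n x)\<^sup>2"
      using p by (simp add: power_divide divide_le_eq le_divide_eq mult_ac)
    then have "reldist n y x \<le> 8 * (reldist n x y)\<^sup>2"
      by (simp add: reldist_def D_def abs_minus_commute)
    moreover have "8 * (1 + reldist n x y)\<^sup>2 = 8 + 16 * reldist n x y + 8 * (reldist n x y)\<^sup>2"
      by (simp add: power2_eq_square algebra_simps)
    ultimately show ?thesis using a by linarith
  qed
qed

lemma rho_antimono:
  assumes "1 \<le> m" "m \<le> n" "x \<in> {-1..1}"
  shows "rho n x \<le> rho m x"
  unfolding rho_phi using assms phi_nonneg[of x]
  by (intro add_mono divide_left_mono mult_pos_pos power_mono) auto

lemma rho_le_4:
  assumes "1 \<le> m" "m \<le> n" "n \<le> 2 * m" "x \<in> {-1..1}"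
  shows "rho m x \<le> 4 * rho n x"
proof -
  have n: "real n \<le> 2 * real m" "real m > 0" "real n > 0" using assms by linarith+
  have "phi x / m \<le> 4 * (phi x / n)"
    using mult_left_mono[of "real n" "4 * real m" "phi x"] phi_nonneg[OF assms(4)] n
    by (simp add: field_simps)
  moreover have "(real n)\<^sup>2 \<le> (2 * real m)\<^sup>2" using n by (intro power_mono) auto
  then have "1 / (real m)\<^sup>2 \<le> 4 * (1 / (real n)\<^sup>2)" using n by (simp add: field_simps)
  ultimately show ?thesis unfolding rho_phi distrib_left by (rule add_mono)
qed

lemma continuous_on_rho: "n \<ge> 1 \<Longrightarrow> continuous_on S (rho n)"
  unfolding rho_def by (intro continuous_intros) auto

section \<open>Mass and averages of a doubling weight\<close>

definition mass :: "(real \<Rightarrow> real) \<Rightarrow> real \<Rightarrow> real \<Rightarrow> real" where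
  "mass w y t = (LINT u:{y - t..y + t}|lebesgue. w u)"

lemma weight_avg_mass: "weight_avg w n x = mass w x (rho n x) / rho n x"
  by (simp only: weight_avg_def mass_def times_divide_eq_left mult_1_left)

context
  fixes L :: real and w :: "real \<Rightarrow> real"
  assumes dw: "doubling_weight L w"
begin

lemma dw_nonneg: "0 \<le> w x"
  using dw unfolding doubling_weight_def by (cases "x \<in> {-1..1}") auto

lemma dw_integrable: "S \<in> sets lebesgue \<Longrightarrow> set_integrable lebesgue S w"
  using dw unfolding doubling_weight_def set_integrable_def
  by (intro integrable_mult_indicator) auto

lemma dw_mono:
  assumes "S \<in> sets lebesgue" "T \<in> sets lebesgue" "S \<inter> {-1..1} \<subseteq> T"
  shows "(LINT u:S|lebesgue. w u) \<le> (LINT u:T|lebesgue. w u)"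
  unfolding set_lebesgue_integral_def
proof (rule integral_mono)
  show "integrable lebesgue (\<lambda>x. indicat_real S x *\<^sub>R w x)" "integrable lebesgue (\<lambda>x. indicat_real T x *\<^sub>R w x)"
    using dw_integrable assms unfolding set_integrable_def by auto
  fix x
  show "indicat_real S x *\<^sub>R w x \<le> indicat_real T x *\<^sub>R w x"
    using assms(3) dw_nonneg[of x] dw
    by (cases "x \<in> {-1..1}") (auto simp: indicator_def doubling_weight_def)
qed

lemma mass_nonneg: "0 \<le> mass w y t"
  unfolding mass_def set_lebesgue_integral_def by (rule Bochner_Integration.integral_nonneg) (simp add: dw_nonneg)

lemma mass_mono: "\<bar>x - y\<bar> + s \<le> t \<Longrightarrow> mass w x s \<le> mass w y t"
  unfolding mass_def by (rule dw_mono) (auto simp: abs_le_iff)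

text \<open>The factor is \<open>5/4\<close> rather than \<open>2\<close>: only the part of \<open>[y - t, y + t]\<close> inside
  \<open>[-1,1]\<close>, of length at least \<open>t/2\<close>, may be doubled.\<close>
lemma mass_step:
  assumes y: "y \<in> {-1..1}" and t: "t > 0"
  shows "mass w y (5/4 * t) \<le> max L 1 * mass w y t"
proof (cases "t \<le> 2")
  case False
  have "mass w y (5/4 * t) \<le> mass w y t"
    unfolding mass_def using False y by (intro dw_mono) auto
  also have "\<dots> \<le> max L 1 * mass w y t" using mass_nonneg[of y t] mult_right_mono[of 1 "max L 1" "mass w y t"] by auto
  finally show ?thesis .
next
  case True
  define a b where "a = max (-1) (y - t)" and "b = min 1 (y + t)"
  have ab: "-1 \<le> a" "a < b" "b \<le> 1" "b - a \<ge> t / 2" using y t True by (auto simp: a_def b_def min_def max_def)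
  have "mass w y (5/4 * t) \<le> (LINT u:{(a + b) / 2 - (b - a)..(a + b) / 2 + (b - a)}|lebesgue. w u)"
    unfolding mass_def
  proof (rule dw_mono)
    have 1: "(a + b) / 2 - (b - a) = a - (b - a) / 2" "(a + b) / 2 + (b - a) = b + (b - a) / 2"
      by (simp_all add: field_simps)
    have "u \<in> {(a + b) / 2 - (b - a)..(a + b) / 2 + (b - a)}" if "u \<in> {-1..1}" "u \<in> {y - 5/4*t..y+5/4*t}" for u
    proof -
      have "a - t / 4 \<le> u" using that t by (auto simp: a_def max_def)
      moreover have "u \<le> b + t / 4" using that t by (auto simp: b_def min_def)
      ultimately have "a - (b - a) / 2 \<le> u" "u \<le> b + (b - a) / 2" using ab(4) by argo+
      then show ?thesis unfolding 1 by simp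
    qed
    then show "{y - 5 / 4 * t..y + 5 / 4 * t} \<inter> {- 1..1} \<subseteq> {(a + b) / 2 - (b - a)..(a + b) / 2 + (b - a)}"
      by blast
  qed auto
  also have "\<dots> \<le> L * (LINT u:{a..b}|lebesgue. w u)"
    using dw ab unfolding doubling_weight_def by blast
  also have "\<dots> \<le> max L 1 * (LINT u:{a..b}|lebesgue. w u)"
    by (intro mult_right_mono) (auto simp: set_lebesgue_integral_def dw_nonneg intro!: Bochner_Integration.integral_nonneg)
  also have "\<dots> \<le> max L 1 * mass w y t"
    unfolding mass_def by (intro mult_left_mono dw_mono) (auto simp: a_def b_def)
  finally show ?thesis .
qed

lemma mass_pow:
  assumes y: "y \<in> {-1..1}" and t: "t > 0"
  shows "mass w y ((5/4) ^ k * t) \<le> max L 1 ^ k * mass w y t"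
proof (induction k)
  case (Suc k)
  have "mass w y ((5/4) ^ Suc k * t) \<le> max L 1 * mass w y ((5/4) ^ k * t)"
    using mass_step[OF y, of "(5/4) ^ k * t"] t by (simp add: mult.assoc)
  also have "\<dots> \<le> max L 1 * (max L 1 ^ k * mass w y t)" using Suc by (intro mult_left_mono) auto
  finally show ?case by (simp add: mult.assoc)
qed auto

text \<open>Dilation by l takes about log l to base 5/4 steps, each costing \<open>max L 1\<close>
  \<le> (5/4)^s, so the total cost is a power of l with exponent s. Rounding the number of steps up
  accounts for the extra 5/4.\<close>

lemma mass_growth:
  assumes y: "y \<in> {-1..1}" and t: "t > 0" and l: "l \<ge> 1" and s: "max L 1 \<le> (5/4) ^ s"
  shows "mass w y (l * t) \<le> (5/4 * l) ^ s * mass w y t"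
proof -
  define k where "k = nat \<lceil>log (5/4) l\<rceil>"
  have lg: "0 \<le> log (5/4) l" using l by simp
  have k: "log (5/4) l \<le> k" "real k \<le> log (5/4) l + 1"
    using lg of_int_ceiling_le_add_one[of "log (5/4) l"] unfolding k_def by auto
  have "l = (5/4) powr log (5/4) l" using l by simp
  also have "\<dots> \<le> (5/4) powr (real k)" using k by (intro powr_mono) auto
  finally have l1: "l \<le> (5/4) ^ k" by (simp add: powr_realpow)
  have "(5/4 :: real) ^ k = (5/4) powr (real k)" by (simp add: powr_realpow)
  also have "\<dots> \<le> (5/4) powr (log (5/4) l + 1)" using k by (intro powr_mono) auto
  also have "\<dots> = 5/4 * l" using l by (simp add: powr_add)
  finally have l2: "(5/4 :: real) ^ k \<le> 5/4 * l" .
  have "mass w y (l * t) \<le> mass w y ((5/4) ^ k * t)" using l1 t by (intro mass_mono) auto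
  also have "\<dots> \<le> max L 1 ^ k * mass w y t" by (rule mass_pow[OF y t])
  also have "\<dots> \<le> ((5/4) ^ s) ^ k * mass w y t" using s by (intro mult_right_mono power_mono mass_nonneg) auto
  also have "((5/4 :: real) ^ s) ^ k = ((5/4) ^ k) ^ s" by (simp add: power_mult[symmetric] mult.commute)
  also have "((5/4 :: real) ^ k) ^ s * mass w y t \<le> (5/4 * l) ^ s * mass w y t"
    using l2 by (intro mult_right_mono power_mono mass_nonneg) auto
  finally show ?thesis .
qed

lemma weight_avg_nonneg: "x \<in> {-1..1} \<Longrightarrow> n \<ge> 1 \<Longrightarrow> 0 \<le> weight_avg w n x"
  using mass_nonneg[of x "rho n x"] rho_pos[of x n] by (simp add: weight_avg_mass)

text \<open>The interval of radius \<open>rho n x\<close> around x lies in the one of radius l times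
  \<open>rho n y\<close> around y, with l quadratic in 1 + \<open>reldist n x y\<close>. Growth of
  the mass therefore costs 2s powers, and changing the normalization from \<open>rho n x\<close> to
  \<open>rho n y\<close> one more.\<close>

lemma weight_avg_growth:
  assumes x: "x \<in> {-1..1}" and y: "y \<in> {-1..1}" and n: "n \<ge> 1" and s: "max L 1 \<le> (5/4) ^ s"
  shows "weight_avg w n x \<le> 2 * 8 ^ s * (1 + reldist n x y) ^ (2 * s + 1) * weight_avg w n y"
proof -
  define a where "a = reldist n x y"
  have p: "rho n x > 0" "rho n y > 0" using rho_pos assms by auto
  have a0: "0 \<le> a" using assms reldist_nonneg by (auto simp: a_def)
  \<comment> \<open>The dilation must reach |x - y| + rho(x) = (1 + a) rho(x), and rho(x) / rho(y)
    is at most sqrt 32 times (1 + a); hence the 6.\<close>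
  define l where "l = 6 * (1 + a)\<^sup>2"
  have "(rho n x / rho n y)\<^sup>2 \<le> 4 * (1 + reldist n y x)" by (rule rho_ratio_sq[OF y x n])
  also have "\<dots> \<le> 4 * (8 * (1 + a)\<^sup>2)" unfolding a_def by (intro mult_left_mono reldist_swap x y n) auto
  also have "\<dots> \<le> (6 * (1 + a))\<^sup>2" unfolding power_mult_distrib by simp
  finally have "rho n x / rho n y \<le> 6 * (1 + a)" by (rule power2_le_imp_le) (use a0 in auto)
  then have *: "rho n x * (1 + a) \<le> (6 * (1 + a) * rho n y) * (1 + a)"
    using p a0 by (intro mult_right_mono) (auto simp: divide_le_eq)
  have "(6 * (1 + a) * rho n y) * (1 + a) = l * rho n y" by (simp add: l_def power2_eq_square mult_ac)
  with * have *: "rho n x * (1 + a) \<le> l * rho n y" by argo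
  have D: "\<bar>x - y\<bar> + rho n x \<le> l * rho n y"
  proof -
    have "\<bar>x - y\<bar> = a * rho n x" using p by (simp add: a_def reldist_def)
    then show ?thesis using * by (simp add: algebra_simps)
  qed
  have "1 \<le> (1 + a)\<^sup>2" using a0 by (simp add: one_le_power)
  then have l: "l \<ge> 1" unfolding l_def by linarith
  have "mass w x (rho n x) \<le> mass w y (l * rho n y)" using D by (rule mass_mono)
  also have "\<dots> \<le> (5/4 * l) ^ s * mass w y (rho n y)" by (rule mass_growth[OF y p(2) l s])
  finally have "weight_avg w n x \<le> ((5/4 * l) ^ s * mass w y (rho n y)) / rho n x"
    using p by (simp add: weight_avg_mass divide_right_mono)
  also have "\<dots> = (5/4 * l) ^ s * weight_avg w n y * (rho n y / rho n x)"
    using p by (simp add: weight_avg_mass)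
  also have "\<dots> \<le> (5/4 * l) ^ s * weight_avg w n y * (2 * (1 + a))"
    using l rho_ratio_le[OF x y n] weight_avg_nonneg[OF y n] by (intro mult_left_mono mult_nonneg_nonneg) (auto simp: a_def)
  also have "\<dots> \<le> (8 * (1 + a)\<^sup>2) ^ s * weight_avg w n y * (2 * (1 + a))"
    using l a0 weight_avg_nonneg[OF y n] by (intro mult_right_mono power_mono) (simp_all add: l_def)
  also have "\<dots> = 2 * 8 ^ s * (1 + a) ^ (2 * s + 1) * weight_avg w n y"
    by (simp add: power_mult_distrib power_mult power_add)
  finally show ?thesis unfolding a_def .
qed

text \<open>The mass shrinks with the interval, so only the normalization is lost. The ratio of the
  scales reaches (n/m)^2 at the endpoints, more than the final exponent can afford; the compensation
  is \<open>ratio_powr_le\<close>.\<close>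

lemma weight_avg_mono_n:
  assumes x: "x \<in> {-1..1}" and "1 \<le> m" "m \<le> n"
  shows "weight_avg w n x \<le> rho m x / rho n x * weight_avg w m x"
proof -
  have p: "rho n x > 0" "rho m x > 0" using rho_pos assms by auto
  have "mass w x (rho n x) \<le> mass w x (rho m x)" using rho_antimono assms by (intro mass_mono) auto
  then have "mass w x (rho n x) / rho n x \<le> mass w x (rho m x) / rho n x" using p by (intro divide_right_mono) auto
  then show ?thesis using p by (simp add: weight_avg_mass)
qed

lemma weight_avg_le_4:
  assumes x: "x \<in> {-1..1}" and "1 \<le> m" "m \<le> n" "n \<le> 2 * m"
  shows "weight_avg w n x \<le> 4 * weight_avg w m x"
proof -
  have p: "rho n x > 0" using rho_pos assms by auto
  have "weight_avg w n x \<le> rho m x / rho n x * weight_avg w m x" using assms by (intro weight_avg_mono_n)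
  also have "\<dots> \<le> 4 * weight_avg w m x"
    using rho_le_4[of m n x] assms p by (intro mult_right_mono weight_avg_nonneg) (auto simp: divide_le_eq)
  finally show ?thesis .
qed

lemma continuous_on_weight_avg:
  assumes n: "n \<ge> 1"
  shows "continuous_on {-1..1} (weight_avg w n)"
proof -
  have io: "w integrable_on {a..b}" for a b
    using set_lebesgue_integral_eq_integral(1)[OF dw_integrable[of "{a..b}"]] by auto
  \<comment> \<open>Since \<open>rho n x\<close> \<le> 2, both ends of every averaging interval lie
    in [-3,3], and one primitive based at -3 serves all of them.\<close>
  define F where "F t = integral {-3..t} w" for t
  have F: "continuous_on {-3..3} F" unfolding F_def by (rule indefinite_integral_continuous_1[OF io])
  have m: "mass w x t = F (x + t) - F (x - t)" if "-3 \<le> x - t" "0 \<le> t" for x t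
  proof -
    have "mass w x t = integral {x - t..x + t} w" unfolding mass_def
      using set_lebesgue_integral_eq_integral(2)[OF dw_integrable[of "{x - t..x+t}"]] by auto
    moreover have "integral {-3..x - t} w + integral {x - t..x + t} w = integral {-3..x + t} w"
      using that by (intro Henstock_Kurzweil_Integration.integral_combine io) auto
    ultimately show ?thesis by (simp add: F_def)
  qed
  have r: "0 < rho n x" "rho n x \<le> 2" if "x \<in> {-1..1}" for x
    using rho_pos[OF that n] rho_le_2[OF n] by auto
  have "continuous_on {-1..1} (\<lambda>x. F (x + rho n x))"
    by (rule continuous_on_compose2[OF F]) (intro continuous_intros continuous_on_rho n, use r in fastforce)
  moreover have "continuous_on {-1..1} (\<lambda>x. F (x - rho n x))"
    by (rule continuous_on_compose2[OF F]) (intro continuous_intros continuous_on_rho n, use r in fastforce)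
  moreover have "\<forall>x\<in>{-1..1}. rho n x \<noteq> 0" using r by fastforce
  ultimately have "continuous_on {-1..1} (\<lambda>x. (F (x + rho n x) - F (x - rho n x)) / rho n x)"
    by (intro continuous_on_divide continuous_on_diff continuous_on_rho n)
  moreover have "(F (x + rho n x) - F (x - rho n x)) / rho n x = weight_avg w n x" if "x \<in> {-1..1}" for x
    using r[OF that] m[of x "rho n x"] that by (simp add: weight_avg_mass)
  ultimately show ?thesis by (rule continuous_on_eq)
qed

end

section \<open>Weighted norms\<close>

text \<open>Convexity of t^q in tangent form, so that it can be integrated: it gives both the
  triangle inequality and Jensen's inequality. The point t = 0 is separate because the convexity
  fact lives on the open half-line.\<close>

lemma powr_tangent:
  fixes q s t :: real
  assumes "q \<ge> 1" "s > 0" "t \<ge> 0"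
  shows "s powr q + q * s powr (q - 1) * (t - s) \<le> t powr q"
proof (cases "t = 0")
  case True
  have "s powr q + q * s powr (q - 1) * (0 - s) = (1 - q) * s powr q"
    using assms by (simp add: powr_diff algebra_simps)
  also have "\<dots> \<le> 0" using assms by (intro mult_nonpos_nonneg) auto
  finally show ?thesis using True by simp
next
  case False
  have "t powr q - s powr q \<ge> (q * s powr (q - 1)) * (t - s)"
  proof (rule convex_on_imp_above_tangent[OF powr_convex[OF assms(1)]])
    show "((\<lambda>x. x powr q) has_real_derivative q * s powr (q - 1)) (at s within {0<..})"
      using assms by (auto intro!: derivative_eq_intros)
  qed (use assms False in \<open>auto simp: interior_open\<close>)
  then show ?thesis by simp
qed

text \<open>Jensen for (a + b)/(A + B) as the mean of a/A and b/B with weights A and B. With A and B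
  in the role of the norms, integrating it yields Minkowski's inequality.\<close>

lemma powr_add_le_weighted:
  fixes a b A B q :: real
  assumes "q \<ge> 1" "a \<ge> 0" "b \<ge> 0" "A > 0" "B > 0"
  shows "(a + b) powr q \<le> (A + B) powr q * (A / (A + B) * (a powr q / A powr q) + B / (A + B) * (b powr q / B powr q))"
proof (cases "a + b = 0")
  case True then show ?thesis using assms by simp
next
  case False
  define s where "s = (a + b) / (A + B)"
  have s: "s > 0" using assms False by (simp add: s_def)
  define k where "k = q * s powr (q - 1)"
  \<comment> \<open>The tangents are taken at the mean s, so their linear parts cancel.\<close>
  have "A * (s powr q + k * (a / A - s)) + B * (s powr q + k * (b / B - s)) \<le> A * ((a / A) powr q) + B * ((b / B) powr q)"
    unfolding k_def using assms s by (intro add_mono mult_left_mono powr_tangent) auto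
  also have "A * (s powr q + k * (a / A - s)) + B * (s powr q + k * (b / B - s))
      = (A + B) * s powr q + k * (a + b - (A + B) * s)"
    using assms by (simp add: algebra_simps)
  also have "a + b - (A + B) * s = 0" using assms by (simp add: s_def)
  finally have "(A + B) powr q * (s powr q) \<le> (A + B) powr q * ((A * (a / A) powr q + B * (b / B) powr q) / (A + B))"
    using assms by (intro mult_left_mono) (simp_all add: le_divide_eq mult.commute)
  also have "(A + B) powr q * (s powr q) = (a + b) powr q"
    using assms s by (simp add: powr_mult[symmetric] s_def)
  finally show ?thesis using assms by (simp add: powr_divide add_divide_distrib mult.commute)
qed

section \<open>Comparison and triangle inequality for the weighted norm\<close>

abbreviation leb1 :: "real measure" where "leb1 \<equiv> lebesgue_on {-1..1}"

text \<open>Removes the root: a finite bound on the norm becomes a bound on an integral, the form in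
  which the estimates for finite exponents are proved.\<close>

lemma wnorm_le_iff:
  fixes q B :: real
  assumes "q \<ge> 1" "B \<ge> 0"
  shows "wnorm (ennreal q) v g \<le> ennreal B \<longleftrightarrow> (\<integral>\<^sup>+ x. ennreal (\<bar>g x\<bar> powr q * v x) \<partial>leb1) \<le> ennreal (B powr q)"
proof -
  define I where "I = (\<integral>\<^sup>+ x. ennreal (\<bar>g x\<bar> powr q * v x) \<partial>leb1)"
  have "ennreal_powr I (1 / q) \<le> ennreal B \<longleftrightarrow> I \<le> ennreal (B powr q)"
  proof (cases I)
    case (real i)
    have "i powr (1 / q) \<le> B \<longleftrightarrow> i \<le> B powr q"
    proof
      assume "i powr (1 / q) \<le> B"
      then have "(i powr (1 / q)) powr q \<le> B powr q" using assms by (intro powr_mono2) auto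
      then show "i \<le> B powr q" using real assms by (simp add: powr_powr)
    next
      assume "i \<le> B powr q"
      then have "i powr (1 / q) \<le> (B powr q) powr (1 / q)" using assms real by (intro powr_mono2) auto
      then show "i powr (1 / q) \<le> B" using real assms by (simp add: powr_powr)
    qed
    then show ?thesis using real assms by (simp add: ennreal_powr_def)
  qed (simp add: ennreal_powr_def top_unique)
  then show ?thesis using assms by (simp add: wnorm_def I_def)
qed

text \<open>Measurability matters here because \<open>esssup\<close> is \<open>top\<close> on
  nonmeasurable functions.\<close>

lemma wnorm_le_infinity_iff:
  assumes "(\<lambda>x. \<bar>g x\<bar> * v x) \<in> borel_measurable leb1" "B \<ge> 0"
  shows "wnorm \<infinity> v g \<le> ennreal B \<longleftrightarrow> (AE x in leb1. \<bar>g x\<bar> * v x \<le> B)"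
proof
  assume *: "wnorm \<infinity> v g \<le> ennreal B"
  have "AE x in leb1. ennreal (\<bar>g x\<bar> * v x) \<le> wnorm \<infinity> v g"
    using esssup_AE[of "\<lambda>x. ennreal (\<bar>g x\<bar> * v x)" leb1] by (simp add: wnorm_def)
  then show "AE x in leb1. \<bar>g x\<bar> * v x \<le> B"
  proof eventually_elim
    case (elim x)
    then have "ennreal (\<bar>g x\<bar> * v x) \<le> ennreal B" using * by (rule order_trans)
    then show ?case using assms by (simp add: ennreal_le_iff)
  qed
next
  have m: "(\<lambda>x. ennreal (\<bar>g x\<bar> * v x)) \<in> borel_measurable leb1" using assms(1) by measurable
  assume "AE x in leb1. \<bar>g x\<bar> * v x \<le> B"
  then have "AE x in leb1. ennreal (\<bar>g x\<bar> * v x) \<le> ennreal B" by eventually_elim (rule ennreal_leI)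
  then show "wnorm \<infinity> v g \<le> ennreal B" unfolding wnorm_def using esssup_I[OF m] by simp
qed

lemma ennreal_ge1_cases:
  assumes "1 \<le> (p :: ennreal)"
  obtains "p = \<infinity>" | q where "q \<ge> 1" "p = ennreal q"
  using assms by (cases p) auto

context
  fixes v :: "real \<Rightarrow> real"
  assumes v[measurable]: "v \<in> borel_measurable leb1" and v0: "\<And>x. x \<in> {-1..1} \<Longrightarrow> 0 \<le> v x"
begin

text \<open>A common comparison principle for all exponents. The two hypotheses differ because the
  weight enters to the first power for every p: a constant K of the norm appears as K^p under the
  integral but as K in the supremum.\<close>

lemma wnorm_le_transfer:
  assumes p: "1 \<le> p" and K: "K \<ge> 0" and [measurable]: "g \<in> borel_measurable leb1"
    and u[measurable]: "u \<in> borel_measurable leb1" "\<And>x. x \<in> {-1..1} \<Longrightarrow> 0 \<le> u x"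
    and le: "\<And>x. x \<in> {-1..1} \<Longrightarrow> p \<noteq> \<infinity> \<Longrightarrow> \<bar>g x\<bar> powr enn2real p * v x \<le> K powr enn2real p * (\<bar>h x\<bar> powr enn2real p * u x)"
    and le': "\<And>x. x \<in> {-1..1} \<Longrightarrow> p = \<infinity> \<Longrightarrow> \<bar>g x\<bar> * v x \<le> K * (\<bar>h x\<bar> * u x)"
    and [measurable]: "h \<in> borel_measurable leb1"
  shows "wnorm p v g \<le> ennreal K * wnorm p u h"
  using p
proof (cases rule: ennreal_ge1_cases)
  case 1
  show ?thesis
  proof (cases "wnorm p u h")
    case top
    \<comment> \<open>In \<open>ennreal\<close>, \<open>0 * top = 0\<close>, so for K = 0 an
      infinite norm on the right does not make the bound trivial.\<close>
    show ?thesis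
    proof (cases "K = 0")
      case True
      have "AE x in leb1. \<bar>g x\<bar> * v x \<le> 0"
        using le' 1 True by (intro AE_I2) auto
      then have "wnorm p v g \<le> ennreal 0" unfolding 1 by (subst wnorm_le_infinity_iff) auto
      then show ?thesis by simp
    qed (use top K in \<open>simp add: ennreal_mult_top\<close>)
  next
    case (real B)
    then have "AE x in leb1. \<bar>h x\<bar> * u x \<le> B" using wnorm_le_infinity_iff[of h u B] 1 by simp
    moreover have "AE x in leb1. x \<in> {-1..1}" by (rule AE_I2) auto
    ultimately have "AE x in leb1. \<bar>g x\<bar> * v x \<le> K * B"
    proof eventually_elim
      case (elim x)
      have "K * (\<bar>h x\<bar> * u x) \<le> K * B" using elim K by (intro mult_left_mono) auto
      then show ?case using le'[of x] elim 1 by linarith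
    qed
    then have "wnorm p v g \<le> ennreal (K * B)" unfolding 1 using K real by (subst wnorm_le_infinity_iff) auto
    then show ?thesis using real K by (simp add: ennreal_mult)
  qed
next
  case (2 q)
  have "wnorm p v g \<le> ennreal K * wnorm p u h" if hB: "wnorm p u h = ennreal B" "B \<ge> 0" for B
  proof -
    have I: "(\<integral>\<^sup>+ x. ennreal (\<bar>h x\<bar> powr q * u x) \<partial>leb1) \<le> ennreal (B powr q)"
      using wnorm_le_iff[of q B u h] 2 hB by simp
    have "(\<integral>\<^sup>+ x. ennreal (\<bar>g x\<bar> powr q * v x) \<partial>leb1) \<le> (\<integral>\<^sup>+ x. ennreal (K powr q) * ennreal (\<bar>h x\<bar> powr q * u x) \<partial>leb1)"
      using le 2 by (intro nn_integral_mono) (auto simp: ennreal_mult'[symmetric] intro!: ennreal_leI)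
    also have "\<dots> = ennreal (K powr q) * (\<integral>\<^sup>+ x. ennreal (\<bar>h x\<bar> powr q * u x) \<partial>leb1)"
      by (rule nn_integral_cmult) measurable
    also have "\<dots> \<le> ennreal (K powr q) * ennreal (B powr q)" by (intro mult_left_mono I) auto
    also have "\<dots> = ennreal ((K * B) powr q)" using K hB by (simp add: powr_mult ennreal_mult)
    finally have "wnorm p v g \<le> ennreal (K * B)" unfolding 2 using K hB 2 by (subst wnorm_le_iff) auto
    then show ?thesis using hB K by (simp add: ennreal_mult)
  qed
  moreover have "wnorm p v g \<le> ennreal K * wnorm p u h" if hB: "wnorm p u h = top"
  proof (cases "K = 0")
    case True
    have "(\<integral>\<^sup>+ x. ennreal (\<bar>g x\<bar> powr q * v x) \<partial>leb1) \<le> (\<integral>\<^sup>+ x. 0 \<partial>leb1)"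
      using le 2 True by (intro nn_integral_mono) (fastforce simp: ennreal_neg)
    then have "wnorm p v g \<le> ennreal 0" unfolding 2 using 2 by (subst wnorm_le_iff) auto
    then show ?thesis by simp
  qed (use hB K in \<open>simp add: ennreal_mult_top\<close>)
  ultimately show ?thesis by (cases "wnorm p u h") auto
qed

lemma wnorm_triangle:
  assumes p: "1 \<le> p" and [measurable]: "g \<in> borel_measurable leb1" "h \<in> borel_measurable leb1"
  shows "wnorm p v (\<lambda>x. g x + h x) \<le> wnorm p v g + wnorm p v h"
proof (cases "wnorm p v g = top \<or> wnorm p v h = top")
  case False
  then obtain A0 B0 where AB0: "wnorm p v g = ennreal A0" "A0 \<ge> 0" "wnorm p v h = ennreal B0" "B0 \<ge> 0"
    by (cases "wnorm p v g"; cases "wnorm p v h") auto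
  \<comment> \<open>Positive majorants A and B replace the norms, which may vanish, because the
    coefficients below divide by them. The slack is removed at the end.\<close>
  have main: "wnorm p v (\<lambda>x. g x + h x) \<le> ennreal (A + B)" if AB: "A > 0" "B > 0" "A0 \<le> A" "B0 \<le> B" for A B
    using p
  proof (cases rule: ennreal_ge1_cases)
    case 1
    have "AE x in leb1. \<bar>g x\<bar> * v x \<le> A" using AB0 AB 1 by (subst wnorm_le_infinity_iff[symmetric]) (auto intro!: ennreal_leI)
    moreover have "AE x in leb1. \<bar>h x\<bar> * v x \<le> B" using AB0 AB 1 by (subst wnorm_le_infinity_iff[symmetric]) (auto intro!: ennreal_leI)
    moreover have "AE x in leb1. x \<in> {-1..1}" by (rule AE_I2) auto
    ultimately have "AE x in leb1. \<bar>g x + h x\<bar> * v x \<le> A + B"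
    proof eventually_elim
      case (elim x)
      have "\<bar>g x + h x\<bar> * v x \<le> (\<bar>g x\<bar> + \<bar>h x\<bar>) * v x" using v0[of x] elim by (intro mult_right_mono) auto
      then show ?case using elim by (simp add: algebra_simps)
    qed
    then show ?thesis unfolding 1 using AB by (subst wnorm_le_infinity_iff) auto
  next
    case (2 q)
    let ?I = "\<lambda>g. (\<integral>\<^sup>+ x. ennreal (\<bar>g x\<bar> powr q * v x) \<partial>leb1)"
    have I: "?I g \<le> ennreal (A powr q)" "?I h \<le> ennreal (B powr q)"
      using AB0 AB 2 by (auto simp flip: wnorm_le_iff simp: ennreal_leI)
    \<comment> \<open>Chosen so that a A^q + b B^q = (A + B)^q.\<close>
    define a b where "a = (A + B) powr q * (A / (A + B)) / A powr q" and "b = (A + B) powr q * (B / (A + B)) / B powr q"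
    have ab: "a \<ge> 0" "b \<ge> 0" using AB by (auto simp: a_def b_def)
    have "?I (\<lambda>x. g x + h x) \<le> (\<integral>\<^sup>+ x. ennreal a * ennreal (\<bar>g x\<bar> powr q * v x) + ennreal b * ennreal (\<bar>h x\<bar> powr q * v x) \<partial>leb1)"
    proof (rule nn_integral_mono)
      fix x assume "x \<in> space leb1"
      then have x: "0 \<le> v x" using v0[of x] by simp
      have "\<bar>g x + h x\<bar> powr q \<le> (\<bar>g x\<bar> + \<bar>h x\<bar>) powr q" using 2 by (intro powr_mono2) auto
      also have "\<dots> \<le> a * \<bar>g x\<bar> powr q + b * \<bar>h x\<bar> powr q"
        using powr_add_le_weighted[OF 2(1), of "\<bar>g x\<bar>" "\<bar>h x\<bar>" A B] AB
        by (simp add: a_def b_def distrib_left mult_ac)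
      finally have "\<bar>g x + h x\<bar> powr q * v x \<le> (a * \<bar>g x\<bar> powr q + b * \<bar>h x\<bar> powr q) * v x" using x by (intro mult_right_mono)
      also have "\<dots> = a * (\<bar>g x\<bar> powr q * v x) + b * (\<bar>h x\<bar> powr q * v x)" by (simp add: algebra_simps)
      finally have "ennreal (\<bar>g x + h x\<bar> powr q * v x) \<le> ennreal (a * (\<bar>g x\<bar> powr q * v x) + b * (\<bar>h x\<bar> powr q * v x))" by (rule ennreal_leI)
      also have "\<dots> = ennreal a * ennreal (\<bar>g x\<bar> powr q * v x) + ennreal b * ennreal (\<bar>h x\<bar> powr q * v x)"
        using x ab by (simp add: ennreal_mult' ennreal_plus)
      finally show "ennreal (\<bar>g x + h x\<bar> powr q * v x) \<le> ennreal a * ennreal (\<bar>g x\<bar> powr q * v x) + ennreal b * ennreal (\<bar>h x\<bar> powr q * v x)" .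
    qed
    also have "\<dots> = ennreal a * ?I g + ennreal b * ?I h"
      by (subst nn_integral_add) (auto simp: nn_integral_cmult)
    also have "\<dots> \<le> ennreal a * ennreal (A powr q) + ennreal b * ennreal (B powr q)"
      by (intro add_mono mult_left_mono I) auto
    also have "\<dots> = ennreal (a * A powr q + b * B powr q)" using ab by (simp add: ennreal_mult)
    also have "a * A powr q + b * B powr q = (A + B) powr q"
      using AB by (simp add: a_def b_def add_divide_distrib[symmetric] distrib_left[symmetric])
    finally show ?thesis unfolding 2 using AB 2 by (subst wnorm_le_iff) auto
  qed
  show ?thesis
  proof (rule ennreal_le_epsilon)
    fix e :: real assume e: "e > 0"
    have "wnorm p v (\<lambda>x. g x + h x) \<le> ennreal ((A0 + e / 2) + (B0 + e / 2))"
      using e AB0 by (intro main) auto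
    also have "(A0 + e / 2) + (B0 + e / 2) = A0 + B0 + e" by simp
    finally show "wnorm p v (\<lambda>x. g x + h x) \<le> wnorm p v g + wnorm p v h + ennreal e"
      using AB0 e by simp
  qed
qed auto

lemma wnorm_zero: "1 \<le> p \<Longrightarrow> wnorm p v (\<lambda>x. 0) = 0"
  using wnorm_le_transfer[of p 0 "\<lambda>x. 0" v "\<lambda>x. 0"] v0 by simp

lemma wnorm_cmult:
  assumes p: "1 \<le> p" and [measurable]: "g \<in> borel_measurable leb1"
  shows "wnorm p v (\<lambda>x. c * g x) \<le> ennreal \<bar>c\<bar> * wnorm p v g"
  by (rule wnorm_le_transfer[OF p]) (auto simp: v0 abs_mult powr_mult)

lemma wnorm_sum:
  assumes p: "1 \<le> p" and "finite I" "\<And>i. i \<in> I \<Longrightarrow> g i \<in> borel_measurable leb1"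
  shows "wnorm p v (\<lambda>x. \<Sum>i\<in>I. g i x) \<le> (\<Sum>i\<in>I. wnorm p v (g i))"
  using assms(2,3)
proof (induction I rule: finite_induct)
  case empty
  then show ?case using wnorm_zero[OF p] by simp
next
  case (insert i I)
  have [measurable]: "g i \<in> borel_measurable leb1" "(\<lambda>x. \<Sum>j\<in>I. g j x) \<in> borel_measurable leb1"
    using insert by (auto intro!: borel_measurable_sum)
  have "wnorm p v (\<lambda>x. \<Sum>j\<in>insert i I. g j x) = wnorm p v (\<lambda>x. g i x + (\<Sum>j\<in>I. g j x))"
    using insert by simp
  also have "\<dots> \<le> wnorm p v (g i) + wnorm p v (\<lambda>x. \<Sum>j\<in>I. g j x)"
    by (rule wnorm_triangle[OF p]) measurable
  also have "\<dots> \<le> wnorm p v (g i) + (\<Sum>j\<in>I. wnorm p v (g j))"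
    using insert by (intro add_left_mono) auto
  finally show ?case using insert by simp
qed

end

text \<open>For finite p the comparison of the weights gives the factor K^(1/p); since K \<ge> 1,
  the plain K covers it and the supremum norm alike.\<close>

lemma wnorm_weight_mono:
  assumes p: "1 \<le> p" and K: "K \<ge> 1" and [measurable]: "g \<in> borel_measurable leb1"
    and [measurable]: "v \<in> borel_measurable leb1" "u \<in> borel_measurable leb1"
    and u: "\<And>x. x \<in> {-1..1} \<Longrightarrow> 0 \<le> u x" and v: "\<And>x. x \<in> {-1..1} \<Longrightarrow> 0 \<le> v x"
    and le: "\<And>x. x \<in> {-1..1} \<Longrightarrow> v x \<le> K * u x"
  shows "wnorm p v g \<le> ennreal K * wnorm p u g"
proof (rule wnorm_le_transfer[OF _ v p])
  fix x :: real assume x: "x \<in> {-1..1}"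
  show "\<bar>g x\<bar> * v x \<le> K * (\<bar>g x\<bar> * u x)"
    using mult_left_mono[OF le[OF x], of "\<bar>g x\<bar>"] by (simp add: mult_ac)
  assume "p \<noteq> \<infinity>"
  then have "enn2real p \<ge> 1" using p by (cases p) auto
  then have "K powr 1 \<le> K powr enn2real p" using K by (intro powr_mono) auto
  then have "K * u x \<le> K powr enn2real p * u x" using K u[OF x] by (intro mult_right_mono) auto
  then have "v x \<le> K powr enn2real p * u x" using le[OF x] by linarith
  from mult_left_mono[OF this, of "\<bar>g x\<bar> powr enn2real p"]
  show "\<bar>g x\<bar> powr enn2real p * v x \<le> K powr enn2real p * (\<bar>g x\<bar> powr enn2real p * u x)"
    by (simp add: mult_ac)
qed (use K u in auto)

section \<open>Reproducing formula on the unit circle\<close>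

lemma has_integral_cis:
  "((\<lambda>t. cis (of_int k * t)) has_integral (if k = 0 then 2 * of_real pi else 0)) {-pi..pi}"
proof (cases "k = 0")
  case True
  have "((\<lambda>t::real. 1::complex) has_integral (pi - - pi) *\<^sub>R 1) {-pi..pi}"
    using has_integral_const_real[of "1::complex" "-pi" pi] by simp
  then show ?thesis using True by (simp add: scaleR_conv_of_real)
next
  case False
  define c where "c = \<i> * of_int k"
  have c: "c \<noteq> 0" using False by (simp add: c_def)
  have e: "cis (of_int k * t) = exp (c * of_real t)" for t :: real
    by (simp add: cis_conv_exp c_def mult.assoc)
  define F where "F t = exp (c * of_real t) / c" for t :: real
  have *: "((\<lambda>t. cis (of_int k * t)) has_integral (F pi - F (-pi))) {-pi..pi}"
  proof (rule fundamental_theorem_of_calculus)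
    fix t
    have "((\<lambda>z. exp (c * z) / c) has_field_derivative exp (c * of_real t)) (at (of_real t))"
      using c by (auto intro!: derivative_eq_intros)
    from has_vector_derivative_real_field[OF this]
    show "(F has_vector_derivative cis (of_int k * t)) (at t within {-pi..pi})"
      unfolding F_def e .
  qed auto
  have "cis (of_int k * pi) = cis (of_int k * (-pi))"
    by (simp add: complex_eq_iff mult.commute[of _ pi])
  then have "F pi - F (-pi) = 0" unfolding F_def e[symmetric] by simp
  then show ?thesis using False * by simp
qed

lemma poly_eq_sum_atMost:
  fixes p :: "'a :: comm_semiring_1 poly"
  assumes "degree p \<le> N"
  shows "poly p z = (\<Sum>i\<le>N. coeff p i * z ^ i)"
  unfolding poly_altdef by (intro sum.mono_neutral_left) (use assms in \<open>auto simp: coeff_eq_0\<close>)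

text \<open>Orthogonality of the exponentials. The second factor is the reproducing kernel of the
  polynomials of degree at most N on the circle; unlike Cauchy's formula, the identity holds for |w|
  > 1 as well.\<close>

lemma poly_reproduce:
  fixes H :: "complex poly"
  assumes "degree H \<le> N"
  shows "((\<lambda>t. poly H (cis t) * (\<Sum>j\<le>N. w ^ j * cis (- (real j * t)))) has_integral 2 * of_real pi * poly H w) {-pi..pi}"
proof -
  have ev: "poly H z = (\<Sum>i\<le>N. coeff H i * z ^ i)" for z
    by (rule poly_eq_sum_atMost[OF assms])
  have "((\<lambda>t. \<Sum>i\<le>N. \<Sum>j\<le>N. (coeff H i * w ^ j) * cis (of_int (int i - int j) * t))
      has_integral (\<Sum>i\<le>N. \<Sum>j\<le>N. (coeff H i * w ^ j) * (if int i - int j = 0 then 2 * of_real pi else 0))) {-pi..pi}"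
    by (intro has_integral_sum finite_atMost has_integral_mult_right has_integral_cis)
  also have "(\<Sum>i\<le>N. \<Sum>j\<le>N. (coeff H i * w ^ j) * (if int i - int j = 0 then 2 * of_real pi else 0))
      = (\<Sum>i\<le>N. \<Sum>j\<le>N. if j = i then (coeff H i * w ^ i) * (2 * of_real pi) else 0)"
    by (intro sum.cong refl) auto
  also have "\<dots> = 2 * of_real pi * poly H w" by (simp add: ev sum_distrib_left mult_ac)
  also have "(\<lambda>t. \<Sum>i\<le>N. \<Sum>j\<le>N. (coeff H i * w ^ j) * cis (of_int (int i - int j) * t))
     = (\<lambda>t. poly H (cis t) * (\<Sum>j\<le>N. w ^ j * cis (- (real j * t))))"
    by (simp add: ev sum_product fun_eq_iff Complex.DeMoivre left_diff_distrib mult_ac flip: cis_mult)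
       (simp add: cis_mult right_diff_distrib)
  finally show ?thesis .
qed

text \<open>The kernel is bounded crudely by (N + 1)|w|^N. This is harmless later: N is of order m,
  |w|^N stays bounded for |w| = 1 + O(1/m), and the factor N + 1 is cancelled by an m in the lower
  bound for |w^2 - 1|.\<close>

lemma poly_outside_disc_bound:
  fixes H :: "complex poly"
  assumes "degree H \<le> N" "cmod w \<ge> 1" "continuous_on {-pi..pi} b" "\<And>t. t \<in> {-pi..pi} \<Longrightarrow> cmod (poly H (cis t)) \<le> b t"
  shows "cmod (poly H w) \<le> (real N + 1) * cmod w ^ N * integral {-pi..pi} b"
proof -
  let ?K = "(real N + 1) * cmod w ^ N"
  have i: "b integrable_on {-pi..pi}" using assms(3) by (rule integrable_continuous_real)
  have iK: "(\<lambda>t. ?K * b t) integrable_on {-pi..pi}"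
    using has_integral_mult_right[OF integrable_integral[OF i], of ?K] by (rule has_integral_integrable)
  have "cmod (integral {-pi..pi} (\<lambda>t. poly H (cis t) * (\<Sum>j\<le>N. w ^ j * cis (- (real j * t)))))
      \<le> integral {-pi..pi} (\<lambda>t. ?K * b t)"
  proof (rule integral_norm_bound_integral)
    fix t assume t: "t \<in> {-pi..pi}"
    have "cmod (\<Sum>j\<le>N. w ^ j * cis (- (real j * t))) \<le> (\<Sum>j\<le>N. cmod w ^ N)"
      using assms(2) by (intro sum_norm_le) (simp add: norm_mult norm_power power_increasing)
    then have "cmod (\<Sum>j\<le>N. w ^ j * cis (- (real j * t))) \<le> ?K" by (simp add: add.commute)
    then show "cmod (poly H (cis t) * (\<Sum>j\<le>N. w ^ j * cis (- (real j * t)))) \<le> ?K * b t"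
      using mult_mono[OF assms(4)[OF t] _ order_trans[OF norm_ge_zero assms(4)[OF t]] norm_ge_zero]
      by (simp only: norm_mult mult.commute[of ?K])
  qed (use poly_reproduce[OF assms(1), of w] iK in \<open>auto simp: has_integral_integrable\<close>)
  also have "integral {-pi..pi} (\<lambda>t. poly H (cis t) * (\<Sum>j\<le>N. w ^ j * cis (- (real j * t)))) = 2 * of_real pi * poly H w"
    by (rule integral_unique[OF poly_reproduce[OF assms(1)]])
  finally have "2 * pi * cmod (poly H w) \<le> ?K * integral {-pi..pi} b" by (simp add: norm_mult)
  moreover have "1 * cmod (poly H w) \<le> 2 * pi * cmod (poly H w)" using pi_gt3 by (intro mult_right_mono) auto
  ultimately show ?thesis by linarith
qed

section \<open>The substitution y = cos t and the Joukowski map\<close>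

lemma integral_abs_sin_cos:
  assumes "continuous_on {-1..1} g"
  shows "((\<lambda>t. \<bar>sin t\<bar> * g (cos t)) has_integral 2 * integral {-1..1} g) {-pi..pi}"
proof -
  have "((\<lambda>t. (- sin t) *\<^sub>R g (cos t)) has_integral (integral {cos (-pi)..cos 0} g)) {-pi..0}"
    by (rule has_integral_substitution[where c="-1" and d=1])
       (auto intro!: derivative_eq_intros assms simp: pi_ge_zero)
  then have 1: "((\<lambda>t. \<bar>sin t\<bar> * g (cos t)) has_integral (integral {-1..1} g)) {-pi..0}"
  proof (rule has_integral_eq_rhs[OF has_integral_eq[rotated]])
    show "(- sin t) *\<^sub>R g (cos t) = \<bar>sin t\<bar> * g (cos t)" if "t \<in> {-pi..0}" for t
      using sin_ge_zero[of "- t"] that by simp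
  qed simp
  then have "((\<lambda>t. \<bar>sin (- t)\<bar> * g (cos (- t))) has_integral (integral {-1..1} g)) {- 0..- (- pi)}"
    by (subst has_integral_reflect_real)
  then have 2: "((\<lambda>t. \<bar>sin t\<bar> * g (cos t)) has_integral (integral {-1..1} g)) {0..pi}" by simp
  show ?thesis using has_integral_combine[OF _ _ 1 2] by (simp add: pi_ge_zero)
qed

text \<open>This is w^m Q((w + 1/w)/2) with the poles cleared: \<open>[:1/2, 0, 1/2:]\<close> is w
  times (w + 1/w)/2.\<close>

definition joukowski_poly :: "nat \<Rightarrow> real poly \<Rightarrow> complex poly" where
  "joukowski_poly m Q = (\<Sum>i\<le>m. smult (of_real (coeff Q i)) (monom 1 (m - i) * [:1/2, 0, 1/2:] ^ i))"

lemma degree_joukowski_poly: "degree (joukowski_poly m Q) \<le> 2 * m"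
  unfolding joukowski_poly_def
proof (rule degree_sum_le)
  fix i assume i: "i \<in> {..m}"
  have "degree ([:1/2, 0, 1/2:] ^ i :: complex poly) \<le> 2 * i"
    using degree_power_le[of "[:1/2, 0, 1/2:] :: complex poly" i] by simp
  then have "degree (monom 1 (m - i) * [:1/2, 0, 1/2:] ^ i :: complex poly) \<le> (m - i) + 2 * i"
    by (intro order_trans[OF degree_mult_le] add_mono degree_monom_le)
  then show "degree (smult (of_real (coeff Q i)) (monom 1 (m - i) * [:1/2, 0, 1/2:] ^ i) :: complex poly) \<le> 2 * m"
    using i by (intro order_trans[OF degree_smult_le]) auto
qed auto

lemma poly_joukowski_poly:
  assumes "degree Q \<le> m" "w \<noteq> 0"
  shows "poly (joukowski_poly m Q) w = w ^ m * poly (map_poly of_real Q) ((w + 1 / w) / 2)"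
proof -
  have ev: "poly (map_poly of_real Q) z = (\<Sum>i\<le>m. of_real (coeff Q i) * z ^ i)" for z :: complex
    using poly_eq_sum_atMost[OF order_trans[OF map_poly_degree_leq[of complex_of_real Q] assms(1)], of z]
    by (simp add: coeff_map_poly)
  have "poly (joukowski_poly m Q) w = (\<Sum>i\<le>m. of_real (coeff Q i) * (w ^ (m - i) * (1/2 + w * (w * (1/2))) ^ i))"
    by (simp add: joukowski_poly_def poly_sum poly_monom)
  also have "\<dots> = (\<Sum>i\<le>m. w ^ m * (of_real (coeff Q i) * ((w + 1 / w) / 2) ^ i))"
  proof (rule sum.cong)
    fix i assume "i \<in> {..m}"
    then have "w ^ m = w ^ (m - i) * w ^ i" by (simp flip: power_add)
    moreover have "1/2 + w * (w * (1/2)) = w * ((w + 1 / w) / 2)" using assms(2) by (simp add: field_simps)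
    ultimately show "of_real (coeff Q i) * (w ^ (m - i) * (1/2 + w * (w * (1/2))) ^ i) = w ^ m * (of_real (coeff Q i) * ((w + 1 / w) / 2) ^ i)"
      by (simp only: power_mult_distrib mult_ac)
  qed auto
  finally show ?thesis by (simp add: ev sum_distrib_left)
qed

text \<open>A one-sided Dirichlet kernel normalized to be 1 at z = w. Its powers localize a
  polynomial on the circle near w at scale 1/m.\<close>

definition dirichlet_poly :: "nat \<Rightarrow> complex \<Rightarrow> complex poly" where
  "dirichlet_poly m w = (\<Sum>k<m. monom (1 / (of_nat m * w ^ k)) k)"

lemma degree_dirichlet_poly: "degree (dirichlet_poly m w) \<le> m"
  unfolding dirichlet_poly_def
  by (rule degree_sum_le) (auto intro: order_trans[OF degree_monom_le])

lemma poly_dirichlet_poly: "poly (dirichlet_poly m w) z = (\<Sum>k<m. (z / w) ^ k) / of_nat m"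
  by (simp add: dirichlet_poly_def poly_sum poly_monom sum_divide_distrib power_divide mult.commute)

text \<open>On the circle |z/w| \<le> 1, so the sum is bounded termwise, and summing the geometric
  series gives decay like 1/(m |z - w|) up to the factor 2|w|.\<close>

lemma cmod_dirichlet_poly:
  assumes "cmod w \<ge> 1" "cmod z = 1" "m \<ge> 1"
  shows "cmod (poly (dirichlet_poly m w) z) \<le> 1"
    and "real m * (cmod (poly (dirichlet_poly m w) z) * cmod (z - w)) \<le> 2 * cmod w"
proof -
  have w0: "w \<noteq> 0" using assms by auto
  have q: "cmod (z / w) \<le> 1" using assms by (simp add: norm_divide divide_le_eq_1)
  have "cmod (\<Sum>k<m. (z / w) ^ k) \<le> (\<Sum>k<m. 1)"
    using q by (intro sum_norm_le) (simp only: norm_power power_le_one norm_ge_zero)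
  then show "cmod (poly (dirichlet_poly m w) z) \<le> 1"
    using assms by (simp add: poly_dirichlet_poly norm_divide divide_le_eq)
  have "(\<Sum>k<m. (z / w) ^ k) * (z - w) = w * ((z / w) ^ m - 1)"
  proof -
    have "(z / w) ^ m - 1 = (z / w - 1) * (\<Sum>k<m. (z / w) ^ k)" using assms by (simp add: power_diff_1_eq)
    moreover have "z - w = w * (z / w - 1)" using w0 by (simp add: right_diff_distrib)
    ultimately show ?thesis by simp
  qed
  then have "cmod (\<Sum>k<m. (z / w) ^ k) * cmod (z - w) = cmod w * cmod ((z / w) ^ m - 1)"
    by (metis norm_mult)
  moreover have "cmod ((z / w) ^ m - 1) \<le> 2"
  proof -
    have "cmod ((z / w) ^ m) \<le> 1" using q by (simp only: norm_power power_le_one norm_ge_zero)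
    then show ?thesis using norm_triangle_ineq4[of "(z / w) ^ m" 1] by simp
  qed
  ultimately have "cmod (\<Sum>k<m. (z / w) ^ k) * cmod (z - w) \<le> cmod w * 2" by (simp only: mult_left_mono norm_ge_zero)
  then show "real m * (cmod (poly (dirichlet_poly m w) z) * cmod (z - w)) \<le> 2 * cmod w"
    using assms by (simp add: poly_dirichlet_poly norm_divide)
qed

text \<open>The two solutions z + s and z - s have product 1, so one has modulus at least 1. For w =
  z + e the reciprocal is z - e, hence w^2 - 1 = 2 w e, which is where the square root in the last
  claim comes from.\<close>

lemma joukowski_preimage:
  obtains w :: complex where "cmod w \<ge> 1" "w + 1 / w = 2 * z" "cmod (w\<^sup>2 - 1) = 2 * cmod w * cmod (csqrt (z\<^sup>2 - 1))"
proof -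
  define s where "s = csqrt (z\<^sup>2 - 1)"
  have p: "(z + s) * (z - s) = 1" by (simp add: s_def algebra_simps flip: power2_eq_square)
  then have "cmod (z + s) * cmod (z - s) = 1" by (metis norm_mult norm_one)
  then have "cmod (z + s) \<ge> 1 \<or> cmod (z - s) \<ge> 1"
    using mult_strict_mono'[of "cmod (z + s)" 1 "cmod (z - s)" 1] by force
  then obtain w e where w: "cmod w \<ge> 1" "w = z + e" "w * (z - e) = 1" "cmod e = cmod s"
  proof
    assume "cmod (z + s) \<ge> 1" then show ?thesis by (intro that[of "z + s" s] p) auto
  next
    assume "cmod (z - s) \<ge> 1" moreover have "(z - s) * (z - - s) = 1" by (subst mult.commute) (simp only: diff_minus_eq_add p)
    ultimately show ?thesis by (intro that[of "z - s" "- s"]) auto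
  qed
  then have inv: "1 / w = z - e" by (metis div_by_0 mult_zero_left nonzero_mult_div_cancel_left zero_neq_one)
  have "w\<^sup>2 - 1 = w * (2 * e)" using w(3) w(2) by (simp add: power2_eq_square algebra_simps)
  then show ?thesis using w inv that[of w] by (simp add: norm_mult s_def)
qed

section \<open>Pointwise bounds for polynomials off the real line\<close>

text \<open>The factor 1/\<open>rho m x\<close> normalizes the mass: for exponents at least 2 the
  integral over y is at most 2.\<close>

definition decay_kernel :: "nat \<Rightarrow> nat \<Rightarrow> real \<Rightarrow> real \<Rightarrow> real" where
  "decay_kernel \<sigma> m x y = 1 / (rho m x * (1 + reldist m x y) ^ \<sigma>)"

lemma decay_kernel_nonneg: "x \<in> {-1..1} \<Longrightarrow> m \<ge> 1 \<Longrightarrow> 0 \<le> decay_kernel \<sigma> m x y"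
  using rho_pos[of x m] reldist_nonneg[of x m y] by (simp add: decay_kernel_def)

lemma continuous_on_decay_kernel:
  assumes "x \<in> {-1..1}" "m \<ge> 1"
  shows "continuous_on S (decay_kernel \<sigma> m x)"
proof -
  have "rho m x > 0" "\<And>y. reldist m x y \<ge> 0" using assms rho_pos reldist_nonneg by auto
  then have "rho m x * (1 + \<bar>x - y\<bar> / rho m x) ^ \<sigma> \<noteq> 0" for y
    by (metis add_pos_nonneg less_irrefl mult_eq_0_iff power_not_zero reldist_def zero_less_one)
  then show ?thesis using \<open>rho m x > 0\<close> unfolding decay_kernel_def reldist_def
    by (intro continuous_intros) auto
qed

definition circle_point :: "real \<Rightarrow> complex" where
  "circle_point x = Complex x (phi x)"

text \<open>The circle point and its conjugate are the preimages of x, with sum 2x and product 1. So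
  the product of the distances of w to them is 2 |w| |z - x|, while their mutual distance is 2
  \<open>phi x\<close>.\<close>

lemma circle_point_factor:
  assumes "x \<in> {-1..1}" "w \<noteq> 0" "w + 1 / w = 2 * z"
  shows "(w - circle_point x) * (w - cnj (circle_point x)) = 2 * w * (z - of_real x)"
proof -
  have "circle_point x + cnj (circle_point x) = 2 * of_real x"
    by (simp add: circle_point_def complex_eq_iff)
  moreover have "circle_point x * cnj (circle_point x) = 1"
    using phi_sq[OF assms(1)] by (simp add: circle_point_def complex_eq_iff power2_eq_square)
  moreover have "w * w + 1 = 2 * w * z" using assms(2,3) by (simp add: field_simps)
  ultimately show ?thesis by algebra
qed

lemma cmod_circle_point: "x \<in> {-1..1} \<Longrightarrow> cmod (circle_point x) = 1"
  using phi_sq[of x] by (simp add: circle_point_def cmod_def)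

lemma cmod_circle_point_diff: "x \<in> {-1..1} \<Longrightarrow> cmod (circle_point x - cnj (circle_point x)) = 2 * phi x"
  using phi_nonneg[of x] by (simp add: circle_point_def cmod_def real_sqrt_mult)

text \<open>Let d be the distance to the nearer preimage of x. The farther one is at distance at
  least (\<open>phi x\<close> + d)/2, so the factorization yields d (\<open>phi x\<close> + d) \<le>
  k \<open>rho m x\<close>. Since \<open>rho m x\<close> = \<open>phi x\<close>/m + 1/m^2 and k
  \<ge> 1, this excludes d > k/m.\<close>

lemma preimage_near_circle_point:
  assumes x: "x \<in> {-1..1}" and m: "m \<ge> 1" and A: "A \<ge> 1" and z: "cmod (z - of_real x) \<le> A * rho m x"
    and w: "cmod w \<ge> 1" "w + 1 / w = 2 * z"
  obtains u where "u = circle_point x \<or> u = cnj (circle_point x)" "cmod w \<le> 3 + 4 * A"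
    "real m * cmod (w - u) \<le> 4 * (3 + 4 * A) * A"
proof -
  \<comment> \<open>|z| \<le> 2A + 1 because \<open>rho m x\<close> \<le> 2, and |w| \<le> 2|z| +
    1.\<close>
  define B where "B = 3 + 4 * A"
  define k where "k = 4 * B * A"
  have w0: "w \<noteq> 0" using w by auto
  have "cmod z \<le> cmod (z - of_real x) + cmod (of_real x :: complex)"
    using norm_triangle_sub[of z "of_real x"] by (simp only: add.commute)
  also have "\<dots> \<le> A * rho m x + 1" using z x by (intro add_mono) auto
  also have "\<dots> \<le> A * 2 + 1" using A rho_le_2[OF m] by (intro add_mono mult_left_mono) auto
  finally have zb: "cmod z \<le> 2 * A + 1" by simp
  have "w = 2 * z - 1 / w" using w(2) by (simp add: algebra_simps)
  then have "cmod w \<le> 2 * cmod z + cmod (1 / w)" by (metis norm_triangle_ineq4 norm_mult norm_numeral)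
  moreover have "cmod (1 / w) \<le> 1" using w by (simp add: norm_divide divide_le_eq_1)
  ultimately have wB: "cmod w \<le> B" using zb by (simp add: B_def)
  obtain u u' where u: "u = circle_point x \<or> u = cnj (circle_point x)" "cmod (w - u) \<le> cmod (w - u')"
    "(w - u) * (w - u') = 2 * w * (z - of_real x)" "cmod (u - u') = 2 * phi x"
  proof (cases "cmod (w - circle_point x) \<le> cmod (w - cnj (circle_point x))")
    case True then show ?thesis
      using that[of "circle_point x" "cnj (circle_point x)"] circle_point_factor[OF x w0 w(2)] cmod_circle_point_diff[OF x] by simp
  next
    case False then show ?thesis
      using that[of "cnj (circle_point x)" "circle_point x"] circle_point_factor[OF x w0 w(2)] cmod_circle_point_diff[OF x]
      by (simp add: norm_minus_commute mult.commute)
  qed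
  define d where "d = cmod (w - u)"
  have d0: "d \<ge> 0" by (simp add: d_def)
  have "2 * phi x \<le> cmod (w - u') + d" unfolding u(4)[symmetric] d_def
    using norm_triangle_ineq4[of "w - u'" "w - u"] by (simp add: algebra_simps)
  then have "phi x + d \<le> 2 * cmod (w - u')" using u(2) unfolding d_def by simp
  then have "d * (phi x + d) \<le> d * (2 * cmod (w - u'))" by (rule mult_left_mono[OF _ d0])
  also have "\<dots> = 2 * cmod (2 * w * (z - of_real x))"
    unfolding u(3)[symmetric] norm_mult d_def by simp
  also have "\<dots> = 4 * (cmod w * cmod (z - of_real x))" by (simp add: norm_mult)
  also have "\<dots> \<le> 4 * (B * (A * rho m x))" using wB z A by (intro mult_left_mono mult_mono) (auto simp: B_def)
  also have "\<dots> = k * rho m x" by (simp add: k_def)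
  finally have d: "d * (phi x + d) \<le> k * rho m x" .
  have k1: "k \<ge> 1" unfolding k_def B_def using A mult_mono[of 1 "4 * (3 + 4 * A)" 1 A] by simp
  have "d \<le> k / m"
  proof (rule ccontr)
    assume "\<not> d \<le> k / m"
    then have dk: "d > k / m" by simp
    have p: "0 < k / m" using k1 m by simp
    have ph: "0 \<le> phi x" by (rule phi_nonneg[OF x])
    have "k * rho m x = k / m * phi x + k * (1 / m)\<^sup>2" by (simp add: rho_phi algebra_simps power_divide)
    moreover have "1 * (k * (1 / m)\<^sup>2) \<le> k * (k * (1 / m)\<^sup>2)" using k1 by (intro mult_right_mono) auto
    moreover have "k * (k * (1 / m)\<^sup>2) = k / m * (k / m)" by (simp add: power2_eq_square)
    moreover have "k / m * (k / m) < d * d" using dk p by (intro mult_strict_mono) auto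
    moreover have "k / m * phi x \<le> d * phi x" using dk ph by (intro mult_right_mono) auto
    moreover have "d * phi x + d * d \<le> k * rho m x" using d by (simp add: distrib_left)
    ultimately show False by argo
  qed
  then have "real m * d \<le> k" using m by (simp add: le_divide_eq mult.commute)
  then show ?thesis using that[OF u(1)] wB by (simp add: d_def k_def B_def)
qed

lemma cis_add_inverse: "cis t + 1 / cis t = 2 * of_real (cos t)"
  by (simp add: divide_inverse cis_inverse complex_eq_iff)

text \<open>The same factorization on the circle: 2|cos t - x| is the product of the distances to
  both preimages, hence at most quadratic in the distance e on the circle. This is why
  \<open>2 * \<sigma>\<close> powers of the localizing polynomial are taken for
  \<open>\<sigma>\<close> powers of decay.\<close>

lemma reldist_cos_le:
  assumes x: "x \<in> {-1..1}" and m: "m \<ge> 1" and u: "u = circle_point x \<or> u = cnj (circle_point x)"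
  shows "1 + reldist m x (cos t) \<le> (1 + real m * cmod (cis t - u))\<^sup>2"
proof -
  define e where "e = cmod (cis t - u)"
  have e0: "e \<ge> 0" by (simp add: e_def)
  have "cis t + 1 / cis t = 2 * of_real (cos t)"
    by (rule cis_add_inverse)
  then have f: "(cis t - u) * (cis t - cnj u) = 2 * cis t * (of_real (cos t) - of_real x)"
    using circle_point_factor[OF x, of "cis t" "of_real (cos t)"] u by (auto simp: mult.commute)
  have "cmod (u - cnj u) = 2 * phi x" using u cmod_circle_point_diff[OF x] by (auto simp: norm_minus_commute)
  then have "cmod (cis t - cnj u) \<le> e + 2 * phi x"
    using norm_triangle_ineq[of "cis t - u" "u - cnj u"] by (simp add: e_def)
  then have "e * cmod (cis t - cnj u) \<le> e * (e + 2 * phi x)" using e0 by (rule mult_left_mono)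
  moreover have "e * cmod (cis t - cnj u) = 2 * \<bar>cos t - x\<bar>"
    using arg_cong[OF f, of cmod] by (simp add: norm_mult e_def flip: of_real_diff)
  ultimately have le: "2 * \<bar>x - cos t\<bar> \<le> e * (e + 2 * phi x)" by (simp add: abs_minus_commute)
  define s where "s = real m * e"
  have s0: "s \<ge> 0" using e0 by (simp add: s_def)
  have es: "e = s / m" using m by (simp add: s_def)
  have "e * (e + 2 * phi x) = 2 * (s * (phi x / m)) + s\<^sup>2 * (1 / (real m)\<^sup>2)"
    by (simp add: es power2_eq_square algebra_simps)
  also have "\<dots> \<le> 2 * (s * rho m x) + s\<^sup>2 * rho m x"
    using s0 rho_ge[OF x, of m] by (intro add_mono mult_left_mono) (auto simp: rho_phi)
  finally have "2 * \<bar>x - cos t\<bar> \<le> (2 * s + s\<^sup>2) * rho m x" using le by (simp add: algebra_simps)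
  then have "2 * reldist m x (cos t) \<le> 2 * s + s\<^sup>2"
    using rho_pos[OF x m] by (simp add: reldist_def divide_le_eq)
  then have "reldist m x (cos t) \<le> 2 * s + s\<^sup>2" using s0 reldist_nonneg[OF x m, of "cos t"] by linarith
  then show ?thesis by (simp add: power2_sum s_def e_def)
qed

text \<open>The reproducing formula is applied to the product of the pulled-back Q, of w^2 - 1 and
  of a power of the localizing polynomial. On the circle their moduli are |Q(cos t)|, the Jacobian
  factor 2|sin t| and the decay; at the preimage of z the localizing factor is 1 and |w^2 - 1| is
  bounded below by the hypothesis on \<open>csqrt\<close>.\<close>

lemma poly_complex_bound:
  fixes A c :: real and \<sigma> m :: nat and Q :: "real poly"
  assumes A: "A \<ge> 1" and c: "c > 0" and m: "m \<ge> 1" and Q: "degree Q \<le> m" and x: "x \<in> {-1..1}"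
    and z: "cmod (z - of_real x) \<le> A * rho m x" and zc: "c * (real m * rho m x) \<le> cmod (csqrt (z\<^sup>2 - 1))"
  defines "B \<equiv> 3 + 4 * A"
  defines "k \<equiv> 4 * B * A"
  shows "cmod (poly (map_poly of_real Q) z) \<le> 2 * (5 + 2 * real \<sigma>) * exp (k * (4 + 2 * real \<sigma>)) * (1 + k + 2 * B) ^ (2 * \<sigma>) / c
     * integral {-1..1} (\<lambda>y. \<bar>poly Q y\<bar> * decay_kernel \<sigma> m x y)"
proof -
  obtain w where w: "cmod w \<ge> 1" "w + 1 / w = 2 * z" "cmod (w\<^sup>2 - 1) = 2 * cmod w * cmod (csqrt (z\<^sup>2 - 1))"
    by (rule joukowski_preimage)
  obtain u where u: "u = circle_point x \<or> u = cnj (circle_point x)" "cmod w \<le> B" "real m * cmod (w - u) \<le> k"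
    using preimage_near_circle_point[OF x m A z w(1,2)] unfolding B_def k_def by blast
  have w0: "w \<noteq> 0" using w by auto
  have u1: "cmod u = 1" using u(1) cmod_circle_point[OF x] by auto
  have k0: "k \<ge> 0" using A by (simp add: k_def B_def)
  have B0: "B \<ge> 0" using A by (simp add: B_def)
  define C1 where "C1 = 1 + k + 2 * B"
  have C1: "C1 \<ge> 0" using k0 B0 by (simp add: C1_def)
  \<comment> \<open>2m from \<open>joukowski_poly\<close>, 2 from w^2 - 1 and
    \<open>2 * \<sigma> * m\<close> from the localizing power; m \<ge> 1 absorbs the 2.\<close>
  define N where "N = (4 + 2 * \<sigma>) * m"
  define J where "J = dirichlet_poly m w"
  define H where "H = joukowski_poly m Q * ([:-1, 0, 1:] * J ^ (2 * \<sigma>))"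
  have "poly [:-1, 0, 1:] z = z\<^sup>2 - 1" for z :: complex by (simp add: power2_eq_square)
  then have Hev: "poly H z = poly (joukowski_poly m Q) z * ((z\<^sup>2 - 1) * poly J z ^ (2 * \<sigma>))" for z
    unfolding H_def poly_mult poly_power by simp
  have "degree H \<le> 2 * m + (2 + 2 * \<sigma> * m)"
    unfolding H_def
  proof (intro order_trans[OF degree_mult_le] add_mono degree_joukowski_poly)
    have "degree (J ^ (2 * \<sigma>)) \<le> degree J * (2 * \<sigma>)" by (rule degree_power_le)
    also have "\<dots> \<le> m * (2 * \<sigma>)" unfolding J_def by (intro mult_right_mono degree_dirichlet_poly) auto
    finally show "degree (J ^ (2 * \<sigma>)) \<le> 2 * \<sigma> * m" by (simp add: mult_ac)
  qed auto
  also have "\<dots> \<le> N" using m by (simp add: N_def algebra_simps)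
  finally have dH: "degree H \<le> N" .
  define g where "g y = \<bar>poly Q y\<bar> / (1 + reldist m x y) ^ \<sigma>" for y
  have gk: "\<bar>poly Q y\<bar> * decay_kernel \<sigma> m x y = g y / rho m x" for y
    by (simp add: g_def decay_kernel_def)
  have rp: "rho m x > 0" using rho_pos[OF x m] .
  have gc: "continuous_on {-1..1} g"
  proof -
    have "continuous_on {-1..1} (\<lambda>y. rho m x * (\<bar>poly Q y\<bar> * decay_kernel \<sigma> m x y))"
      by (intro continuous_intros continuous_on_decay_kernel x m)
    then show ?thesis using rp by (simp add: gk)
  qed
  have J_bound: "cmod (poly J (cis t)) ^ (2 * \<sigma>) \<le> C1 ^ (2 * \<sigma>) / (1 + reldist m x (cos t)) ^ \<sigma>" for t
  proof -
    let ?J = "cmod (poly J (cis t))" and ?e = "real m * cmod (cis t - u)"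
    have J1: "?J \<le> 1" and J2: "real m * (?J * cmod (cis t - w)) \<le> 2 * cmod w"
      using cmod_dirichlet_poly[OF w(1) _ m, of "cis t"] by (auto simp: J_def)
    have "cmod (cis t - u) \<le> cmod (cis t - w) + cmod (w - u)"
      using norm_triangle_ineq[of "cis t - w" "w - u"] by simp
    then have "real m * cmod (cis t - u) \<le> real m * (cmod (cis t - w) + cmod (w - u))" by (intro mult_left_mono) auto
    then have "?e \<le> real m * cmod (cis t - w) + k" using u(3) by (simp add: distrib_left)
    then have "?J * (1 + ?e) \<le> ?J * (1 + k + real m * cmod (cis t - w))" by (intro mult_left_mono) auto
    also have "\<dots> = ?J * (1 + k) + real m * (?J * cmod (cis t - w))" by (simp add: algebra_simps)
    also have "\<dots> \<le> 1 * (1 + k) + 2 * B" using J1 J2 u(2) k0 by (intro add_mono mult_right_mono) auto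
    finally have le: "?J * (1 + ?e) \<le> C1" by (simp add: C1_def)
    have "?J ^ (2 * \<sigma>) * (1 + reldist m x (cos t)) ^ \<sigma> \<le> ?J ^ (2 * \<sigma>) * ((1 + ?e)\<^sup>2) ^ \<sigma>"
      using reldist_cos_le[OF x m u(1), of t] reldist_nonneg[OF x m, of "cos t"] by (intro mult_left_mono power_mono) auto
    also have "\<dots> = (?J * (1 + ?e)) ^ (2 * \<sigma>)" by (simp add: power_mult_distrib power_mult)
    also have "\<dots> \<le> C1 ^ (2 * \<sigma>)" using le by (intro power_mono) auto
    finally show ?thesis using reldist_nonneg[OF x m, of "cos t"] by (simp add: le_divide_eq)
  qed
  define b where "b t = 2 * C1 ^ (2 * \<sigma>) * (\<bar>sin t\<bar> * g (cos t))" for t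
  have Hb: "cmod (poly H (cis t)) \<le> b t" for t
  proof -
    have "(cis t + 1 / cis t) / 2 = of_real (cos t)"
      by (simp add: cis_add_inverse)
    moreover have "poly (map_poly complex_of_real Q) (of_real (cos t)) = of_real (poly Q (cos t))"
      by (simp add: poly_altdef degree_map_poly coeff_map_poly)
    ultimately have 1: "cmod (poly (joukowski_poly m Q) (cis t)) = \<bar>poly Q (cos t)\<bar>"
      by (simp add: poly_joukowski_poly[OF Q] norm_mult norm_power)
    have "(cis t)\<^sup>2 - 1 = 2 * \<i> * of_real (sin t) * cis t"
      by (simp add: complex_eq_iff power2_eq_square algebra_simps)
    then have 2: "cmod ((cis t)\<^sup>2 - 1) = 2 * \<bar>sin t\<bar>" by (simp add: norm_mult)
    have "cmod (poly H (cis t)) = \<bar>poly Q (cos t)\<bar> * (2 * \<bar>sin t\<bar> * cmod (poly J (cis t)) ^ (2 * \<sigma>))"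
      unfolding Hev norm_mult norm_power 1 2 by simp
    also have "\<dots> \<le> \<bar>poly Q (cos t)\<bar> * (2 * \<bar>sin t\<bar> * (C1 ^ (2 * \<sigma>) / (1 + reldist m x (cos t)) ^ \<sigma>))"
      by (intro mult_left_mono J_bound) auto
    also have "\<dots> = b t" by (simp add: b_def g_def)
    finally show ?thesis .
  qed
  have bi: "(b has_integral 2 * C1 ^ (2 * \<sigma>) * (2 * integral {-1..1} g)) {-pi..pi}"
    unfolding b_def by (intro has_integral_mult_right integral_abs_sin_cos gc)
  have g0: "integral {-1..1} g \<ge> 0"
    by (intro integral_nonneg integrable_continuous_real gc) (auto simp: g_def reldist_nonneg[OF x m])
  have "continuous_on {-pi..pi} b" unfolding b_def
    by (intro continuous_intros continuous_on_compose2[OF gc]) auto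
  then have "cmod (poly H w) \<le> (real N + 1) * cmod w ^ N * (2 * C1 ^ (2 * \<sigma>) * (2 * integral {-1..1} g))"
    using poly_outside_disc_bound[OF dH w(1) _ Hb] integral_unique[OF bi] by simp
  also have "\<dots> \<le> ((5 + 2 * real \<sigma>) * m) * exp (k * (4 + 2 * real \<sigma>)) * (2 * C1 ^ (2 * \<sigma>) * (2 * integral {-1..1} g))"
  proof (intro mult_right_mono mult_mono)
    show "real N + 1 \<le> (5 + 2 * real \<sigma>) * m" using m by (simp add: N_def algebra_simps)
    \<comment> \<open>The preimage is within k/m of the circle and N is proportional to m, so |w|^N
      is bounded independently of m.\<close>
    have "cmod w \<le> cmod u + cmod (w - u)" by (rule norm_triangle_sub)
    also have "\<dots> \<le> 1 + k / m" using u(3) u1 m by (simp add: le_divide_eq mult.commute)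
    also have "\<dots> \<le> exp (k / m)" by simp
    finally have "cmod w ^ N \<le> exp (k / m) ^ N" by (intro power_mono) auto
    also have "\<dots> = exp (k * (4 + 2 * real \<sigma>))" using m by (simp add: exp_of_nat_mult[symmetric] N_def algebra_simps)
    finally show "cmod w ^ N \<le> exp (k * (4 + 2 * real \<sigma>))" .
  qed (use g0 C1 in auto)
  finally have up: "cmod (poly H w) \<le> ((5 + 2 * real \<sigma>) * m) * exp (k * (4 + 2 * real \<sigma>)) * (2 * C1 ^ (2 * \<sigma>) * (2 * integral {-1..1} g))" .
  define q where "q = cmod (poly (map_poly of_real Q) z)"
  have "poly J w = 1" using w0 m by (simp add: J_def poly_dirichlet_poly)
  moreover have "(w + 1 / w) / 2 = z" using w(2) by simp
  ultimately have Hw: "cmod (poly H w) = cmod w ^ m * q * (2 * cmod w * cmod (csqrt (z\<^sup>2 - 1)))"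
    using w(3) by (simp add: Hev poly_joukowski_poly[OF Q w0] norm_mult norm_power q_def)
  \<comment> \<open>The m inherited from N + 1 cancels against the m in m \<open>rho m x\<close>,
    which leaves the normalization 1/\<open>rho m x\<close> of the kernel.\<close>
  have "1 * q * (2 * 1 * (c * (real m * rho m x))) \<le> cmod (poly H w)"
    unfolding Hw using w(1) zc c rp by (intro mult_mono) (auto simp: q_def one_le_power)
  with up have "real m * (q * (2 * c * rho m x)) \<le> real m * ((5 + 2 * real \<sigma>) * exp (k * (4 + 2 * real \<sigma>)) * (2 * C1 ^ (2 * \<sigma>) * (2 * integral {-1..1} g)))"
    by (simp add: mult_ac)
  then have "q * (2 * c * rho m x) \<le> (5 + 2 * real \<sigma>) * exp (k * (4 + 2 * real \<sigma>)) * (2 * C1 ^ (2 * \<sigma>) * (2 * integral {-1..1} g))"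
    using m by simp
  then have "q \<le> ((5 + 2 * real \<sigma>) * exp (k * (4 + 2 * real \<sigma>)) * (2 * C1 ^ (2 * \<sigma>) * (2 * integral {-1..1} g))) / (2 * c * rho m x)"
    using c rp by (simp only: pos_le_divide_eq mult_pos_pos zero_less_numeral)
  also have "\<dots> = 2 * (5 + 2 * real \<sigma>) * exp (k * (4 + 2 * real \<sigma>)) * C1 ^ (2 * \<sigma>) / c * (integral {-1..1} g / rho m x)"
    by simp
  also have "integral {-1..1} g / rho m x = integral {-1..1} (\<lambda>y. \<bar>poly Q y\<bar> * decay_kernel \<sigma> m x y)"
    unfolding gk by simp
  finally show ?thesis by (simp add: q_def C1_def)
qed

section \<open>Differences of polynomials\<close>

lemma binomial_difference_Suc:
  fixes f :: "real \<Rightarrow> real"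
  shows "(\<Sum>i=0..Suc r. real (Suc r choose i) * (-1) ^ (Suc r - i) * f (a + real i * d))
       = (\<Sum>i=0..r. real (r choose i) * (-1) ^ (r - i) * (f (a + real i * d + d) - f (a + real i * d)))"
proof -
  let ?g = "\<lambda>i. f (a + real i * d)"
  have "(\<Sum>i=0..Suc r. real (Suc r choose i) * (-1) ^ (Suc r - i) * ?g i)
      = (-1) ^ Suc r * ?g 0 + (\<Sum>i\<le>r. real (Suc r choose Suc i) * (-1) ^ (r - i) * ?g (Suc i))"
    unfolding atLeast0AtMost by (subst sum.atMost_Suc_shift) simp
  also have "(\<Sum>i\<le>r. real (Suc r choose Suc i) * (-1) ^ (r - i) * ?g (Suc i))
      = (\<Sum>i\<le>r. real (r choose i) * (-1) ^ (r - i) * ?g (Suc i)) + (\<Sum>i\<le>r. real (r choose Suc i) * (-1) ^ (r - i) * ?g (Suc i))"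
    by (simp add: distrib_right sum.distrib)
  also have "(\<Sum>i\<le>r. real (r choose Suc i) * (-1) ^ (r - i) * ?g (Suc i)) = (\<Sum>i<r. real (r choose Suc i) * (-1) ^ (r - i) * ?g (Suc i))"
    by (rule sum.mono_neutral_right) (auto simp: binomial_eq_0_iff not_less_eq)
  also have "\<dots> = - (\<Sum>i<r. real (r choose Suc i) * (-1) ^ (r - Suc i) * ?g (Suc i))"
    unfolding sum_negf[symmetric]
  proof (rule sum.cong)
    fix i assume "i \<in> {..<r}"
    then have "r - i = Suc (r - Suc i)" by auto
    then show "real (r choose Suc i) * (-1) ^ (r - i) * ?g (Suc i) = - (real (r choose Suc i) * (-1) ^ (r - Suc i) * ?g (Suc i))"
      by simp
  qed simp
  finally have "(\<Sum>i=0..Suc r. real (Suc r choose i) * (-1) ^ (Suc r - i) * ?g i)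
      = (\<Sum>i\<le>r. real (r choose i) * (-1) ^ (r - i) * ?g (Suc i))
       - ((-1) ^ r * ?g 0 + (\<Sum>i<r. real (r choose Suc i) * (-1) ^ (r - Suc i) * ?g (Suc i)))"
    by simp
  also have "(-1) ^ r * ?g 0 + (\<Sum>i<r. real (r choose Suc i) * (-1) ^ (r - Suc i) * ?g (Suc i)) = (\<Sum>i\<le>r. real (r choose i) * (-1) ^ (r - i) * ?g i)"
    by (subst sum.atMost_shift) simp
  finally show ?thesis
    by (simp add: right_diff_distrib sum_subtractf atLeast0AtMost algebra_simps)
qed

lemma binomial_difference_const:
  "r \<ge> 1 \<Longrightarrow> (\<Sum>i=0..r. real (r choose i) * (-1) ^ (r - i) * c) = 0"
  using binomial_difference_Suc[of "r - 1" "\<lambda>_. c" 0 0] by simp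

lemma binomial_difference_poly:
  fixes Q :: "real poly"
  assumes "d \<ge> 0"
  shows "\<exists>\<xi>\<in>{a..a + real r * d}.
    (\<Sum>i=0..r. real (r choose i) * (-1) ^ (r - i) * poly Q (a + real i * d)) = d ^ r * poly ((pderiv ^^ r) Q) \<xi>"
proof (induction r arbitrary: Q)
  case (Suc r)
  define G where "G = pcompose Q [:d, 1:] - Q"
  have G: "poly G x = poly Q (x + d) - poly Q x" for x by (simp add: G_def poly_pcompose add.commute)
  have "pderiv (pcompose P [:d, 1:]) = pcompose (pderiv P) [:d, 1:]" for P :: "real poly"
    by (simp add: pderiv_pcompose pderiv_pCons)
  then have pc: "(pderiv ^^ k) (pcompose P [:d, 1:]) = pcompose ((pderiv ^^ k) P) [:d, 1:]" for k and P :: "real poly"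
    by (induction k) simp_all
  have "(pderiv ^^ k) (P - R) = (pderiv ^^ k) P - (pderiv ^^ k) R" for k and P R :: "real poly"
    by (induction k) (simp_all add: pderiv_diff)
  then have dG: "poly ((pderiv ^^ r) G) x = poly ((pderiv ^^ r) Q) (x + d) - poly ((pderiv ^^ r) Q) x" for x
    by (simp add: G_def pc poly_pcompose add.commute)
  obtain \<xi> where \<xi>: "\<xi> \<in> {a..a + real r * d}"
    "(\<Sum>i=0..r. real (r choose i) * (-1) ^ (r - i) * poly G (a + real i * d)) = d ^ r * poly ((pderiv ^^ r) G) \<xi>"
    using Suc by blast
  obtain z where z: "z \<in> {\<xi>..\<xi> + d}" "poly ((pderiv ^^ r) G) \<xi> = d * poly ((pderiv ^^ Suc r) Q) z"
  proof (cases "d = 0")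
    case True
    then show ?thesis using that[of \<xi>] by (simp add: dG)
  next
    case False
    then have "\<xi> < \<xi> + d" using assms by simp
    from MVT2[OF this, of "poly ((pderiv ^^ r) Q)" "poly ((pderiv ^^ Suc r) Q)"]
    obtain z where "\<xi> < z" "z < \<xi> + d" "poly ((pderiv ^^ r) Q) (\<xi> + d) - poly ((pderiv ^^ r) Q) \<xi> = (\<xi> + d - \<xi>) * poly ((pderiv ^^ Suc r) Q) z"
      by (auto intro: poly_DERIV)
    then show ?thesis using that[of z] by (simp add: dG)
  qed
  have "(\<Sum>i=0..Suc r. real (Suc r choose i) * (-1) ^ (Suc r - i) * poly Q (a + real i * d))
    = (\<Sum>i=0..r. real (r choose i) * (-1) ^ (r - i) * poly G (a + real i * d))"
    unfolding binomial_difference_Suc G ..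
  also have "\<dots> = d ^ Suc r * poly ((pderiv ^^ Suc r) Q) z" unfolding \<xi>(2) z(2) by simp
  finally show ?case using \<xi>(1) z(1) by (intro bexI[of _ z]) (auto simp: algebra_simps)
qed simp

section \<open>Derivatives of polynomials by Cauchy's estimate\<close>

lemma deriv_pow_poly: "(deriv ^^ r) (poly P) = poly ((pderiv ^^ r) P)" for P :: "complex poly"
proof (induction r)
  case (Suc r)
  have "deriv (poly ((pderiv ^^ r) P)) = poly (pderiv ((pderiv ^^ r) P))"
    by (auto simp: fun_eq_iff intro!: DERIV_imp_deriv poly_DERIV)
  with Suc show ?case by simp
qed simp

lemma pderiv_pow_map_poly_of_real:
  "(pderiv ^^ r) (map_poly complex_of_real Q) = map_poly complex_of_real ((pderiv ^^ r) Q)"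
proof -
  have "pderiv (map_poly complex_of_real P) = map_poly complex_of_real (pderiv P)" for P
    by (rule poly_eqI) (simp add: coeff_pderiv coeff_map_poly)
  then show ?thesis by (induction r) simp_all
qed

lemma poly_map_poly_of_real: "poly (map_poly complex_of_real Q) (of_real x) = of_real (poly Q x)"
  by (simp add: poly_altdef degree_map_poly coeff_map_poly)

text \<open>a and b will be the distances from the centre of a Cauchy circle to 1 and -1. The
  candidates are spaced by \<rho>, so each of a and b is closer than \<rho>/2 to at most one of
  them, and one of the three survives.\<close>

lemma three_radii:
  fixes \<rho> a b :: real
  assumes "\<rho> > 0"
  obtains R where "\<rho> \<le> R" "R \<le> 3 * \<rho>" "\<rho> \<le> 2 * \<bar>R - a\<bar>" "\<rho> \<le> 2 * \<bar>R - b\<bar>"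
proof -
  have "(\<rho> \<le> 2 * \<bar>\<rho> - a\<bar> \<and> \<rho> \<le> 2 * \<bar>\<rho> - b\<bar>) \<or> (\<rho> \<le> 2 * \<bar>2 * \<rho> - a\<bar> \<and> \<rho> \<le> 2 * \<bar>2 * \<rho> - b\<bar>)
    \<or> (\<rho> \<le> 2 * \<bar>3 * \<rho> - a\<bar> \<and> \<rho> \<le> 2 * \<bar>3 * \<rho> - b\<bar>)"
    using assms by (smt (verit))
  then show ?thesis using that[of \<rho>] that[of "2 * \<rho>"] that[of "3 * \<rho>"] assms by auto
qed

text \<open>Since m \<open>rho m x\<close> = \<open>phi x\<close> + 1/m, two lower bounds for s^2 =
  |z - 1||z + 1| are needed. Distance from the endpoints bounds 1 - x and 1 + x by multiples of |z -
  1| and |z + 1|, which handles \<open>phi x\<close>; for 1/m, one of the two factors is at least 1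
  and the other at least \<open>rho m x\<close>/2.\<close>

lemma rho_le_sqrt_dist:
  assumes x: "x \<in> {-1..1}" and m: "m \<ge> 1" and A: "A \<ge> 1" and z: "cmod (z - of_real x) \<le> A * rho m x"
    and z1: "rho m x \<le> 2 * cmod (z - 1)" and z2: "rho m x \<le> 2 * cmod (z + 1)"
  shows "1 / (3 + 2 * A) * (real m * rho m x) \<le> cmod (csqrt (z\<^sup>2 - 1))"
proof -
  define s where "s = cmod (csqrt (z\<^sup>2 - 1))"
  have "(csqrt (z\<^sup>2 - 1))\<^sup>2 = (z - 1) * (z + 1)" by (simp only: power2_csqrt) (simp add: power2_eq_square algebra_simps)
  then have s: "s\<^sup>2 = cmod (z - 1) * cmod (z + 1)" by (metis s_def norm_mult norm_power)
  have s0: "s \<ge> 0" by (simp add: s_def)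
  have rp: "rho m x > 0" by (rule rho_pos[OF x m])
  have zA: "A * rho m x \<le> A * (2 * cmod (z - 1))" "A * rho m x \<le> A * (2 * cmod (z + 1))"
    using A z1 z2 by (auto intro!: mult_left_mono)
  have "cmod (1 - of_real x) \<le> cmod (z - 1) + cmod (z - of_real x)"
    using norm_triangle_ineq4[of "z - of_real x" "z - 1"] by (simp add: add.commute)
  then have a: "1 - x \<le> (1 + 2 * A) * cmod (z - 1)"
    using z zA norm_of_real[of "1 - x", where 'a=complex] by (simp add: algebra_simps)
  have "cmod (1 + of_real x) \<le> cmod (z + 1) + cmod (z - of_real x)"
    using norm_triangle_ineq4[of "z + 1" "z - of_real x"] by (simp add: algebra_simps)
  then have b: "1 + x \<le> (1 + 2 * A) * cmod (z + 1)"
    using z zA norm_of_real[of "1 + x", where 'a=complex] by (simp add: algebra_simps)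
  have "(phi x)\<^sup>2 = (1 - x) * (1 + x)" using phi_sq[OF x] by (simp add: power2_eq_square algebra_simps)
  also have "\<dots> \<le> ((1 + 2 * A) * cmod (z - 1)) * ((1 + 2 * A) * cmod (z + 1))"
    using a b x A by (intro mult_mono) auto
  also have "\<dots> = ((1 + 2 * A) * s)\<^sup>2" by (simp add: power_mult_distrib s) (simp add: power2_eq_square)
  finally have 1: "phi x \<le> (1 + 2 * A) * s" by (rule power2_le_imp_le) (use s0 A in auto)
  have "2 \<le> cmod (z - 1) + cmod (z + 1)" using norm_triangle_ineq4[of "z + 1" "z - 1"] by simp
  then consider "1 \<le> cmod (z - 1)" | "1 \<le> cmod (z + 1)" by linarith
  then have "rho m x \<le> 2 * s\<^sup>2"
  proof cases
    case 1
    have "1 * rho m x \<le> cmod (z - 1) * (2 * cmod (z + 1))" using 1 z2 rp by (intro mult_mono) auto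
    then show ?thesis by (simp add: s)
  next
    case 2
    have "1 * rho m x \<le> cmod (z + 1) * (2 * cmod (z - 1))" using 2 z1 rp by (intro mult_mono) auto
    then show ?thesis by (simp add: s mult_ac)
  qed
  moreover have "(1 / real m)\<^sup>2 \<le> rho m x" using rho_ge[OF x, of m] by (simp add: power_divide)
  moreover have "2 * s\<^sup>2 \<le> (2 * s)\<^sup>2" by (simp add: power_mult_distrib)
  ultimately have "(1 / real m)\<^sup>2 \<le> (2 * s)\<^sup>2" by linarith
  then have 2: "1 / real m \<le> 2 * s" by (rule power2_le_imp_le) (use s0 in auto)
  have "real m * rho m x = phi x + 1 / real m" using m by (simp add: rho_phi distrib_left power2_eq_square)
  also have "\<dots> \<le> (3 + 2 * A) * s" using 1 2 by (simp add: algebra_simps)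
  finally show ?thesis using A by (simp add: s_def divide_le_eq mult.commute)
qed

text \<open>The constant of \<open>poly_complex_bound\<close> with A = r + 3: the Cauchy circle has
  radius at most 3 \<open>rho m x\<close> and its centre is within r \<open>rho m x\<close> of x.
  The divisor is the constant of \<open>rho_le_sqrt_dist\<close>, and \<open>fact r\<close> comes
  from Cauchy's estimate.\<close>

definition bernstein_const :: "nat \<Rightarrow> nat \<Rightarrow> real" where
  "bernstein_const \<sigma> r = (let A = real r + 3; B = 3 + 4 * A; k = 4 * B * A in
     fact r * (2 * (5 + 2 * real \<sigma>) * exp (k * (4 + 2 * real \<sigma>)) * (1 + k + 2 * B) ^ (2 * \<sigma>) / (1 / (3 + 2 * A))))"

lemma bernstein_const_pos: "bernstein_const \<sigma> r > 0"
proof -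
  have "0 < 5 + 2 * real \<sigma>" "0 < 1 + 4 * (3 + 4 * (real r + 3)) * (real r + 3) + 2 * (3 + 4 * (real r + 3))" "0 < 3 + 2 * (real r + 3)"
    by (intro add_pos_nonneg mult_nonneg_nonneg; simp)+
  then show ?thesis
    unfolding bernstein_const_def Let_def by (intro mult_pos_pos divide_pos_pos zero_less_power) (simp_all del: power_add_numeral)
qed

text \<open>The derivative is taken at \<xi> while scale and kernel stay at x, because \<xi> will be
  the uncontrolled mean value point of a difference centred at x.\<close>

lemma poly_deriv_bound:
  assumes m: "m \<ge> 1" and Q: "degree Q \<le> m" and x: "x \<in> {-1..1}" and \<xi>: "\<xi> \<in> {-1..1}" "\<bar>\<xi> - x\<bar> \<le> real r * rho m x"
  shows "\<bar>poly ((pderiv ^^ r) Q) \<xi>\<bar> \<le> bernstein_const \<sigma> r / rho m x ^ r * integral {-1..1} (\<lambda>y. \<bar>poly Q y\<bar> * decay_kernel \<sigma> m x y)"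
proof -
  define A where "A = real r + 3"
  have A: "A \<ge> 1" by (simp add: A_def)
  have rp: "rho m x > 0" by (rule rho_pos[OF x m])
  define M where "M = bernstein_const \<sigma> r / fact r * integral {-1..1} (\<lambda>y. \<bar>poly Q y\<bar> * decay_kernel \<sigma> m x y)"
  have "0 \<le> integral {-1..1} (\<lambda>y. \<bar>poly Q y\<bar> * decay_kernel \<sigma> m x y)"
    by (intro integral_nonneg integrable_continuous_real continuous_intros continuous_on_decay_kernel x m)
       (auto simp: decay_kernel_nonneg[OF x m])
  then have M0: "M \<ge> 0" unfolding M_def using bernstein_const_pos[of \<sigma> r] by (intro mult_nonneg_nonneg divide_nonneg_nonneg) auto
  \<comment> \<open>The centre \<xi> has distances 1 - \<xi> and 1 + \<xi> to the endpoints, so this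
    radius keeps the circle at least \<open>rho m x\<close>/2 away from both.\<close>
  obtain R where R: "rho m x \<le> R" "R \<le> 3 * rho m x" "rho m x \<le> 2 * \<bar>R - (1 - \<xi>)\<bar>" "rho m x \<le> 2 * \<bar>R - (1 + \<xi>)\<bar>"
    by (rule three_radii[OF rp])
  have bound: "cmod (poly (map_poly of_real Q) z) \<le> M" if z: "cmod (of_real \<xi> - z) = R" for z
  proof -
    have "cmod (z - of_real x) \<le> cmod (of_real \<xi> - z) + cmod (of_real (\<xi> - x))"
      using norm_triangle_ineq4[of "of_real (\<xi> - x)" "of_real \<xi> - z"] by (simp add: add.commute)
    also have "\<dots> \<le> A * rho m x" using R(2) \<xi>(2) unfolding z norm_of_real A_def by (simp add: distrib_right)
    finally have zx: "cmod (z - of_real x) \<le> A * rho m x" .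
    have "\<bar>R - (1 - \<xi>)\<bar> \<le> cmod (z - 1)"
      using norm_triangle_ineq3[of "of_real \<xi> - z" "of_real (\<xi> - 1)"] \<xi>(1) z unfolding norm_of_real
      by (simp add: norm_minus_commute)
    then have z1: "rho m x \<le> 2 * cmod (z - 1)" using R(3) by argo
    have "\<bar>R - (1 + \<xi>)\<bar> \<le> cmod (z + 1)"
      using norm_triangle_ineq3[of "of_real \<xi> - z" "of_real (\<xi> + 1)"] \<xi>(1) z unfolding norm_of_real
      by (simp add: norm_minus_commute add.commute)
    then have z2: "rho m x \<le> 2 * cmod (z + 1)" using R(4) by argo
    have c: "1 / (3 + 2 * A) > 0" using A by simp
    have Mc: "bernstein_const \<sigma> r / fact r = 2 * (5 + 2 * real \<sigma>) * exp (4 * (3 + 4 * A) * A * (4 + 2 * real \<sigma>)) * (1 + 4 * (3 + 4 * A) * A + 2 * (3 + 4 * A)) ^ (2 * \<sigma>) / (1 / (3 + 2 * A))"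
      unfolding bernstein_const_def Let_def A_def by simp
    show ?thesis unfolding M_def Mc
      by (rule poly_complex_bound[OF A c m Q x zx rho_le_sqrt_dist[OF x m A zx z1 z2]])
  qed
  have "cmod ((deriv ^^ r) (poly (map_poly of_real Q)) (of_real \<xi>)) \<le> fact r * M / R ^ r"
  proof (rule Cauchy_inequality)
    show "poly (map_poly of_real Q) holomorphic_on ball (of_real \<xi>) R"
      unfolding holomorphic_on_def field_differentiable_def by (meson poly_DERIV has_field_derivative_at_within)
    show "continuous_on (cball (complex_of_real \<xi>) R) (poly (map_poly of_real Q))"
      by (intro continuous_at_imp_continuous_on ballI DERIV_isCont[OF poly_DERIV])
  qed (use rp R bound in auto)
  then have "\<bar>poly ((pderiv ^^ r) Q) \<xi>\<bar> \<le> fact r * M / R ^ r"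
    by (simp add: deriv_pow_poly pderiv_pow_map_poly_of_real poly_map_poly_of_real)
  also have "\<dots> \<le> fact r * M / rho m x ^ r"
    using R(1) rp M0 by (intro divide_left_mono power_mono mult_nonneg_nonneg) auto
  also have "\<dots> = bernstein_const \<sigma> r / rho m x ^ r * integral {-1..1} (\<lambda>y. \<bar>poly Q y\<bar> * decay_kernel \<sigma> m x y)"
    by (simp add: M_def)
  finally show ?thesis .
qed

text \<open>The step d = h \<open>phi x\<close> is at most \<open>phi x\<close>/n \<le>
  \<open>rho m x\<close>, so the mean value point is within reach of
  \<open>poly_deriv_bound\<close>, and d^r against the r-th power of \<open>rho m x\<close> leaves
  the small factor.\<close>

lemma symm_difference_poly_bound:
  assumes m: "1 \<le> m" "m \<le> n" and Q: "degree Q \<le> m" and x: "x \<in> {-1..1}" and h: "0 < h" "h \<le> 1 / real n"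
  shows "\<bar>symm_difference r (h * phi x) (poly Q) x\<bar>
    \<le> bernstein_const \<sigma> r * (phi x / (real n * rho m x)) ^ r * integral {-1..1} (\<lambda>y. \<bar>poly Q y\<bar> * decay_kernel \<sigma> m x y)"
proof -
  define d where "d = h * phi x"
  have n: "n \<ge> 1" using m by simp
  have rp: "rho m x > 0" by (rule rho_pos[OF x m(1)])
  have d0: "d \<ge> 0" using h phi_nonneg[OF x] by (simp add: d_def)
  have dn: "d \<le> phi x / n" using mult_right_mono[OF h(2) phi_nonneg[OF x]] by (simp add: d_def)
  also have "\<dots> \<le> rho n x" by (simp add: rho_phi)
  also have "\<dots> \<le> rho m x" using rho_antimono[OF m x] .
  finally have dr: "d \<le> rho m x" .
  have I0: "0 \<le> integral {-1..1} (\<lambda>y. \<bar>poly Q y\<bar> * decay_kernel \<sigma> m x y)" (is "0 \<le> ?I")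
    by (intro integral_nonneg integrable_continuous_real continuous_intros continuous_on_decay_kernel x m)
       (auto simp: decay_kernel_nonneg[OF x m(1)])
  show ?thesis
  proof (cases "x - real r * d / 2 \<in> {-1..1} \<and> x + real r * d / 2 \<in> {-1..1}")
    case True
    obtain \<xi> where \<xi>: "\<xi> \<in> {x - real r * d / 2..x - real r * d / 2 + real r * d}"
      "(\<Sum>i=0..r. real (r choose i) * (-1) ^ (r - i) * poly Q (x - real r * d / 2 + real i * d)) = d ^ r * poly ((pderiv ^^ r) Q) \<xi>"
      using binomial_difference_poly[OF d0, of "x - real r * d / 2" r Q] by blast
    have eq: "x - real r * d / 2 + real r * d = x + real r * d / 2" by (simp add: field_simps)
    have "\<bar>\<xi> - x\<bar> \<le> real r * d / 2" using \<xi>(1) unfolding eq abs_le_iff by auto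
    also have "\<dots> \<le> real r * d" using d0 by simp
    also have "\<dots> \<le> real r * rho m x" using dr by (intro mult_left_mono) auto
    finally have \<xi>2: "\<bar>\<xi> - x\<bar> \<le> real r * rho m x" .
    have \<xi>1: "\<xi> \<in> {-1..1}" using \<xi>(1) True unfolding eq by auto
    have "\<bar>symm_difference r d (poly Q) x\<bar> = d ^ r * \<bar>poly ((pderiv ^^ r) Q) \<xi>\<bar>"
      using True \<xi>(2) d0 by (simp add: symm_difference_def abs_mult)
    also have "\<dots> \<le> (phi x / n) ^ r * (bernstein_const \<sigma> r / rho m x ^ r * ?I)"
      using d0 dn by (intro mult_mono power_mono poly_deriv_bound m Q x \<xi>1 \<xi>2) auto
    also have "\<dots> = bernstein_const \<sigma> r * (phi x / (real n * rho m x)) ^ r * ?I"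
      by (simp add: power_divide power_mult_distrib)
    finally show ?thesis by (simp add: d_def)
  next
    case False
    then have "symm_difference r d (poly Q) x = 0" unfolding symm_difference_def by (simp only: if_False)
    then show ?thesis using I0 bernstein_const_pos[of \<sigma> r] rp phi_nonneg[OF x] by (simp add: d_def)
  qed
qed

section \<open>Change of variables\<close>

text \<open>A Lebesgue measurable function composed with a continuous map need not be measurable, so
  compositions are formed with a Borel representative and transferred back almost
  everywhere.\<close>

lemma leb1_borel_representative:
  fixes g :: "real \<Rightarrow> real"
  assumes "g \<in> borel_measurable leb1"
  obtains g' where "g' \<in> borel_measurable borel" "AE x in lborel. x \<in> {-1..1} \<longrightarrow> g x = g' x"
proof -
  have "(\<lambda>x. if x \<in> {-1..1} then g x else 0) \<in> borel_measurable lebesgue"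
    using assms by (subst borel_measurable_if) auto
  from completion_ex_borel_measurable_real[OF this]
  obtain g' where g': "g' \<in> borel_measurable lborel" "AE x in lborel. (if x \<in> {-1..1} then g x else 0) = g' x"
    by blast
  from g'(2) have "AE x in lborel. x \<in> {-1..1} \<longrightarrow> g x = g' x" by eventually_elim auto
  then show ?thesis using that g'(1) by simp
qed

lemma nn_integral_leb1: "(\<integral>\<^sup>+ x. F x \<partial>leb1) = (\<integral>\<^sup>+ x. F x * indicator {-1..1} x \<partial>lborel)"
  by (simp add: nn_integral_restrict_space nn_integral_completion)

lemma AE_leb1: "(AE x in leb1. P x) \<longleftrightarrow> (AE x in lborel. x \<in> {-1..1} \<longrightarrow> P x)"
  by (simp add: AE_restrict_space_iff AE_completion_iff)

context
  fixes a b :: real and u u' :: "real \<Rightarrow> real"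
  assumes ab: "a \<le> b" "-1 \<le> a" "b \<le> 1"
    and u: "\<And>x. x \<in> {a..b} \<Longrightarrow> (u has_real_derivative u' x) (at x)"
    and u'_cont: "continuous_on {a..b} u'"
    and u'_ge: "\<And>x. x \<in> {a..b} \<Longrightarrow> 1 / 2 \<le> u' x"
    and u_mem: "\<And>x. x \<in> {a..b} \<Longrightarrow> u x \<in> {-1..1}"
begin

lemma subst_borel_measurable:
  assumes [measurable]: "F \<in> borel_measurable borel"
  shows "(\<lambda>x. if x \<in> {a..b} then F (u x) else 0 :: real) \<in> borel_measurable borel"
proof -
  have "continuous_on {a..b} u" using u by (meson DERIV_continuous continuous_at_imp_continuous_on)
  then have [measurable]: "(\<lambda>x. if x \<in> {a..b} then u x else 0) \<in> borel_measurable borel"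
    by (intro borel_measurable_continuous_on_if continuous_intros) auto
  have "(\<lambda>x. if x \<in> {a..b} then F (if x \<in> {a..b} then u x else 0) else 0) \<in> borel_measurable borel"
    by measurable
  then show ?thesis by (rule measurable_cong[THEN iffD1, rotated]) auto
qed

text \<open>The lower bound 1/2 for the derivative allows 2 u' to be inserted as a Jacobian.\<close>

lemma nn_integral_subst_le:
  assumes [measurable]: "F \<in> borel_measurable borel" and F: "\<And>y. 0 \<le> (F y :: real)"
  shows "(\<integral>\<^sup>+ x. ennreal (F (u x)) * indicator {a..b} x \<partial>lborel) \<le> 2 * (\<integral>\<^sup>+ y. ennreal (F y) * indicator {-1..1} y \<partial>lborel)"
proof -
  have m: "a \<in> {a..b}" "b \<in> {a..b}" using ab by auto
  have u'0: "0 \<le> u' x" if "x \<in> {a..b}" for x using u'_ge[OF that] by simp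
  have "(\<integral>\<^sup>+ x. ennreal (F (u x)) * indicator {a..b} x \<partial>lborel)
      \<le> (\<integral>\<^sup>+ x. ennreal (2 * F (u x) * u' x * indicator {a..b} x) \<partial>lborel)"
  proof (rule nn_integral_mono)
    fix x
    show "ennreal (F (u x)) * indicator {a..b} x \<le> ennreal (2 * F (u x) * u' x * indicator {a..b} x)"
    proof (cases "x \<in> {a..b}")
      case True
      have "F (u x) * 1 \<le> F (u x) * (2 * u' x)" using u'_ge[OF True] F by (intro mult_left_mono) auto
      then have "ennreal (F (u x)) \<le> ennreal (2 * F (u x) * u' x)" by (intro ennreal_leI) (simp add: mult_ac)
      then show ?thesis using True by simp
    qed simp
  qed
  also have "\<dots> = (\<integral>\<^sup>+ y. ennreal (2 * F y * indicator {u a..u b} y) \<partial>lborel)"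
    by (rule nn_integral_substitution[of u a b "\<lambda>y. 2 * F y" u', symmetric])
       (use u u'_cont u'0 ab in \<open>auto simp: set_borel_measurable_def\<close>)
  also have "\<dots> \<le> (\<integral>\<^sup>+ y. 2 * (ennreal (F y) * indicator {-1..1} y) \<partial>lborel)"
    using u_mem[OF m(1)] u_mem[OF m(2)] F
    by (intro nn_integral_mono) (auto simp: indicator_def ennreal_mult)
  also have "\<dots> = 2 * (\<integral>\<^sup>+ y. ennreal (F y) * indicator {-1..1} y \<partial>lborel)"
    by (rule nn_integral_cmult) measurable
  finally show ?thesis .
qed

text \<open>Preimages of null sets under u are null: the indicator of the exceptional set is put
  into \<open>nn_integral_subst_le\<close>.\<close>

lemma AE_subst:
  assumes "AE y in lborel. y \<in> {-1..1} \<longrightarrow> P y"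
  shows "AE x in lborel. x \<in> {a..b} \<longrightarrow> P (u x)"
proof -
  obtain N where N: "N \<in> null_sets lborel" "\<And>y. y \<in> {-1..1} \<Longrightarrow> y \<notin> N \<Longrightarrow> P y"
    using assms unfolding eventually_ae_filter by auto
  then have [measurable]: "N \<in> sets borel" by auto
  have "(\<integral>\<^sup>+ y. ennreal (indicator N y) * indicator {-1..1} y \<partial>lborel) \<le> (\<integral>\<^sup>+ y. indicator N y \<partial>lborel)"
    by (intro nn_integral_mono) (auto simp: indicator_def)
  also have "\<dots> = 0" using N by (subst nn_integral_indicator) auto
  finally have "(\<integral>\<^sup>+ x. ennreal (indicator N (u x)) * indicator {a..b} x \<partial>lborel) = 0"
    using nn_integral_subst_le[of "indicator N"] by (auto simp: le_zero_eq)
  moreover have "(\<lambda>x. ennreal (indicator N (u x)) * indicator {a..b} x) = (\<lambda>x. ennreal (if x \<in> {a..b} then indicator N (u x) else 0))"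
    by (auto simp: fun_eq_iff)
  moreover have "(\<lambda>x. ennreal (if x \<in> {a..b} then indicator N (u x) else 0)) \<in> borel_measurable borel"
    using subst_borel_measurable[of "indicator N"] by measurable
  ultimately have "AE x in lborel. ennreal (if x \<in> {a..b} then indicator N (u x) else 0) = 0"
    by (simp add: nn_integral_0_iff_AE)
  then show ?thesis
  proof eventually_elim
    case (elim x)
    then show ?case using N(2)[of "u x"] u_mem[of x] by (auto simp: indicator_def split: if_splits)
  qed
qed

lemma subst_leb1_measurable:
  assumes g: "g \<in> borel_measurable leb1"
  shows "(\<lambda>x. if x \<in> {a..b} then g (u x) else 0 :: real) \<in> borel_measurable leb1"
proof -
  obtain g' where g': "g' \<in> borel_measurable borel" "AE x in lborel. x \<in> {-1..1} \<longrightarrow> g x = g' x"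
    by (rule leb1_borel_representative[OF g])
  have "(\<lambda>x. if x \<in> {a..b} then g' (u x) else 0) \<in> borel_measurable lebesgue"
    using subst_borel_measurable[OF g'(1)] by (intro measurable_completion) simp
  moreover have "AE x in lebesgue. (if x \<in> {a..b} then g' (u x) else 0) = (if x \<in> {a..b} then g (u x) else 0)"
    unfolding AE_completion_iff using AE_subst[OF g'(2)] by eventually_elim auto
  ultimately have "(\<lambda>x. if x \<in> {a..b} then g (u x) else 0) \<in> borel_measurable lebesgue"
    by (rule borel_measurable_AE)
  then show ?thesis by (rule measurable_restrict_space1)
qed

text \<open>The 2 pays for the Jacobian and C for moving the weight from x to u x. For finite
  exponents both arise under the integral of q-th powers, and 2 C \<ge> 1 allows the same constant
  outside the root.\<close>

lemma wnorm_subst_le: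
  assumes p: "1 \<le> p" and g: "g \<in> borel_measurable leb1" and v: "continuous_on {-1..1} v"
    and v0: "\<And>x. x \<in> {-1..1} \<Longrightarrow> 0 \<le> v x" and C: "C \<ge> 1"
    and vC: "\<And>x. x \<in> {a..b} \<Longrightarrow> v x \<le> C * v (u x)"
  shows "wnorm p v (\<lambda>x. if x \<in> {a..b} then g (u x) else 0) \<le> ennreal (2 * C) * wnorm p v g"
proof -
  define T where "T = (\<lambda>x. if x \<in> {a..b} then g (u x) else 0)"
  have T: "T x = (if x \<in> {a..b} then g (u x) else 0)" for x by (simp add: T_def)
  have [measurable]: "v \<in> borel_measurable leb1" "g \<in> borel_measurable leb1" "T \<in> borel_measurable leb1"
    using v g subst_leb1_measurable[OF g] unfolding T_def
    by (auto intro: continuous_imp_measurable_on_sets_lebesgue simp del: atLeastAtMost_iff)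
  have "wnorm p v T \<le> ennreal (2 * C) * wnorm p v g" if hB: "wnorm p v g = ennreal B" "B \<ge> 0" for B
    using p
  proof (cases rule: ennreal_ge1_cases)
    case 1
    have "AE x in leb1. \<bar>g x\<bar> * v x \<le> B" using hB 1 by (subst wnorm_le_infinity_iff[symmetric]) auto
    then have "AE x in lborel. x \<in> {a..b} \<longrightarrow> \<bar>g (u x)\<bar> * v (u x) \<le> B" unfolding AE_leb1 by (rule AE_subst)
    then have "AE x in leb1. \<bar>T x\<bar> * v x \<le> 2 * C * B" unfolding AE_leb1
    proof eventually_elim
      case (elim x)
      show ?case
      proof (cases "x \<in> {a..b}")
        case True
        have "\<bar>g (u x)\<bar> * v x \<le> \<bar>g (u x)\<bar> * (C * v (u x))" using vC[OF True] by (intro mult_left_mono) auto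
        also have "\<dots> = C * (\<bar>g (u x)\<bar> * v (u x))" by simp
        also have "\<dots> \<le> C * B" using elim True C by (intro mult_left_mono) auto
        also have "\<dots> \<le> 2 * C * B" using C hB by simp
        finally show ?thesis using True by (simp add: T)
      next
        case False
        then show ?thesis using C hB by (auto simp: T)
      qed
    qed
    then have "wnorm p v T \<le> ennreal (2 * C * B)" unfolding 1 using C hB by (subst wnorm_le_infinity_iff) auto
    then show ?thesis using hB C by (simp add: ennreal_mult)
  next
    case (2 q)
    obtain g' where g'[measurable]: "g' \<in> borel_measurable borel" and gg': "AE x in lborel. x \<in> {-1..1} \<longrightarrow> g x = g' x"
      by (rule leb1_borel_representative[OF g])
    define F where "F y = \<bar>g' y\<bar> powr q * (if y \<in> {-1..1} then v y else 0)" for y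
    have "(\<lambda>y. if y \<in> {-1..1} then v y else 0) \<in> borel_measurable borel"
      by (intro borel_measurable_continuous_on_if v continuous_intros) auto
    then have F[measurable]: "F \<in> borel_measurable borel" unfolding F_def by measurable
    have F0: "0 \<le> F y" for y using v0 by (simp add: F_def)
    have gF: "AE x in lborel. x \<in> {-1..1} \<longrightarrow> \<bar>g x\<bar> powr q * v x = F x"
      using gg' by eventually_elim (simp add: F_def)
    have "(\<integral>\<^sup>+ x. ennreal (F x) * indicator {-1..1} x \<partial>lborel) = (\<integral>\<^sup>+ x. ennreal (\<bar>g x\<bar> powr q * v x) \<partial>leb1)"
      unfolding nn_integral_leb1 by (rule nn_integral_cong_AE) (use gF in eventually_elim, auto simp: indicator_def)
    also have "\<dots> \<le> ennreal (B powr q)" using hB 2 by (subst wnorm_le_iff[symmetric]) auto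
    finally have FB: "(\<integral>\<^sup>+ x. ennreal (F x) * indicator {-1..1} x \<partial>lborel) \<le> ennreal (B powr q)" .
    have "(\<integral>\<^sup>+ x. ennreal (\<bar>T x\<bar> powr q * v x) \<partial>leb1) \<le> (\<integral>\<^sup>+ x. ennreal C * (ennreal (F (u x)) * indicator {a..b} x) \<partial>lborel)"
      unfolding nn_integral_leb1
    proof (rule nn_integral_mono_AE)
      show "AE x in lborel. ennreal (\<bar>T x\<bar> powr q * v x) * indicator {-1..1} x \<le> ennreal C * (ennreal (F (u x)) * indicator {a..b} x)"
        using AE_subst[OF gF]
      proof eventually_elim
        case (elim x)
        show ?case
        proof (cases "x \<in> {a..b}")
          case True
          have "\<bar>g (u x)\<bar> powr q * v x \<le> \<bar>g (u x)\<bar> powr q * (C * v (u x))" using vC[OF True] by (intro mult_left_mono) auto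
          also have "\<dots> = C * F (u x)" using elim True by simp
          finally have "ennreal (\<bar>g (u x)\<bar> powr q * v x) \<le> ennreal (C * F (u x))" by (rule ennreal_leI)
          also have "\<dots> = ennreal C * ennreal (F (u x))" using C F0 by (intro ennreal_mult) auto
          finally show ?thesis using True ab by (simp add: indicator_def T)
        qed (use 2 in \<open>auto simp: T\<close>)
      qed
    qed
    also have "\<dots> = ennreal C * (\<integral>\<^sup>+ x. ennreal (F (u x)) * indicator {a..b} x \<partial>lborel)"
    proof (rule nn_integral_cmult)
      have "(\<lambda>x. ennreal (F (u x)) * indicator {a..b} x) = (\<lambda>x. ennreal (if x \<in> {a..b} then F (u x) else 0))"
        by (auto simp: fun_eq_iff)
      then show "(\<lambda>x. ennreal (F (u x)) * indicator {a..b} x) \<in> borel_measurable lborel"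
        using subst_borel_measurable[OF F] by simp
    qed
    also have "\<dots> \<le> ennreal C * (2 * ennreal (B powr q))"
      by (intro mult_left_mono order_trans[OF nn_integral_subst_le[OF F F0] mult_left_mono[OF FB]]) auto
    also have "\<dots> = ennreal (2 * C * B powr q)" using C hB by (simp add: ennreal_mult mult_ac)
    also have "\<dots> \<le> ennreal ((2 * C * B) powr q)"
    proof (rule ennreal_leI)
      have "(2 * C) powr 1 \<le> (2 * C) powr q" using C 2 by (intro powr_mono) auto
      then show "2 * C * B powr q \<le> (2 * C * B) powr q"
        using C hB by (simp add: powr_mult mult_right_mono)
    qed
    finally have "wnorm p v T \<le> ennreal (2 * C * B)" unfolding 2 using C hB 2 by (subst wnorm_le_iff) auto
    then show ?thesis using hB C by (simp add: ennreal_mult)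
  qed
  then show ?thesis unfolding T_def[symmetric] using C by (cases "wnorm p v g") (auto simp: ennreal_mult_top)
qed

end

section \<open>Where the shifted points stay in the interval\<close>

definition cutoff :: "real \<Rightarrow> real" where
  "cutoff s = (1 - s\<^sup>2) / (1 + s\<^sup>2)"

lemma cutoff_bounds: "0 < s \<Longrightarrow> s \<le> 1 \<Longrightarrow> 0 \<le> cutoff s \<and> cutoff s < 1"
  by (auto simp: cutoff_def power_le_one add_pos_pos divide_less_eq)

text \<open>Squaring and cancelling 1 - x leaves s^2 (1 + x) \<le> 1 - x, which is x \<le>
  \<open>cutoff s\<close>. The point x = 1 is excluded: there \<open>phi\<close> vanishes and the
  left side holds although 1 > \<open>cutoff s\<close>.\<close>

lemma add_phi_le_1_iff:
  assumes x: "x \<in> {-1..<1}" and s: "0 < s"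
  shows "x + s * phi x \<le> 1 \<longleftrightarrow> x \<le> cutoff s"
proof -
  have xI: "x \<in> {-1..1}" using x by auto
  have s2: "0 < 1 + s\<^sup>2" by (simp add: add_pos_nonneg)
  have "x + s * phi x \<le> 1 \<longleftrightarrow> s * phi x \<le> 1 - x" by auto
  also have "\<dots> \<longleftrightarrow> (s * phi x)\<^sup>2 \<le> (1 - x)\<^sup>2"
    using s phi_nonneg[OF xI] x by (intro power_mono_iff[symmetric]) auto
  also have "\<dots> \<longleftrightarrow> (1 - x) * (s\<^sup>2 * (1 + x)) \<le> (1 - x) * (1 - x)"
    by (simp only: power_mult_distrib phi_sq[OF xI]) (simp add: power2_eq_square algebra_simps)
  also have "\<dots> \<longleftrightarrow> s\<^sup>2 * (1 + x) \<le> 1 - x" using x by simp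
  also have "\<dots> \<longleftrightarrow> x \<le> cutoff s" using s2 by (simp add: cutoff_def le_divide_eq algebra_simps)
  finally show ?thesis .
qed

lemma phi_minus: "phi (- x) = phi x"
  by (simp add: phi_def)

lemma phi_pos: "x \<in> {-1<..<1} \<Longrightarrow> 0 < phi x"
  by (simp add: phi_def abs_square_less_1 abs_less_iff)

lemma shift_domain:
  assumes x: "x \<in> {-1<..<1}" and s: "0 < s"
  shows "(x - s * phi x \<in> {-1..1} \<and> x + s * phi x \<in> {-1..1}) \<longleftrightarrow> x \<in> {- cutoff s..cutoff s}"
proof -
  have "0 \<le> s * phi x" using s phi_pos[OF x] by simp
  moreover have "x + s * phi x \<le> 1 \<longleftrightarrow> x \<le> cutoff s" using x s by (intro add_phi_le_1_iff) auto
  moreover have "- x + s * phi (- x) \<le> 1 \<longleftrightarrow> - x \<le> cutoff s" using x s by (intro add_phi_le_1_iff) auto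
  ultimately show ?thesis using x by (auto simp: phi_minus)
qed

lemma phi_deriv:
  assumes "x \<in> {-1<..<1}"
  shows "(phi has_real_derivative - x / phi x) (at x)"
proof -
  have "x\<^sup>2 < 1" using assms by (simp add: abs_square_less_1 abs_less_iff)
  then have "(sqrt has_real_derivative inverse (sqrt (1 - x\<^sup>2)) / 2) (at (1 - x\<^sup>2))"
    by (intro DERIV_real_sqrt) simp
  moreover have "((\<lambda>x. 1 - x\<^sup>2) has_real_derivative - 2 * x) (at x)"
    by (auto intro!: derivative_eq_intros)
  ultimately have "((\<lambda>x. sqrt (1 - x\<^sup>2)) has_real_derivative inverse (sqrt (1 - x\<^sup>2)) / 2 * (- 2 * x)) (at x)"
    by (rule DERIV_chain2)
  moreover have "inverse c / 2 * (- 2 * x) = - x / c" for c :: real by (cases "c = 0") (simp_all add: field_simps)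
  ultimately show ?thesis unfolding phi_def[abs_def] by metis
qed

text \<open>On this domain s^2 (1 + |x|) \<le> 1 - |x|; multiplying by 1 + |x| and using 2|x| \<le>
  1 + |x| gives 2 s |x| \<le> \<open>phi x\<close>. So every shift in the difference is an
  increasing change of variables with Jacobian at least 1/2, even where the derivative of
  \<open>phi\<close> is large.\<close>

lemma shift_deriv_ge:
  assumes s: "0 < s" "s \<le> 1" and x: "x \<in> {- cutoff s..cutoff s}" and t: "\<bar>t\<bar> \<le> s"
  shows "1 / 2 \<le> 1 + t * (- x / phi x)"
proof -
  have c: "0 \<le> cutoff s" "cutoff s < 1" using cutoff_bounds[OF s] by auto
  have x1: "x \<in> {-1<..<1}" "x \<in> {-1..1}" using x c by auto
  have p: "phi x > 0" by (rule phi_pos[OF x1(1)])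
  have s2: "0 < 1 + s\<^sup>2" by (simp add: add_pos_nonneg)
  have ax: "\<bar>x\<bar> \<le> cutoff s" using x by auto
  have "(2 * s * \<bar>x\<bar>)\<^sup>2 \<le> (phi x)\<^sup>2"
  proof -
    have "\<bar>x\<bar> * (1 + s\<^sup>2) \<le> 1 - s\<^sup>2" using ax s2 by (simp add: cutoff_def le_divide_eq)
    then have "s\<^sup>2 * (1 + \<bar>x\<bar>) \<le> 1 - \<bar>x\<bar>" by (simp add: algebra_simps)
    then have "(s\<^sup>2 * (1 + \<bar>x\<bar>)) * (1 + \<bar>x\<bar>) \<le> (1 - \<bar>x\<bar>) * (1 + \<bar>x\<bar>)" by (intro mult_right_mono) auto
    moreover have "4 * \<bar>x\<bar>\<^sup>2 \<le> (1 + \<bar>x\<bar>) * (1 + \<bar>x\<bar>)"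
    proof -
      have "\<bar>x\<bar> \<le> 1" using x1 by auto
      then have "(2 * \<bar>x\<bar>)\<^sup>2 \<le> (1 + \<bar>x\<bar>)\<^sup>2" by (intro power_mono) auto
      then show ?thesis by (simp add: power_mult_distrib power2_eq_square)
    qed
    then have "s\<^sup>2 * (4 * \<bar>x\<bar>\<^sup>2) \<le> s\<^sup>2 * ((1 + \<bar>x\<bar>) * (1 + \<bar>x\<bar>))" by (intro mult_left_mono) auto
    ultimately have "s\<^sup>2 * (4 * \<bar>x\<bar>\<^sup>2) \<le> (1 - \<bar>x\<bar>) * (1 + \<bar>x\<bar>)" by (simp add: mult.assoc)
    then show ?thesis unfolding phi_sq[OF x1(2)] by (simp add: power_mult_distrib power2_eq_square algebra_simps)
  qed
  then have "2 * s * \<bar>x\<bar> \<le> phi x" by (rule power2_le_imp_le) (use p in auto)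
  moreover have "2 * (\<bar>t\<bar> * \<bar>x\<bar>) \<le> 2 * (s * \<bar>x\<bar>)" using t by (intro mult_left_mono mult_right_mono) auto
  ultimately have "2 * \<bar>t * x\<bar> \<le> phi x" by (simp add: abs_mult)
  then have "2 * (t * x) \<le> phi x" by linarith
  then have "t * x / phi x \<le> 1 / 2" using p by (simp add: divide_le_eq)
  then show ?thesis by simp
qed

section \<open>Boundedness of the weighted differences\<close>

lemma wnorm_cong:
  assumes "\<And>x. x \<in> {-1..1} \<Longrightarrow> g x = h x"
  shows "wnorm p v g = wnorm p v h"
proof -
  have "(\<integral>\<^sup>+ x. ennreal (\<bar>g x\<bar> powr enn2real p * v x) \<partial>leb1) = (\<integral>\<^sup>+ x. ennreal (\<bar>h x\<bar> powr enn2real p * v x) \<partial>leb1)"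
    by (rule nn_integral_cong) (simp add: assms)
  moreover have "esssup leb1 (\<lambda>x. ennreal (\<bar>g x\<bar> * v x)) = esssup leb1 (\<lambda>x. ennreal (\<bar>h x\<bar> * v x))"
  proof -
    have "(\<lambda>x. ennreal (\<bar>g x\<bar> * v x)) \<in> borel_measurable leb1 \<longleftrightarrow> (\<lambda>x. ennreal (\<bar>h x\<bar> * v x)) \<in> borel_measurable leb1"
      by (rule measurable_cong) (simp add: assms)
    moreover have "Limsup (ae_filter leb1) (\<lambda>x. ennreal (\<bar>g x\<bar> * v x)) = Limsup (ae_filter leb1) (\<lambda>x. ennreal (\<bar>h x\<bar> * v x))"
      by (rule Limsup_eq) (rule AE_I2, simp add: assms)
    ultimately show ?thesis by (simp add: esssup_def)
  qed
  ultimately show ?thesis by (simp add: wnorm_def)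
qed

lemma cutoff_shift:
  assumes s: "0 < s" "s \<le> 1" and x: "x \<in> {- cutoff s..cutoff s}" and t: "\<bar>t\<bar> \<le> s"
  shows "x + t * phi x \<in> {-1..1}"
proof -
  have c: "0 \<le> cutoff s" "cutoff s < 1" using cutoff_bounds[OF s] by auto
  have x1: "x \<in> {-1<..<1}" using x c by auto
  then have "x - s * phi x \<in> {-1..1}" "x + s * phi x \<in> {-1..1}" using shift_domain[OF x1 s(1)] x by auto
  moreover have "\<bar>t * phi x\<bar> \<le> s * phi x" using t phi_pos[OF x1] by (simp add: abs_mult mult_right_mono)
  ultimately show ?thesis by (auto simp: abs_le_iff)
qed

text \<open>The step vanishes at both endpoints, so all nodes coincide and the alternating binomial
  sum is 0. These points pass the domain test of the difference but lie outside the interval given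
  by \<open>cutoff\<close>.\<close>

lemma symm_difference_endpoint:
  assumes "x = 1 \<or> x = -1" "r \<ge> 1"
  shows "symm_difference r (h * phi x) f x = 0"
proof -
  have "phi x = 0" using assms by (auto simp: phi_def)
  then show ?thesis using binomial_difference_const[OF assms(2), of "f x"] by (simp add: symm_difference_def)
qed

text \<open>All nodes share one domain, the interval on which the outermost shifts stay in [-1,1],
  so the difference is a combination of composition operators.\<close>

lemma symm_difference_eq_sum:
  assumes x: "x \<in> {-1..1}" and r: "r \<ge> 1" and h: "h > 0" and s: "real r * h / 2 \<le> 1"
  shows "symm_difference r (h * phi x) f x = (\<Sum>i=0..r. (real (r choose i) * (-1) ^ (r - i)) *
    (if x \<in> {- cutoff (real r * h / 2)..cutoff (real r * h / 2)} then f (x + (real i - real r / 2) * h * phi x) else 0))"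
proof -
  let ?s = "real r * h / 2"
  have s0: "0 < ?s" using r h by simp
  have c: "0 \<le> cutoff ?s" "cutoff ?s < 1" using cutoff_bounds[OF s0 s] by auto
  show ?thesis
  proof (cases "x = 1 \<or> x = -1")
    case True
    then have "x \<notin> {- cutoff ?s..cutoff ?s}" using c by auto
    then show ?thesis unfolding symm_difference_endpoint[OF True r] if_not_P[OF \<open>x \<notin> {- cutoff ?s..cutoff ?s}\<close>] by simp
  next
    case False
    then have x1: "x \<in> {-1<..<1}" using x by auto
    have e: "real r * (h * phi x) / 2 = ?s * phi x" by simp
    have d: "(x - real r * (h * phi x) / 2 \<in> {-1..1} \<and> x + real r * (h * phi x) / 2 \<in> {-1..1}) = (x \<in> {- cutoff ?s..cutoff ?s})"
      unfolding e by (rule shift_domain[OF x1 s0])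
    have a: "x - real r * (h * phi x) / 2 + real i * (h * phi x) = x + (real i - real r / 2) * h * phi x" for i
      by (simp add: algebra_simps)
    show ?thesis unfolding symm_difference_def d a
      by (cases "x \<in> {- cutoff ?s..cutoff ?s}") (simp_all del: atLeastAtMost_iff)
  qed
qed

lemma symm_difference_eq_0:
  assumes x: "x \<in> {-1..1}" and r: "r \<ge> 1" and s: "real r * h / 2 > 1"
  shows "symm_difference r (h * phi x) f x = 0"
proof (cases "x = 1 \<or> x = -1")
  case True then show ?thesis by (rule symm_difference_endpoint[OF _ r])
next
  case False
  let ?s = "real r * h / 2"
  have x1: "x \<in> {-1<..<1}" using x False by auto
  have "1 < ?s\<^sup>2" using s by (simp only: one_less_power zero_less_numeral)
  then have "cutoff ?s < 0" unfolding cutoff_def by (intro divide_neg_pos add_pos_nonneg) auto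
  then have "x \<notin> {- cutoff ?s..cutoff ?s}" by auto
  moreover have e: "real r * (h * phi x) / 2 = ?s * phi x" by simp
  have "(x - real r * (h * phi x) / 2 \<in> {-1..1} \<and> x + real r * (h * phi x) / 2 \<in> {-1..1}) = (x \<in> {- cutoff ?s..cutoff ?s})"
    unfolding e by (rule shift_domain[OF x1]) (use s in linarith)
  ultimately show ?thesis unfolding symm_difference_def by (simp only: if_False)
qed

definition shift_const :: "nat \<Rightarrow> nat \<Rightarrow> real" where
  "shift_const \<tau> r = 2 * 8 ^ \<tau> * (1 + real r) ^ (2 * \<tau> + 1)"

lemma shift_const_ge_1: "shift_const \<tau> r \<ge> 1"
proof -
  have "1 * (1 * 1) \<le> 2 * ((8::real) ^ \<tau> * (1 + real r) ^ (2 * \<tau> + 1))"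
    by (intro mult_mono one_le_power) auto
  then show ?thesis by (simp add: shift_const_def)
qed

text \<open>The difference is a sum of r + 1 composition operators. Each shift has derivative at
  least 1/2 and moves x by at most r \<open>rho n x\<close>, over which the weight changes by at
  most the factor \<open>shift_const\<close>; the binomial coefficients sum to 2^r.\<close>

lemma
  assumes dw: "doubling_weight L w" and t: "max L 1 \<le> (5/4) ^ \<tau>" and p: "1 \<le> p" and r: "r \<ge> 1" and n: "n \<ge> 1"
    and h: "0 < h" "h \<le> 1 / real n" and f: "f \<in> borel_measurable leb1"
  shows symm_difference_measurable: "(\<lambda>x. symm_difference r (h * phi x) f x) \<in> borel_measurable leb1"
    and wnorm_symm_difference_le: "wnorm p (weight_avg w n) (\<lambda>x. symm_difference r (h * phi x) f x)
      \<le> ennreal (2 ^ r * (2 * shift_const \<tau> r)) * wnorm p (weight_avg w n) f"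
proof -
  let ?s = "real r * h / 2"
  let ?v = "weight_avg w n"
  have vm: "?v \<in> borel_measurable leb1"
    by (intro continuous_imp_measurable_on_sets_lebesgue continuous_on_weight_avg[OF dw n]) auto
  have v0: "\<And>x. x \<in> {-1..1} \<Longrightarrow> 0 \<le> ?v x" using weight_avg_nonneg[OF dw _ n] .
  have C0: "0 \<le> shift_const \<tau> r" using shift_const_ge_1[of \<tau> r] by simp
  have "(\<lambda>x. symm_difference r (h * phi x) f x) \<in> borel_measurable leb1
    \<and> wnorm p ?v (\<lambda>x. symm_difference r (h * phi x) f x) \<le> ennreal (2 ^ r * (2 * shift_const \<tau> r)) * wnorm p ?v f"
  proof (cases "?s \<le> 1")
    \<comment> \<open>For n small compared with r the half-span can exceed 1; the difference is then
      identically 0.\<close>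
    case False
    then have z: "symm_difference r (h * phi x) f x = 0" if "x \<in> {-1..1}" for x
      using that by (intro symm_difference_eq_0 r) auto
    have "(\<lambda>x. symm_difference r (h * phi x) f x) \<in> borel_measurable leb1 \<longleftrightarrow> (\<lambda>x. 0 :: real) \<in> borel_measurable leb1"
      by (rule measurable_cong) (simp add: z)
    moreover have "wnorm p ?v (\<lambda>x. symm_difference r (h * phi x) f x) = wnorm p ?v (\<lambda>x. 0)"
      by (rule wnorm_cong) (rule z)
    ultimately show ?thesis using wnorm_zero[OF vm v0 p] by simp
  next
    case True
    have s0: "0 < ?s" using r h by simp
    have c: "0 \<le> cutoff ?s" "cutoff ?s < 1" using cutoff_bounds[OF s0 True] by auto
    define a where "a = - cutoff ?s"
    define b where "b = cutoff ?s"
    define u where "u i x = x + (real i - real r / 2) * h * phi x" for i x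
    define T where "T i x = (if x \<in> {a..b} then f (u i x) else 0)" for i x
    define k where "k i = real (r choose i) * (-1) ^ (r - i)" for i
    have tb: "\<bar>(real i - real r / 2) * h\<bar> \<le> ?s" if "i \<in> {0..r}" for i
    proof -
      have "\<bar>real i - real r / 2\<bar> \<le> real r / 2" using that by (auto simp: abs_if field_simps)
      then show ?thesis using h mult_right_mono[of "\<bar>real i - real r / 2\<bar>" "real r / 2" h] by (simp add: abs_mult)
    qed
    have mem: "u i x \<in> {-1..1}" if "i \<in> {0..r}" "x \<in> {a..b}" for i x
      unfolding u_def using that cutoff_shift[OF s0 True _ tb] by (simp add: a_def b_def)
    have x1: "x \<in> {-1<..<1}" if "x \<in> {a..b}" for x using that c by (auto simp: a_def b_def)
    have ab: "a \<le> b" "-1 \<le> a" "b \<le> 1" using c by (auto simp: a_def b_def)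
    have ud: "(u i has_real_derivative 1 + (real i - real r / 2) * h * (- x / phi x)) (at x)" if "x \<in> {a..b}" for i x
      unfolding u_def by (intro DERIV_add DERIV_ident DERIV_cmult phi_deriv x1 that)
    have phc: "continuous_on {a..b} phi" unfolding phi_def by (intro continuous_intros)
    have udc: "continuous_on {a..b} (\<lambda>x. 1 + (real i - real r / 2) * h * (- x / phi x))" for i
      using phi_pos x1 by (intro continuous_intros phc) force
    have udg: "1 / 2 \<le> 1 + (real i - real r / 2) * h * (- x / phi x)" if "i \<in> {0..r}" "x \<in> {a..b}" for i x
      using that by (intro shift_deriv_ge[OF s0 True _ tb]) (auto simp: a_def b_def)
    have vC: "?v x \<le> shift_const \<tau> r * ?v (u i x)" if ix: "i \<in> {0..r}" "x \<in> {a..b}" for i x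
    proof -
      have xI: "x \<in> {-1..1}" using x1[OF ix(2)] by auto
      have p0: "0 \<le> phi x" by (rule phi_nonneg[OF xI])
      have "\<bar>x - u i x\<bar> = \<bar>(real i - real r / 2) * h\<bar> * phi x" using p0 by (simp add: u_def abs_mult)
      also have "\<dots> \<le> ?s * phi x" using tb[OF ix(1)] p0 by (rule mult_right_mono)
      also have "\<dots> \<le> real r * h * phi x" using h p0 by (intro mult_right_mono) auto
      also have "\<dots> = real r * (h * phi x)" by simp
      also have "\<dots> \<le> real r * (1 / n * phi x)" using h p0 by (intro mult_left_mono mult_right_mono) auto
      also have "\<dots> \<le> real r * rho n x" by (intro mult_left_mono) (auto simp: rho_phi)
      finally have "reldist n x (u i x) \<le> real r" using rho_pos[OF xI n] by (simp add: reldist_def divide_le_eq)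
      then have "2 * 8 ^ \<tau> * (1 + reldist n x (u i x)) ^ (2 * \<tau> + 1) * ?v (u i x) \<le> shift_const \<tau> r * ?v (u i x)"
        unfolding shift_const_def using reldist_nonneg[OF xI n] mem[OF ix]
        by (intro mult_right_mono mult_left_mono power_mono v0) auto
      then show ?thesis using weight_avg_growth[OF dw xI mem[OF ix] n t] by linarith
    qed
    have eq: "symm_difference r (h * phi x) f x = (\<Sum>i=0..r. k i * T i x)" if "x \<in> {-1..1}" for x
      unfolding symm_difference_eq_sum[OF that r h(1) True] k_def T_def u_def a_def b_def ..
    have Tm: "T i \<in> borel_measurable leb1" if "i \<in> {0..r}" for i
      unfolding T_def[abs_def] by (rule subst_leb1_measurable[OF ab ud udc udg[OF that] mem[OF that] f])
    have Tn: "wnorm p ?v (T i) \<le> ennreal (2 * shift_const \<tau> r) * wnorm p ?v f" if "i \<in> {0..r}" for i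
      unfolding T_def[abs_def]
      by (rule wnorm_subst_le[OF ab ud udc udg[OF that] mem[OF that] p f continuous_on_weight_avg[OF dw n] v0 shift_const_ge_1 vC[OF that]])
    have kTm: "(\<lambda>x. k i * T i x) \<in> borel_measurable leb1" if "i \<in> {0..r}" for i
      using Tm[OF that] by measurable
    have "(\<lambda>x. symm_difference r (h * phi x) f x) \<in> borel_measurable leb1 \<longleftrightarrow> (\<lambda>x. \<Sum>i=0..r. k i * T i x) \<in> borel_measurable leb1"
      by (rule measurable_cong) (simp add: eq)
    then have m: "(\<lambda>x. symm_difference r (h * phi x) f x) \<in> borel_measurable leb1"
      using kTm by (auto intro!: borel_measurable_sum)
    have "wnorm p ?v (\<lambda>x. symm_difference r (h * phi x) f x) = wnorm p ?v (\<lambda>x. \<Sum>i=0..r. k i * T i x)"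
      by (rule wnorm_cong) (rule eq)
    also have "\<dots> \<le> (\<Sum>i=0..r. wnorm p ?v (\<lambda>x. k i * T i x))"
      by (rule wnorm_sum[OF vm v0 p _ kTm]) auto
    also have "\<dots> \<le> (\<Sum>i=0..r. ennreal \<bar>k i\<bar> * (ennreal (2 * shift_const \<tau> r) * wnorm p ?v f))"
    proof (rule sum_mono)
      fix i assume i: "i \<in> {0..r}"
      have "wnorm p ?v (\<lambda>x. k i * T i x) \<le> ennreal \<bar>k i\<bar> * wnorm p ?v (T i)"
        by (rule wnorm_cmult[OF vm v0 p Tm[OF i]])
      also have "\<dots> \<le> ennreal \<bar>k i\<bar> * (ennreal (2 * shift_const \<tau> r) * wnorm p ?v f)"
        by (intro mult_left_mono Tn i) auto
      finally show "wnorm p ?v (\<lambda>x. k i * T i x) \<le> ennreal \<bar>k i\<bar> * (ennreal (2 * shift_const \<tau> r) * wnorm p ?v f)" .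
    qed
    also have "\<dots> = ennreal (\<Sum>i=0..r. \<bar>k i\<bar>) * (ennreal (2 * shift_const \<tau> r) * wnorm p ?v f)"
      by (simp add: sum_distrib_right[symmetric] sum_ennreal)
    also have "(\<Sum>i=0..r. \<bar>k i\<bar>) = (\<Sum>i=0..r. real (r choose i))"
      by (simp add: k_def abs_mult power_abs)
    also have "\<dots> = 2 ^ r" using choose_row_sum[of r] unfolding atLeast0AtMost
      by (metis of_nat_numeral of_nat_power of_nat_sum)
    also have "ennreal (2 ^ r) * (ennreal (2 * shift_const \<tau> r) * wnorm p ?v f) = ennreal (2 ^ r * (2 * shift_const \<tau> r)) * wnorm p ?v f"
      using C0 by (simp add: ennreal_mult mult.assoc)
    finally show ?thesis using m by simp
  qed
  then show "(\<lambda>x. symm_difference r (h * phi x) f x) \<in> borel_measurable leb1"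
    "wnorm p ?v (\<lambda>x. symm_difference r (h * phi x) f x) \<le> ennreal (2 ^ r * (2 * shift_const \<tau> r)) * wnorm p ?v f"
    by auto
qed

section \<open>Integral operators with decaying kernels\<close>

lemma nn_integral_eq_integral_interval:
  assumes "continuous_on {-1..1::real} f" "\<And>y. y \<in> {-1..1} \<Longrightarrow> 0 \<le> f y"
  shows "(\<integral>\<^sup>+ y. ennreal (f y) * indicator {-1..1} y \<partial>lborel) = ennreal (integral {-1..1} f)"
proof -
  define g where "g y = (if y \<in> {-1..1} then f y else 0)" for y
  have "(g has_integral integral {-1..1} f) UNIV"
    unfolding g_def has_integral_restrict_UNIV
    by (rule integrable_integral[OF integrable_continuous_real[OF assms(1)]])
  moreover have "g \<in> borel_measurable borel" unfolding g_def
    by (intro borel_measurable_continuous_on_if assms continuous_intros) auto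
  moreover have "0 \<le> g y" for y using assms(2) by (simp add: g_def)
  ultimately have "(\<integral>\<^sup>+ y. ennreal (g y) \<partial>lborel) = ennreal (integral {-1..1} f)"
    by (intro nn_integral_has_integral_lborel)
  moreover have "ennreal (g y) = ennreal (f y) * indicator {-1..1} y" for y
    by (simp add: g_def indicator_def)
  ultimately show ?thesis by simp
qed

text \<open>(y - c)/(\<rho> + |y - c|) is a primitive with values in [-1,1], so the mass is at most
  2 whatever \<rho> and c are. The derivative is computed on either side of the corner c.\<close>

lemma decay_integral_le:
  fixes c \<rho> :: real
  assumes \<rho>: "\<rho> > 0"
  shows "(\<integral>\<^sup>+ y. ennreal (1 / (\<rho> * (1 + \<bar>y - c\<bar> / \<rho>)\<^sup>2)) * indicator {-1..1} y \<partial>lborel) \<le> 2"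
proof -
  let ?k = "\<lambda>y. 1 / (\<rho> * (1 + \<bar>y - c\<bar> / \<rho>)\<^sup>2)"
  define F where "F y = (y - c) / (\<rho> + \<bar>y - c\<bar>)" for y
  have p: "\<rho> + \<bar>y - c\<bar> > 0" for y using \<rho> by (simp add: add_pos_nonneg)
  have kF: "?k y = \<rho> / (\<rho> + \<bar>y - c\<bar>)\<^sup>2" for y
  proof -
    have "1 + \<bar>y - c\<bar> / \<rho> = (\<rho> + \<bar>y - c\<bar>) / \<rho>" using \<rho> by (simp add: add_divide_distrib)
    then show ?thesis using \<rho> by (simp add: power_divide power2_eq_square)
  qed
  have "(?k has_integral (F 1 - F (-1))) {-1..1}"
    unfolding kF
  proof (rule fundamental_theorem_of_calculus_interior_strong[where S="{c}"])
    show "continuous_on {-1..1} F" unfolding F_def using p by (intro continuous_intros) (metis less_irrefl)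
    fix y assume y: "y \<in> {-1<..<1} - {c}"
    have "(F has_real_derivative \<rho> / (\<rho> + \<bar>y - c\<bar>)\<^sup>2) (at y)"
    proof (cases "y > c")
      case True
      have q: "\<rho> + (y - c) \<noteq> 0" using \<rho> True by linarith
      have "((\<lambda>y. (y - c) / (\<rho> + (y - c))) has_real_derivative (1 * (\<rho> + (y - c)) - (y - c) * 1) / ((\<rho> + (y - c)) * (\<rho> + (y - c)))) (at y)"
        by (rule DERIV_divide) (auto intro!: derivative_eq_intros q)
      then have "((\<lambda>y. (y - c) / (\<rho> + (y - c))) has_real_derivative \<rho> / (\<rho> + \<bar>y - c\<bar>)\<^sup>2) (at y)"
        using True by (simp add: power2_eq_square)
      moreover have "\<forall>\<^sub>F z in nhds y. z \<in> {c<..}" using True by (intro eventually_nhds_in_open) auto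
      then have "\<forall>\<^sub>F z in nhds y. F z = (z - c) / (\<rho> + (z - c))" by eventually_elim (simp add: F_def)
      ultimately show ?thesis by (subst DERIV_cong_ev[OF refl _ refl])
    next
      case False
      then have yc: "y < c" using y by auto
      have q: "\<rho> + (c - y) \<noteq> 0" using \<rho> yc by linarith
      have "((\<lambda>y. (y - c) / (\<rho> + (c - y))) has_real_derivative (1 * (\<rho> + (c - y)) - (y - c) * (-1)) / ((\<rho> + (c - y)) * (\<rho> + (c - y)))) (at y)"
        by (rule DERIV_divide) (auto intro!: derivative_eq_intros q)
      then have "((\<lambda>y. (y - c) / (\<rho> + (c - y))) has_real_derivative \<rho> / (\<rho> + \<bar>y - c\<bar>)\<^sup>2) (at y)"
        using yc by (simp add: power2_eq_square)
      moreover have "\<forall>\<^sub>F z in nhds y. z \<in> {..<c}" using yc by (intro eventually_nhds_in_open) auto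
      then have "\<forall>\<^sub>F z in nhds y. F z = (z - c) / (\<rho> + (c - z))" by eventually_elim (simp add: F_def)
      ultimately show ?thesis by (subst DERIV_cong_ev[OF refl _ refl])
    qed
    then show "(F has_vector_derivative \<rho> / (\<rho> + \<bar>y - c\<bar>)\<^sup>2) (at y)"
      by (simp add: has_real_derivative_iff_has_vector_derivative)
  qed auto
  then have I: "integral {-1..1} ?k = F 1 - F (-1)" by (rule integral_unique)
  have "1 + \<bar>y - c\<bar> / \<rho> \<noteq> 0" for y
    using divide_nonneg_pos[OF abs_ge_zero[of "y - c"] \<rho>] by linarith
  then have "continuous_on {-1..1} ?k" using \<rho> by (intro continuous_intros) auto
  then have "(\<integral>\<^sup>+ y. ennreal (?k y) * indicator {-1..1} y \<partial>lborel) = ennreal (F 1 - F (-1))"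
    unfolding I[symmetric] using \<rho> by (intro nn_integral_eq_integral_interval) auto
  moreover have "F y \<le> 1" "- 1 \<le> F y" for y
    using p[of y] \<rho> by (auto simp: F_def divide_le_eq le_divide_eq)
  then have "F 1 - F (-1) \<le> 2" by (smt (verit))
  then have "ennreal (F 1 - F (-1)) \<le> ennreal 2" by (rule ennreal_leI)
  ultimately show ?thesis by simp
qed

lemma decay_kernel_nn_integral_le:
  assumes "x \<in> {-1..1}" "m \<ge> 1"
  shows "(\<integral>\<^sup>+ y. ennreal (decay_kernel 2 m x y) * indicator {-1..1} y \<partial>lborel) \<le> 2"
  using decay_integral_le[OF rho_pos[OF assms], of x] by (simp add: decay_kernel_def reldist_def abs_minus_commute)

lemma decay_kernel_antimono:
  assumes "x \<in> {-1..1}" "m \<ge> 1" "\<sigma> \<le> \<sigma>'"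
  shows "decay_kernel \<sigma>' m x y \<le> decay_kernel \<sigma> m x y"
proof -
  have "rho m x > 0" "reldist m x y \<ge> 0" using assms rho_pos reldist_nonneg by auto
  then show ?thesis unfolding decay_kernel_def using assms(3)
    by (intro divide_left_mono mult_left_mono power_increasing mult_pos_pos zero_less_power) auto
qed

lemma decay_kernel_add:
  assumes "x \<in> {-1..1}" "m \<ge> 1"
  shows "decay_kernel (\<sigma> + \<tau>) m x y * (1 + reldist m x y) ^ \<tau> = decay_kernel \<sigma> m x y"
proof -
  have "1 + reldist m x y \<noteq> 0" using reldist_nonneg[OF assms, of y] by linarith
  then show ?thesis by (simp add: decay_kernel_def power_add)
qed

text \<open>Five powers at x buy two at y, enough for integrability in x: one pays for the ratio of
  the scales and four for the square of \<open>reldist_swap\<close>. The constant is 2 times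
  8^2.\<close>

lemma decay_kernel_swap:
  assumes x: "x \<in> {-1..1}" and y: "y \<in> {-1..1}" and m: "m \<ge> 1"
  shows "decay_kernel 5 m x y \<le> 128 * decay_kernel 2 m y x"
proof -
  define a b where "a = 1 + reldist m x y" and "b = 1 + reldist m y x"
  have p: "rho m x > 0" "rho m y > 0" using rho_pos assms by auto
  have ab: "a \<ge> 1" "b \<ge> 1" using reldist_nonneg assms by (auto simp: a_def b_def)
  have "b\<^sup>2 \<le> (8 * a\<^sup>2)\<^sup>2" using reldist_swap[OF x y m] ab by (intro power_mono) (auto simp: a_def b_def)
  then have 1: "b\<^sup>2 \<le> 64 * a ^ 4" by (simp add: power_mult_distrib flip: power_mult)
  have 2: "rho m y \<le> 2 * a * rho m x" using rho_ratio_le[OF x y m] p by (simp add: a_def divide_le_eq)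
  have "rho m y * b\<^sup>2 \<le> (2 * a * rho m x) * (64 * a ^ 4)"
    using 1 2 p ab by (intro mult_mono) auto
  also have "\<dots> = 128 * (rho m x * a ^ 5)" by (simp add: eval_nat_numeral)
  finally have "1 / (128 * (rho m x * a ^ 5)) \<le> 1 / (rho m y * b\<^sup>2)"
    using p ab by (intro divide_left_mono mult_pos_pos zero_less_power) auto
  then show ?thesis by (simp add: decay_kernel_def a_def b_def)
qed

lemma decay_kernel_measurable [measurable (raw)]:
  assumes [measurable]: "f \<in> borel_measurable M" "g \<in> borel_measurable M"
  shows "(\<lambda>z. decay_kernel \<sigma> m (f z) (g z)) \<in> borel_measurable M"
  unfolding decay_kernel_def reldist_def rho_def by measurable

lemma poly_measurable [measurable]: "poly Q \<in> borel_measurable borel" for Q :: "real poly"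
  by (intro borel_measurable_continuous_onI continuous_intros)

section \<open>Averages of polynomials against the decay kernel\<close>

definition kernel_average :: "nat \<Rightarrow> nat \<Rightarrow> real poly \<Rightarrow> real \<Rightarrow> real" where
  "kernel_average \<sigma> m Q x = integral {-1..1} (\<lambda>y. \<bar>poly Q y\<bar> * decay_kernel \<sigma> m x y)"

context
  fixes m :: nat and Q :: "real poly"
  assumes m: "m \<ge> 1"
begin

lemma kernel_average_nonneg:
  assumes "x \<in> {-1..1}"
  shows "0 \<le> kernel_average \<sigma> m Q x"
  unfolding kernel_average_def
  by (intro integral_nonneg integrable_continuous_real continuous_intros continuous_on_decay_kernel m assms)
     (simp add: decay_kernel_nonneg[OF assms m])

lemma ennreal_kernel_average:
  assumes "x \<in> {-1..1}"
  shows "ennreal (kernel_average \<sigma> m Q x) = (\<integral>\<^sup>+ y. ennreal (\<bar>poly Q y\<bar> * decay_kernel \<sigma> m x y) * indicator {-1..1} y \<partial>lborel)"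
  unfolding kernel_average_def using assms m
  by (intro nn_integral_eq_integral_interval[symmetric] continuous_intros continuous_on_decay_kernel)
     (auto simp: decay_kernel_nonneg)

lemma kernel_average_measurable: "kernel_average \<sigma> m Q \<in> borel_measurable leb1"
proof -
  have "(\<lambda>x. enn2real (\<integral>\<^sup>+ y. ennreal (\<bar>poly Q y\<bar> * decay_kernel \<sigma> m x y) * indicator {-1..1} y \<partial>lborel)) \<in> borel_measurable borel"
    by measurable
  then have "(\<lambda>x. enn2real (\<integral>\<^sup>+ y. ennreal (\<bar>poly Q y\<bar> * decay_kernel \<sigma> m x y) * indicator {-1..1} y \<partial>lborel)) \<in> borel_measurable lebesgue"
    by (intro measurable_completion) simp
  then have *: "(\<lambda>x. enn2real (\<integral>\<^sup>+ y. ennreal (\<bar>poly Q y\<bar> * decay_kernel \<sigma> m x y) * indicator {-1..1} y \<partial>lborel)) \<in> borel_measurable leb1"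
    by (rule measurable_restrict_space1)
  show ?thesis
  proof (rule measurable_cong[THEN iffD1, OF _ *])
    fix x assume "x \<in> space leb1"
    then have x: "x \<in> {-1..1}" by simp
    show "enn2real (\<integral>\<^sup>+ y. ennreal (\<bar>poly Q y\<bar> * decay_kernel \<sigma> m x y) * indicator {-1..1} y \<partial>lborel) = kernel_average \<sigma> m Q x"
      using ennreal_kernel_average[OF x, of \<sigma>] kernel_average_nonneg[OF x, of \<sigma>] by (metis enn2real_ennreal)
  qed
qed

text \<open>Jensen's inequality by integrating the tangent of \<open>t powr q\<close> at \<open>kernel_average / 2\<close>; it only uses
  that the kernel has mass at most \<open>2\<close>.\<close>
lemma kernel_average_powr_le:
  assumes q: "q \<ge> 1" and x: "x \<in> {-1..1}" and s: "\<sigma> \<ge> 2"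
  shows "kernel_average \<sigma> m Q x powr q \<le> 2 powr q * integral {-1..1} (\<lambda>y. \<bar>poly Q y\<bar> powr q * decay_kernel \<sigma> m x y)"
proof (cases "kernel_average \<sigma> m Q x = 0")
  case True
  have "0 \<le> integral {-1..1} (\<lambda>y. \<bar>poly Q y\<bar> powr q * decay_kernel \<sigma> m x y)"
    using q x m by (intro integral_nonneg integrable_continuous_real continuous_intros continuous_on_decay_kernel continuous_on_powr')
      (auto simp: decay_kernel_nonneg)
  then show ?thesis using True by simp
next
  case False
  define G where "G = kernel_average \<sigma> m Q x"
  define s where "s = G / 2"
  have s0: "s > 0" using False kernel_average_nonneg[OF x, of \<sigma>] by (simp add: s_def G_def)
  let ?k = "decay_kernel \<sigma> m x"
  have kc: "continuous_on {-1..1} ?k" by (rule continuous_on_decay_kernel[OF x m])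
  have k0: "0 \<le> ?k y" for y by (rule decay_kernel_nonneg[OF x m])
  define A where "A = integral {-1..1} ?k"
  have A0: "A \<ge> 0" unfolding A_def by (intro integral_nonneg integrable_continuous_real kc k0)
  have "ennreal A = (\<integral>\<^sup>+ y. ennreal (?k y) * indicator {-1..1} y \<partial>lborel)"
    unfolding A_def by (rule nn_integral_eq_integral_interval[symmetric, OF kc k0])
  also have "\<dots> \<le> (\<integral>\<^sup>+ y. ennreal (decay_kernel 2 m x y) * indicator {-1..1} y \<partial>lborel)"
    by (intro nn_integral_mono mult_right_mono ennreal_leI decay_kernel_antimono x m \<open>\<sigma> \<ge> 2\<close>) auto
  also have "\<dots> \<le> 2" by (rule decay_kernel_nn_integral_le[OF x m])
  finally have "ennreal A \<le> ennreal 2" by simp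
  then have A2: "A \<le> 2" by (subst (asm) ennreal_le_iff) auto
  define c where "c = q * s powr (q - 1)"
  have int: "((\<lambda>y. s powr q * ?k y + c * (\<bar>poly Q y\<bar> * ?k y - s * ?k y)) has_integral s powr q * A + c * (G - s * A)) {-1..1}"
    unfolding A_def G_def kernel_average_def
    by (intro has_integral_add has_integral_diff has_integral_mult_right integrable_integral integrable_continuous_real continuous_intros kc)
  have "s powr q * A + c * (G - s * A) \<le> integral {-1..1} (\<lambda>y. \<bar>poly Q y\<bar> powr q * ?k y)"
  proof (rule has_integral_le[OF int integrable_integral])
    show "(\<lambda>y. \<bar>poly Q y\<bar> powr q * ?k y) integrable_on {-1..1}"
      using q by (intro integrable_continuous_real continuous_intros kc continuous_on_powr') auto
    fix y
    have "(s powr q + c * (\<bar>poly Q y\<bar> - s)) * ?k y \<le> \<bar>poly Q y\<bar> powr q * ?k y"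
      unfolding c_def using q s0 by (intro mult_right_mono powr_tangent k0) auto
    then show "s powr q * ?k y + c * (\<bar>poly Q y\<bar> * ?k y - s * ?k y) \<le> \<bar>poly Q y\<bar> powr q * ?k y"
      by (simp add: algebra_simps)
  qed
  moreover have "s powr q \<le> s powr q * A + c * (G - s * A)"
  proof -
    have "c * s = q * s powr q" using s0 by (simp add: c_def powr_diff)
    moreover have "c * (G - s * A) = (c * s) * (2 - A)" by (simp add: s_def algebra_simps)
    ultimately have "s powr q * A + c * (G - s * A) = s powr q * (A + q * (2 - A))"
      by (simp add: algebra_simps)
    moreover have "1 * (2 - A) \<le> q * (2 - A)" using q A2 by (intro mult_right_mono) auto
    then have "s powr q * 1 \<le> s powr q * (A + q * (2 - A))" by (intro mult_left_mono) auto
    ultimately show ?thesis by simp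
  qed
  ultimately have "s powr q \<le> integral {-1..1} (\<lambda>y. \<bar>poly Q y\<bar> powr q * ?k y)" by linarith
  then have "2 powr q * s powr q \<le> 2 powr q * integral {-1..1} (\<lambda>y. \<bar>poly Q y\<bar> powr q * ?k y)"
    by (intro mult_left_mono) auto
  moreover have "G powr q = 2 powr q * s powr q" using s0 by (simp add: s_def powr_mult[symmetric])
  ultimately show ?thesis by (simp add: G_def)
qed

text \<open>A Schur-type test. Of the 5 + \<tau> powers, \<tau> absorb the growth of the weight as
  it moves from x to y. In the supremum norm the remaining kernel is integrated in y; for finite
  exponents Jensen and Tonelli leave an integration in x, where \<open>decay_kernel_swap\<close>
  consumes the other five.\<close>

lemma wnorm_kernel_average_le:
  assumes p: "1 \<le> p" and v: "continuous_on {-1..1} v" and v0: "\<And>x. x \<in> {-1..1} \<Longrightarrow> 0 \<le> v x" and C: "C \<ge> 1"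
    and growth: "\<And>x y. x \<in> {-1..1} \<Longrightarrow> y \<in> {-1..1} \<Longrightarrow> v x \<le> C * (1 + reldist m x y) ^ \<tau> * v y"
  shows "wnorm p v (kernel_average (5 + \<tau>) m Q) \<le> ennreal (512 * C) * wnorm p v (poly Q)"
proof -
  let ?k = "decay_kernel (5 + \<tau>) m"
  have vm[measurable]: "v \<in> borel_measurable leb1" using v by (intro continuous_imp_measurable_on_sets_lebesgue) auto
  have Qm[measurable]: "poly Q \<in> borel_measurable leb1"
    by (intro continuous_imp_measurable_on_sets_lebesgue continuous_intros) auto
  note [measurable] = kernel_average_measurable[of "5 + \<tau>"]
  have vk: "v x * ?k x y \<le> C * v y * decay_kernel 5 m x y" if "x \<in> {-1..1}" "y \<in> {-1..1}" for x y
  proof -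
    have "v x * ?k x y \<le> (C * (1 + reldist m x y) ^ \<tau> * v y) * ?k x y"
      using growth[OF that] decay_kernel_nonneg[OF that(1) m] by (intro mult_right_mono) auto
    also have "\<dots> = C * v y * (?k x y * (1 + reldist m x y) ^ \<tau>)" by (simp add: mult_ac)
    also have "\<dots> = C * v y * decay_kernel 5 m x y" using decay_kernel_add[OF that(1) m] by simp
    finally show ?thesis .
  qed
  have "wnorm p v (kernel_average (5 + \<tau>) m Q) \<le> ennreal (512 * C) * wnorm p v (poly Q)"
    if hB: "wnorm p v (poly Q) = ennreal B" "B \<ge> 0" for B
    using p
  proof (cases rule: ennreal_ge1_cases)
    case 1
    have ae: "AE y in lborel. y \<in> {-1..1} \<longrightarrow> \<bar>poly Q y\<bar> * v y \<le> B"
      unfolding AE_leb1[symmetric] using hB 1 by (subst wnorm_le_infinity_iff[symmetric]) auto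
    have bd: "\<bar>kernel_average (5 + \<tau>) m Q x\<bar> * v x \<le> 512 * C * B" if x: "x \<in> {-1..1}" for x
    proof -
      have "ennreal (v x * kernel_average (5 + \<tau>) m Q x) = ennreal (v x) * (\<integral>\<^sup>+ y. ennreal (\<bar>poly Q y\<bar> * ?k x y) * indicator {-1..1} y \<partial>lborel)"
        using v0[OF x] kernel_average_nonneg[OF x] by (simp add: ennreal_mult ennreal_kernel_average[OF x])
      also have "\<dots> = (\<integral>\<^sup>+ y. ennreal (v x) * (ennreal (\<bar>poly Q y\<bar> * ?k x y) * indicator {-1..1} y) \<partial>lborel)"
        by (rule nn_integral_cmult[symmetric]) measurable
      also have "\<dots> \<le> (\<integral>\<^sup>+ y. ennreal (C * B) * (ennreal (decay_kernel 2 m x y) * indicator {-1..1} y) \<partial>lborel)"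
      proof (rule nn_integral_mono_AE)
        show "AE y in lborel. ennreal (v x) * (ennreal (\<bar>poly Q y\<bar> * ?k x y) * indicator {-1..1} y)
          \<le> ennreal (C * B) * (ennreal (decay_kernel 2 m x y) * indicator {-1..1} y)"
          using ae
        proof eventually_elim
          case (elim y)
          show ?case
          proof (cases "y \<in> {-1..1}")
            case y: True
            have "v x * (\<bar>poly Q y\<bar> * ?k x y) = \<bar>poly Q y\<bar> * (v x * ?k x y)" by simp
            also have "\<dots> \<le> \<bar>poly Q y\<bar> * (C * v y * decay_kernel 5 m x y)" by (intro mult_left_mono vk x y) auto
            also have "\<dots> = C * (\<bar>poly Q y\<bar> * v y) * decay_kernel 5 m x y" by simp
            also have "\<dots> \<le> C * B * decay_kernel 2 m x y"
              using elim y C hB v0[OF y] by (intro mult_mono mult_left_mono decay_kernel_antimono decay_kernel_nonneg x m) auto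
            finally have "ennreal (v x * (\<bar>poly Q y\<bar> * ?k x y)) \<le> ennreal (C * B * decay_kernel 2 m x y)" by (rule ennreal_leI)
            then show ?thesis using y v0[OF x] C hB decay_kernel_nonneg[OF x m] by (simp add: ennreal_mult)
          qed simp
        qed
      qed
      also have "\<dots> = ennreal (C * B) * (\<integral>\<^sup>+ y. ennreal (decay_kernel 2 m x y) * indicator {-1..1} y \<partial>lborel)"
        by (rule nn_integral_cmult) measurable
      also have "\<dots> \<le> ennreal (C * B) * 2" by (intro mult_left_mono decay_kernel_nn_integral_le x m) auto
      also have "\<dots> = ennreal (2 * C * B)" using C hB by (simp add: ennreal_mult mult_ac)
      also have "\<dots> \<le> ennreal (512 * C * B)" using C hB by (intro ennreal_leI mult_right_mono) auto
      finally have "v x * kernel_average (5 + \<tau>) m Q x \<le> 512 * C * B" using C hB by (subst (asm) ennreal_le_iff) auto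
      then show ?thesis using kernel_average_nonneg[OF x] by (simp add: mult.commute)
    qed
    then have "wnorm p v (kernel_average (5 + \<tau>) m Q) \<le> ennreal (512 * C * B)"
      unfolding 1 using C hB by (subst wnorm_le_infinity_iff) (auto intro!: AE_I2)
    then show ?thesis using hB C by (simp add: ennreal_mult)
  next
    case (2 q)
    \<comment> \<open>The weight is cut off to a Borel function on the line, because interchanging
      the integrals requires joint measurability.\<close>
    define v' where "v' y = (if y \<in> {-1..1} then v y else 0)" for y
    have v'm[measurable]: "v' \<in> borel_measurable borel" unfolding v'_def
      by (intro borel_measurable_continuous_on_if v continuous_intros) auto
    have v'0: "0 \<le> v' y" for y using v0 by (simp add: v'_def)
    let ?I = "indicator {-1..1} :: real \<Rightarrow> ennreal"
    have IB: "(\<integral>\<^sup>+ y. ennreal (\<bar>poly Q y\<bar> powr q * v' y) * ?I y \<partial>lborel) \<le> ennreal (B powr q)"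
    proof -
      have "(\<integral>\<^sup>+ y. ennreal (\<bar>poly Q y\<bar> powr q * v' y) * ?I y \<partial>lborel) = (\<integral>\<^sup>+ y. ennreal (\<bar>poly Q y\<bar> powr q * v y) \<partial>leb1)"
        unfolding nn_integral_leb1 by (intro nn_integral_cong) (auto simp: v'_def indicator_def)
      also have "\<dots> \<le> ennreal (B powr q)" using hB 2 by (subst wnorm_le_iff[symmetric]) auto
      finally show ?thesis .
    qed
    have "(\<integral>\<^sup>+ x. ennreal (\<bar>kernel_average (5 + \<tau>) m Q x\<bar> powr q * v x) \<partial>leb1)
      \<le> (\<integral>\<^sup>+ x. (\<integral>\<^sup>+ y. ennreal (2 powr q * C * (\<bar>poly Q y\<bar> powr q * v' y)) * ennreal (decay_kernel 5 m x y) * (?I x * ?I y) \<partial>lborel) \<partial>lborel)"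
      unfolding nn_integral_leb1
    proof (rule nn_integral_mono)
      fix x
      show "ennreal (\<bar>kernel_average (5 + \<tau>) m Q x\<bar> powr q * v x) * ?I x
        \<le> (\<integral>\<^sup>+ y. ennreal (2 powr q * C * (\<bar>poly Q y\<bar> powr q * v' y)) * ennreal (decay_kernel 5 m x y) * (?I x * ?I y) \<partial>lborel)"
      proof (cases "x \<in> {-1..1}")
        case x: True
        let ?f = "\<lambda>y. \<bar>poly Q y\<bar> powr q * ?k x y"
        have fc: "continuous_on {-1..1} ?f"
          using 2 x m by (intro continuous_intros continuous_on_decay_kernel continuous_on_powr') auto
        have f0: "0 \<le> ?f y" for y using decay_kernel_nonneg[OF x m] by simp
        have "\<bar>kernel_average (5 + \<tau>) m Q x\<bar> powr q * v x \<le> 2 powr q * integral {-1..1} ?f * v x"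
          using kernel_average_powr_le[OF 2(1) x, of "5 + \<tau>"] kernel_average_nonneg[OF x] v0[OF x] by (intro mult_right_mono) auto
        then have "ennreal (\<bar>kernel_average (5 + \<tau>) m Q x\<bar> powr q * v x) \<le> ennreal (2 powr q * integral {-1..1} ?f * v x)"
          by (rule ennreal_leI)
        also have "\<dots> = ennreal (2 powr q * v x) * ennreal (integral {-1..1} ?f)"
          using v0[OF x] integral_nonneg[OF integrable_continuous_real[OF fc] f0]
          by (subst ennreal_mult[symmetric]) (auto simp: mult_ac)
        also have "\<dots> = ennreal (2 powr q * v x) * (\<integral>\<^sup>+ y. ennreal (?f y) * ?I y \<partial>lborel)"
          by (simp add: nn_integral_eq_integral_interval[OF fc f0])
        also have "\<dots> = (\<integral>\<^sup>+ y. ennreal (2 powr q * v x) * (ennreal (?f y) * ?I y) \<partial>lborel)"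
          by (rule nn_integral_cmult[symmetric]) measurable
        also have "\<dots> \<le> (\<integral>\<^sup>+ y. ennreal (2 powr q * C * (\<bar>poly Q y\<bar> powr q * v' y)) * ennreal (decay_kernel 5 m x y) * (?I x * ?I y) \<partial>lborel)"
        proof (rule nn_integral_mono)
          fix y
          show "ennreal (2 powr q * v x) * (ennreal (?f y) * ?I y) \<le> ennreal (2 powr q * C * (\<bar>poly Q y\<bar> powr q * v' y)) * ennreal (decay_kernel 5 m x y) * (?I x * ?I y)"
          proof (cases "y \<in> {-1..1}")
            case y: True
            have "2 powr q * v x * ?f y = 2 powr q * \<bar>poly Q y\<bar> powr q * (v x * ?k x y)" by simp
            also have "\<dots> \<le> 2 powr q * \<bar>poly Q y\<bar> powr q * (C * v y * decay_kernel 5 m x y)" by (intro mult_left_mono vk x y) auto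
            also have "\<dots> = 2 powr q * C * (\<bar>poly Q y\<bar> powr q * v' y) * decay_kernel 5 m x y" using y by (simp add: v'_def)
            finally have "ennreal (2 powr q * v x * ?f y) \<le> ennreal (2 powr q * C * (\<bar>poly Q y\<bar> powr q * v' y) * decay_kernel 5 m x y)"
              by (rule ennreal_leI)
            also have "\<dots> = ennreal (2 powr q * C * (\<bar>poly Q y\<bar> powr q * v' y)) * ennreal (decay_kernel 5 m x y)"
              using C v'0 decay_kernel_nonneg[OF x m] by (intro ennreal_mult) auto
            also have "ennreal (2 powr q * v x * ?f y) = ennreal (2 powr q * v x) * ennreal (?f y)"
              using v0[OF x] f0 by (intro ennreal_mult) auto
            finally show ?thesis using x y by simp
          qed simp
        qed
        finally show ?thesis using x by simp
      qed simp
    qed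
    also have "\<dots> = (\<integral>\<^sup>+ y. (\<integral>\<^sup>+ x. ennreal (2 powr q * C * (\<bar>poly Q y\<bar> powr q * v' y)) * ennreal (decay_kernel 5 m x y) * (?I x * ?I y) \<partial>lborel) \<partial>lborel)"
      by (rule lborel_pair.Fubini') measurable
    also have "\<dots> \<le> (\<integral>\<^sup>+ y. ennreal (256 * (2 powr q * C)) * (ennreal (\<bar>poly Q y\<bar> powr q * v' y) * ?I y) \<partial>lborel)"
    proof (rule nn_integral_mono)
      fix y
      show "(\<integral>\<^sup>+ x. ennreal (2 powr q * C * (\<bar>poly Q y\<bar> powr q * v' y)) * ennreal (decay_kernel 5 m x y) * (?I x * ?I y) \<partial>lborel)
         \<le> ennreal (256 * (2 powr q * C)) * (ennreal (\<bar>poly Q y\<bar> powr q * v' y) * ?I y)"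
      proof (cases "y \<in> {-1..1}")
        case y: True
        let ?c = "2 powr q * C * (\<bar>poly Q y\<bar> powr q * v' y)"
        have c0: "0 \<le> ?c" using C v'0 by simp
        have "(\<integral>\<^sup>+ x. ennreal ?c * ennreal (decay_kernel 5 m x y) * (?I x * ?I y) \<partial>lborel)
          \<le> (\<integral>\<^sup>+ x. ennreal (?c * 128) * (ennreal (decay_kernel 2 m y x) * ?I x) \<partial>lborel)"
        proof (rule nn_integral_mono)
          fix x
          show "ennreal ?c * ennreal (decay_kernel 5 m x y) * (?I x * ?I y) \<le> ennreal (?c * 128) * (ennreal (decay_kernel 2 m y x) * ?I x)"
          proof (cases "x \<in> {-1..1}")
            case x: True
            have "ennreal (decay_kernel 5 m x y) \<le> ennreal (128 * decay_kernel 2 m y x)"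
              by (intro ennreal_leI decay_kernel_swap x y m)
            also have "\<dots> = ennreal 128 * ennreal (decay_kernel 2 m y x)"
              using decay_kernel_nonneg[OF y m] by (intro ennreal_mult) auto
            finally have "ennreal ?c * ennreal (decay_kernel 5 m x y) \<le> ennreal ?c * (ennreal 128 * ennreal (decay_kernel 2 m y x))"
              by (rule mult_left_mono) simp
            also have "\<dots> = ennreal (?c * 128) * ennreal (decay_kernel 2 m y x)"
              using ennreal_mult[OF c0, of 128] by (simp add: mult.assoc)
            finally show ?thesis using x y by simp
          qed simp
        qed
        also have "\<dots> = ennreal (?c * 128) * (\<integral>\<^sup>+ x. ennreal (decay_kernel 2 m y x) * ?I x \<partial>lborel)"
          by (rule nn_integral_cmult) measurable
        also have "\<dots> \<le> ennreal (?c * 128) * 2" by (intro mult_left_mono decay_kernel_nn_integral_le y m) auto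
        also have "\<dots> = ennreal (?c * 128 * 2)" using ennreal_mult[of "?c * 128" 2] c0 by simp
        also have "?c * 128 * 2 = 256 * (2 powr q * C) * (\<bar>poly Q y\<bar> powr q * v' y)" by simp
        also have "ennreal \<dots> = ennreal (256 * (2 powr q * C)) * ennreal (\<bar>poly Q y\<bar> powr q * v' y)"
          using C v'0 by (intro ennreal_mult) auto
        finally show ?thesis using y by simp
      qed simp
    qed
    also have "\<dots> = ennreal (256 * (2 powr q * C)) * (\<integral>\<^sup>+ y. ennreal (\<bar>poly Q y\<bar> powr q * v' y) * ?I y \<partial>lborel)"
      by (rule nn_integral_cmult) measurable
    also have "\<dots> \<le> ennreal (256 * (2 powr q * C)) * ennreal (B powr q)" by (intro mult_left_mono IB) auto
    also have "\<dots> = ennreal (256 * (2 powr q * C) * B powr q)" using C by (intro ennreal_mult[symmetric]) auto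
    also have "\<dots> \<le> ennreal ((512 * C * B) powr q)"
    proof (rule ennreal_leI)
      \<comment> \<open>256 = 128 * 2 comes from the swap and the mass of the kernel, and 2^q from
        Jensen; 256 C \<ge> 1 lets them merge into the q-th power of 512 C.\<close>
      have "(256 * C) powr 1 \<le> (256 * C) powr q" using C 2 by (intro powr_mono) auto
      then have "256 * C * (2 powr q * B powr q) \<le> (256 * C) powr q * (2 powr q * B powr q)"
        using C by (intro mult_right_mono) auto
      also have "\<dots> = (256 * C * (2 * B)) powr q" by (simp only: powr_mult)
      also have "256 * C * (2 * B) = 512 * C * B" by simp
      finally show "256 * (2 powr q * C) * B powr q \<le> (512 * C * B) powr q" by (simp add: mult_ac)
    qed
    finally have "wnorm p v (kernel_average (5 + \<tau>) m Q) \<le> ennreal (512 * C * B)"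
      unfolding 2 using C hB 2 by (subst wnorm_le_iff) auto
    then show ?thesis using hB C by (simp add: ennreal_mult)
  qed
  then show ?thesis using C by (cases "wnorm p v (poly Q)") (auto simp: ennreal_mult_top)
qed

end

section \<open>The inverse theorem\<close>

lemma lam_ge_1: "1 \<le> p \<Longrightarrow> 1 \<le> lam p"
  by (cases p) (auto simp: lam_def)

text \<open>With t = \<open>phi x\<close>/(n \<open>rho m x\<close>), both t \<le> m/n and t
  \<open>rho m x\<close>/\<open>rho n x\<close> \<le> 1. One factor t pays for the whole ratio of
  the scales and the remaining power E - 1 supplies the decay; at the endpoints, where the ratio is
  largest, t is 0.\<close>

lemma ratio_powr_le:
  assumes m: "1 \<le> m" "m \<le> n" and x: "x \<in> {-1..1}" and E: "E \<ge> 1"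
  shows "(phi x / (real n * rho m x)) powr E * (rho m x / rho n x) \<le> (real m / real n) powr (E - 1)"
proof -
  define t where "t = phi x / (real n * rho m x)"
  have n: "1 \<le> n" using m by simp
  have p: "rho m x > 0" "rho n x > 0" using rho_pos[OF x] m n by auto
  have p0: "phi x \<ge> 0" by (rule phi_nonneg[OF x])
  have t0: "t \<ge> 0" using p p0 by (simp add: t_def)
  have "phi x / real m \<le> rho m x" "phi x / real n \<le> rho n x" by (auto simp: rho_phi)
  then have "phi x \<le> real m * rho m x" "phi x \<le> real n * rho n x"
    using m by (auto simp: divide_le_eq mult.commute split: if_splits)
  then have tm: "t \<le> real m / real n" and tn: "t * (rho m x / rho n x) \<le> 1"
    using p m unfolding t_def by (auto simp: divide_le_eq mult_ac)
  show ?thesis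
  proof (cases "t = 0")
    case True then show ?thesis by (simp add: t_def[symmetric])
  next
    case False
    have "t powr E * (rho m x / rho n x) = t powr (E - 1) * (t * (rho m x / rho n x))"
      using False t0 by (simp add: powr_diff)
    also have "\<dots> \<le> t powr (E - 1) * 1" using tn by (intro mult_left_mono) auto
    also have "\<dots> \<le> (real m / real n) powr (E - 1)" using tm t0 E by (simp add: powr_mono2)
    finally show ?thesis by (simp add: t_def)
  qed
qed

text \<open>2\<tau> + 1 and 2 * 8^\<tau> are the growth exponent and constant of
  \<open>weight_avg_growth\<close>; the 5 and the 512 come from
  \<open>wnorm_kernel_average_le\<close>.\<close>

definition poly_const :: "nat \<Rightarrow> nat \<Rightarrow> real" where
  "poly_const \<tau> r = bernstein_const (5 + (2 * \<tau> + 1)) r * (512 * (2 * 8 ^ \<tau>))"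

lemma poly_const_pos: "poly_const \<tau> r > 0"
  using bernstein_const_pos by (simp add: poly_const_def)

context
  fixes L :: real and w :: "real \<Rightarrow> real" and \<tau> r :: nat and p :: ennreal
  assumes dw: "doubling_weight L w" and tau: "max L 1 \<le> (5/4) ^ \<tau>" and p: "1 \<le> p" and r: "r \<ge> 1"
begin

lemma weight_avg_measurable: "n \<ge> 1 \<Longrightarrow> weight_avg w n \<in> borel_measurable leb1"
  by (intro continuous_imp_measurable_on_sets_lebesgue continuous_on_weight_avg[OF dw]) auto

lemma poly_leb1_measurable: "poly Q \<in> borel_measurable leb1"
  by (intro continuous_imp_measurable_on_sets_lebesgue continuous_intros) auto

text \<open>For finite p the pointwise bound is raised to the power p before the weights are
  compared, so \<open>ratio_powr_le\<close> enters with E = r p and one of these powers is lost; the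
  root turns this into the exponent r - 1/p. In the supremum norm E = r and a full power is lost,
  which matches the value 1 of \<open>lam\<close>.\<close>

lemma wnorm_symm_difference_poly_le:
  assumes m: "1 \<le> m" "m \<le> n" and Q: "degree Q \<le> m" and h: "0 < h" "h \<le> 1 / real n"
  shows "wnorm p (weight_avg w n) (\<lambda>x. symm_difference r (h * phi x) (poly Q) x)
    \<le> ennreal (poly_const \<tau> r * (real m / real n) powr (real r - 1 / lam p)) * wnorm p (weight_avg w m) (poly Q)"
proof -
  define \<sigma> where "\<sigma> = 5 + (2 * \<tau> + 1)"
  define b where "b = bernstein_const \<sigma> r"
  define K where "K = b * (real m / real n) powr (real r - 1 / lam p)"
  have n: "1 \<le> n" using m by simp
  have b0: "b > 0" unfolding b_def by (rule bernstein_const_pos)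
  have K0: "K \<ge> 0" using b0 by (simp add: K_def)
  have point: "\<bar>symm_difference r (h * phi x) (poly Q) x\<bar> \<le> b * (phi x / (real n * rho m x)) ^ r * kernel_average \<sigma> m Q x"
    if "x \<in> {-1..1}" for x
    unfolding b_def kernel_average_def by (rule symm_difference_poly_bound[OF m Q that h])
  have t0: "phi x / (real n * rho m x) \<ge> 0" if "x \<in> {-1..1}" for x
    using phi_nonneg[OF that] rho_pos[OF that m(1)] by simp
  have key: "(phi x / (real n * rho m x)) powr E * weight_avg w n x \<le> (real m / real n) powr (E - 1) * weight_avg w m x"
    if x: "x \<in> {-1..1}" and E: "E \<ge> 1" for x E
  proof -
    have "(phi x / (real n * rho m x)) powr E * weight_avg w n x
      \<le> (phi x / (real n * rho m x)) powr E * (rho m x / rho n x * weight_avg w m x)"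
      by (intro mult_left_mono weight_avg_mono_n[OF dw x m]) auto
    also have "\<dots> = ((phi x / (real n * rho m x)) powr E * (rho m x / rho n x)) * weight_avg w m x" by simp
    also have "\<dots> \<le> (real m / real n) powr (E - 1) * weight_avg w m x"
      by (intro mult_right_mono ratio_powr_le m x E weight_avg_nonneg[OF dw])
    finally show ?thesis .
  qed
  \<comment> \<open>At base 0 this relies on r \<ge> 1: \<open>0 ^ 0\<close> is 1 whereas
    \<open>0 powr 0\<close> is 0.\<close>
  have pw: "(phi x / (real n * rho m x)) ^ r = (phi x / (real n * rho m x)) powr real r" if "x \<in> {-1..1}" for x
  proof (cases "phi x / (real n * rho m x) = 0")
    case True
    show ?thesis unfolding True using r by simp
  next
    case False
    have "0 < phi x / (real n * rho m x)" by (rule le_neq_trans[OF t0[OF that] False[symmetric]])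
    then show ?thesis by (rule powr_realpow[symmetric])
  qed
  have "wnorm p (weight_avg w n) (\<lambda>x. symm_difference r (h * phi x) (poly Q) x) \<le> ennreal K * wnorm p (weight_avg w m) (kernel_average \<sigma> m Q)"
  proof (rule wnorm_le_transfer)
    show "(\<lambda>x. symm_difference r (h * phi x) (poly Q) x) \<in> borel_measurable leb1"
      by (rule symm_difference_measurable[OF dw tau p r n h poly_leb1_measurable])
    fix x :: real assume x: "x \<in> {-1..1}"
    note G0 = kernel_average_nonneg[OF m(1) x, of \<sigma> Q]
    note wn0 = weight_avg_nonneg[OF dw x n]
    show "\<bar>symm_difference r (h * phi x) (poly Q) x\<bar> * weight_avg w n x \<le> K * (\<bar>kernel_average \<sigma> m Q x\<bar> * weight_avg w m x)"
      if "p = \<infinity>"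
    proof -
      have "\<bar>symm_difference r (h * phi x) (poly Q) x\<bar> * weight_avg w n x
        \<le> (b * (phi x / (real n * rho m x)) powr real r * kernel_average \<sigma> m Q x) * weight_avg w n x"
        using point[OF x] unfolding pw[OF x] by (intro mult_right_mono wn0)
      also have "\<dots> = b * kernel_average \<sigma> m Q x * ((phi x / (real n * rho m x)) powr real r * weight_avg w n x)" by simp
      also have "\<dots> \<le> b * kernel_average \<sigma> m Q x * ((real m / real n) powr (real r - 1) * weight_avg w m x)"
        using b0 G0 r by (intro mult_left_mono key x) auto
      also have "\<dots> = K * (\<bar>kernel_average \<sigma> m Q x\<bar> * weight_avg w m x)" using G0 that by (simp add: K_def lam_def)
      finally show ?thesis .
    qed
    show "\<bar>symm_difference r (h * phi x) (poly Q) x\<bar> powr enn2real p * weight_avg w n x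
      \<le> K powr enn2real p * (\<bar>kernel_average \<sigma> m Q x\<bar> powr enn2real p * weight_avg w m x)" if "p \<noteq> \<infinity>"
    proof -
      define q where "q = enn2real p"
      have q: "q \<ge> 1" and lq: "lam p = q" using p that by (cases p; auto simp: q_def lam_def)+
      have rq: "real r * q \<ge> 1" using mult_mono[of 1 "real r" 1 q] r q by simp
      have "\<bar>symm_difference r (h * phi x) (poly Q) x\<bar> powr q
        \<le> (b * (phi x / (real n * rho m x)) powr real r * kernel_average \<sigma> m Q x) powr q"
        using point[OF x] q unfolding pw[OF x] by (intro powr_mono2) auto
      also have "\<dots> = b powr q * (phi x / (real n * rho m x)) powr (real r * q) * kernel_average \<sigma> m Q x powr q"
        by (simp only: powr_mult powr_powr)
      finally have "\<bar>symm_difference r (h * phi x) (poly Q) x\<bar> powr q * weight_avg w n x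
        \<le> (b powr q * (phi x / (real n * rho m x)) powr (real r * q) * kernel_average \<sigma> m Q x powr q) * weight_avg w n x"
        by (intro mult_right_mono wn0)
      also have "\<dots> = b powr q * kernel_average \<sigma> m Q x powr q * ((phi x / (real n * rho m x)) powr (real r * q) * weight_avg w n x)"
        by (simp only: mult_ac)
      also have "\<dots> \<le> b powr q * kernel_average \<sigma> m Q x powr q * ((real m / real n) powr (real r * q - 1) * weight_avg w m x)"
        by (intro mult_left_mono key x rq) auto
      also have "(real m / real n) powr (real r * q - 1) = ((real m / real n) powr (real r - 1 / lam p)) powr q"
        using q by (simp add: powr_powr lq left_diff_distrib)
      also have "b powr q * kernel_average \<sigma> m Q x powr q * (((real m / real n) powr (real r - 1 / lam p)) powr q * weight_avg w m x)
        = K powr q * (kernel_average \<sigma> m Q x powr q * weight_avg w m x)"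
        unfolding K_def powr_mult by (simp only: mult_ac)
      finally show ?thesis using G0 by (simp add: q_def)
    qed
  qed (use weight_avg_measurable m n weight_avg_nonneg[OF dw] K0 p kernel_average_measurable in auto)
  also have "\<dots> \<le> ennreal K * (ennreal (512 * (2 * 8 ^ \<tau>)) * wnorm p (weight_avg w m) (poly Q))"
  proof (rule mult_left_mono)
    show "wnorm p (weight_avg w m) (kernel_average \<sigma> m Q) \<le> ennreal (512 * (2 * 8 ^ \<tau>)) * wnorm p (weight_avg w m) (poly Q)"
      unfolding \<sigma>_def
    proof (rule wnorm_kernel_average_le[OF m(1) p continuous_on_weight_avg[OF dw m(1)] weight_avg_nonneg[OF dw _ m(1)]])
      have "(1::real) * 1 \<le> 2 * 8 ^ \<tau>" by (intro mult_mono one_le_power) auto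
      then show "(1::real) \<le> 2 * 8 ^ \<tau>" by simp
    qed (assumption | rule weight_avg_growth[OF dw _ _ m(1) tau])+
  qed simp
  also have "\<dots> = ennreal (K * (512 * (2 * 8 ^ \<tau>))) * wnorm p (weight_avg w m) (poly Q)"
    using K0 by (simp add: ennreal_mult mult.assoc)
  also have "K * (512 * (2 * 8 ^ \<tau>)) = poly_const \<tau> r * (real m / real n) powr (real r - 1 / lam p)"
    by (simp add: K_def b_def \<sigma>_def poly_const_def)
  finally show ?thesis .
qed

section \<open>Comparison of neighbouring indices and condensation\<close>

lemma wnorm_weight_avg_le_4:
  assumes "1 \<le> m" "m \<le> n" "n \<le> 2 * m" and g: "g \<in> borel_measurable leb1"
  shows "wnorm p (weight_avg w n) g \<le> 4 * wnorm p (weight_avg w m) g"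
proof -
  have n: "1 \<le> n" using assms by simp
  have "wnorm p (weight_avg w n) g \<le> ennreal 4 * wnorm p (weight_avg w m) g"
    using assms n weight_avg_nonneg[OF dw] weight_avg_le_4[OF dw _ assms(1-3)]
    by (intro wnorm_weight_mono p weight_avg_measurable) auto
  then show ?thesis by simp
qed

lemma best_approx_le_4:
  assumes "1 \<le> k" "k \<le> n" "n \<le> 2 * k" and f: "f \<in> borel_measurable leb1"
  shows "best_approx n f p (weight_avg w n) \<le> 4 * best_approx k f p (weight_avg w k)"
proof -
  have "best_approx n f p (weight_avg w n) \<le> 4 * wnorm p (weight_avg w k) (\<lambda>x. f x - poly P x)" if "P \<in> Pi_poly k" for P
  proof -
    have "P \<in> Pi_poly n" using that assms by (auto simp: Pi_poly_def)
    then have "best_approx n f p (weight_avg w n) \<le> wnorm p (weight_avg w n) (\<lambda>x. f x - poly P x)"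
      unfolding best_approx_def by (rule INF_lower)
    also have "\<dots> \<le> 4 * wnorm p (weight_avg w k) (\<lambda>x. f x - poly P x)"
      using poly_leb1_measurable f by (intro wnorm_weight_avg_le_4 assms borel_measurable_diff)
    finally show ?thesis .
  qed
  \<comment> \<open>The factor 4 is moved to the left before the infimum over P is taken, and back
    afterwards.\<close>
  moreover have q: "ennreal (1 / 4) * (4 * y) = y" "4 * (ennreal (1 / 4) * y) = y" for y
    using ennreal_mult[of "1 / 4" 4] ennreal_mult[of 4 "1 / 4"] by (simp_all flip: mult.assoc)
  ultimately have "ennreal (1 / 4) * best_approx n f p (weight_avg w n) \<le> wnorm p (weight_avg w k) (\<lambda>x. f x - poly P x)"
    if "P \<in> Pi_poly k" for P
    using mult_left_mono[of "best_approx n f p (weight_avg w n)" "4 * wnorm p (weight_avg w k) (\<lambda>x. f x - poly P x)" "ennreal (1 / 4)"] that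
    by simp
  then have "ennreal (1 / 4) * best_approx n f p (weight_avg w n) \<le> best_approx k f p (weight_avg w k)"
    unfolding best_approx_def[of k] by (rule INF_greatest)
  then have "4 * (ennreal (1 / 4) * best_approx n f p (weight_avg w n)) \<le> 4 * best_approx k f p (weight_avg w k)"
    by (intro mult_left_mono) auto
  then show ?thesis unfolding q .
qed

text \<open>Cauchy condensation: the error at index 2^(J+1) is at most 4 times the error at each of
  the 2^J indices k of the block ending there, and k^(e-1) is at least 2^(-r) times its value at the
  end of the block. The constant is 2 * 4 * 2^r, where the 2 is the ratio of 2^(J+1) to the block
  length.\<close>

lemma dyadic_sum_le:
  assumes f: "f \<in> borel_measurable leb1" and e: "0 \<le> e" "e \<le> real r"
  shows "(\<Sum>j\<le>J. ennreal ((2 ^ j) powr e) * best_approx (2 ^ j) f p (weight_avg w (2 ^ j)))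
    \<le> ennreal (2 ^ (r + 3)) * (\<Sum>k=1..2 ^ J. ennreal (real k powr (e - 1)) * best_approx k f p (weight_avg w k))"
proof (induction J)
  case 0
  have "1 * best_approx (Suc 0) f p (weight_avg w (Suc 0)) \<le> ennreal (2 ^ (r + 3)) * best_approx (Suc 0) f p (weight_avg w (Suc 0))"
    by (intro mult_right_mono) (simp_all flip: ennreal_1 add: ennreal_leI del: power_add_numeral)
  then show ?case by simp
next
  case (Suc J)
  let ?F = "\<lambda>k. ennreal (real k powr (e - 1)) * best_approx k f p (weight_avg w k)"
  let ?E = "best_approx (2 ^ Suc J) f p (weight_avg w (2 ^ Suc J))"
  let ?S = "{2 ^ J + 1..2 ^ Suc J} :: nat set"
  define M where "M = ((2::real) ^ Suc J) powr (e - 1)"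
  have M0: "M > 0" by (simp add: M_def)
  have low: "ennreal (M / 2 ^ r) * ?E \<le> 4 * ?F k" if k: "k \<in> ?S" for k
  proof -
    have k1: "1 \<le> k" "k \<le> 2 ^ Suc J" "2 ^ Suc J \<le> 2 * k" using k by auto
    have rk: "real k > 0" "real k \<le> 2 ^ Suc J" "(2 ^ Suc J) / 2 \<le> real k"
      using k1 of_nat_mono[OF k1(2), where 'a=real] of_nat_mono[OF k1(3), where 'a=real] by auto
    \<comment> \<open>The exponent e - 1 may have either sign: for e \<ge> 1 halving the base costs
      2^(e-1), and for e < 1 the power decreases in k, so nothing is lost.\<close>
    have "M / 2 ^ r \<le> real k powr (e - 1)"
    proof (cases "e \<ge> 1")
      case True
      have "2 powr (e - 1) \<le> 2 powr real r" using e by (intro powr_mono) auto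
      then have "M / 2 ^ r \<le> M / 2 powr (e - 1)"
        using M0 by (intro divide_left_mono mult_pos_pos) (auto simp: powr_realpow)
      also have "\<dots> = ((2 ^ Suc J) / 2) powr (e - 1)" unfolding M_def by (rule powr_divide[symmetric])
      also have "\<dots> \<le> real k powr (e - 1)" using rk True by (intro powr_mono2) auto
      finally show ?thesis .
    next
      case False
      have "M / 2 ^ r \<le> M / 1" using M0 by (intro divide_left_mono) auto
      also have "\<dots> \<le> real k powr (e - 1)" unfolding M_def using rk False by (simp add: powr_mono2')
      finally show ?thesis .
    qed
    then have "ennreal (M / 2 ^ r) * ?E \<le> ennreal (real k powr (e - 1)) * (4 * best_approx k f p (weight_avg w k))"
      by (intro mult_mono ennreal_leI best_approx_le_4 k1 f) auto
    then show ?thesis by (simp add: mult_ac)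
  qed
  have card: "card ?S = 2 ^ J" by simp
  have "ennreal ((2 ^ Suc J) powr e) = ennreal (2 ^ (r + 3) * (2 ^ J * (M / 2 ^ r / 4)))"
    by (simp add: M_def powr_diff power_add)
  also have "\<dots> = ennreal (2 ^ (r + 3)) * (of_nat (card ?S) * ennreal (M / 2 ^ r / 4))"
  proof -
    have "ennreal (a * (b * c)) = ennreal a * (ennreal b * ennreal c)" if "0 \<le> a" "0 \<le> b" "0 \<le> c" for a b c
      using that by (simp add: ennreal_mult)
    moreover have "of_nat (2 ^ J) = ennreal (2 ^ J)" by (simp add: ennreal_of_nat_eq_real_of_nat)
    ultimately show ?thesis unfolding card using M0 by (metis divide_nonneg_nonneg less_imp_le zero_le_numeral zero_le_power)
  qed
  finally have "ennreal ((2 ^ Suc J) powr e) * ?E = ennreal (2 ^ (r + 3)) * (of_nat (card ?S) * (ennreal (M / 2 ^ r / 4) * ?E))"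
    by (simp add: mult.assoc)
  also have "\<dots> = ennreal (2 ^ (r + 3)) * (\<Sum>k\<in>?S. ennreal (M / 2 ^ r / 4) * ?E)" by simp
  also have "\<dots> \<le> ennreal (2 ^ (r + 3)) * (\<Sum>k\<in>?S. ?F k)"
  proof (intro mult_left_mono sum_mono)
    fix k assume k: "k \<in> ?S"
    have "ennreal (M / 2 ^ r / 4) * ?E = ennreal (1 / 4) * (ennreal (M / 2 ^ r) * ?E)"
      using ennreal_mult[of "1/4" "M / 2 ^ r"] M0 by (simp add: mult.assoc[symmetric] mult.commute[of _ "4 :: real"])
    also have "\<dots> \<le> ennreal (1 / 4) * (4 * ?F k)" by (intro mult_left_mono low k) auto
    also have "\<dots> = (ennreal (1 / 4) * ennreal 4) * ?F k" by (simp add: mult.assoc)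
    also have "ennreal (1 / 4) * ennreal 4 = 1" by (subst ennreal_mult[symmetric]) auto
    finally show "ennreal (M / 2 ^ r / 4) * ?E \<le> ?F k" by simp
  qed simp
  finally have step: "ennreal ((2 ^ Suc J) powr e) * ?E \<le> ennreal (2 ^ (r + 3)) * (\<Sum>k\<in>?S. ?F k)" .
  have "(\<Sum>j\<le>Suc J. ennreal ((2 ^ j) powr e) * best_approx (2 ^ j) f p (weight_avg w (2 ^ j)))
    \<le> ennreal (2 ^ (r + 3)) * (\<Sum>k=1..2 ^ J. ?F k) + ennreal (2 ^ (r + 3)) * (\<Sum>k\<in>?S. ?F k)"
    using add_mono[OF Suc step] by simp
  also have "\<dots> = ennreal (2 ^ (r + 3)) * (sum ?F {1..2 ^ J} + sum ?F ?S)" by (simp add: distrib_left)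
  also have "sum ?F {1..2 ^ J} + sum ?F ?S = sum ?F ({1..2 ^ J} \<union> ?S)"
    by (rule sum.union_disjoint[symmetric]) auto
  also have "{1..2 ^ J} \<union> ?S = {1..2 ^ Suc J}" by auto
  finally show ?case .
qed

lemma symm_difference_add:
  "symm_difference r d (\<lambda>x. f x + g x) x = symm_difference r d f x + symm_difference r d g x"
  by (simp add: symm_difference_def distrib_left sum.distrib)

text \<open>The differences of the constant \<open>P 0\<close> vanish because r \<ge> 1, so the
  telescoping sum has no initial term.\<close>

lemma wnorm_symm_difference_telescope:
  assumes n: "n \<ge> 1" and h: "0 < h" "h \<le> 1 / real n" and P0: "degree (P 0) = 0"
  shows "wnorm p (weight_avg w n) (\<lambda>x. symm_difference r (h * phi x) (poly (P J)) x)
    \<le> (\<Sum>j<J. wnorm p (weight_avg w n) (\<lambda>x. symm_difference r (h * phi x) (poly (P (Suc j) - P j)) x))"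
proof (induction J)
  case 0
  obtain a where "P 0 = [:a:]" using P0 by (metis degree_eq_zeroE)
  then have "symm_difference r (h * phi x) (poly (P 0)) x = 0" for x
    using binomial_difference_const[OF r, of a] by (simp add: symm_difference_def)
  then show ?case using wnorm_zero[OF weight_avg_measurable[OF n] weight_avg_nonneg[OF dw _ n] p] by simp
next
  case (Suc J)
  let ?D = "\<lambda>Q x. symm_difference r (h * phi x) (poly Q) x"
  have "?D (P (Suc J)) x = ?D (P J) x + ?D (P (Suc J) - P J) x" for x
    by (subst symm_difference_add[symmetric]) simp
  then have "wnorm p (weight_avg w n) (?D (P (Suc J))) = wnorm p (weight_avg w n) (\<lambda>x. ?D (P J) x + ?D (P (Suc J) - P J) x)"
    by simp
  also have "\<dots> \<le> wnorm p (weight_avg w n) (?D (P J)) + wnorm p (weight_avg w n) (?D (P (Suc J) - P J))"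
    by (intro wnorm_triangle[OF weight_avg_measurable[OF n] weight_avg_nonneg[OF dw _ n] p]
        symm_difference_measurable[OF dw tau p r n h] poly_leb1_measurable)
  also have "\<dots> \<le> (\<Sum>j<Suc J. wnorm p (weight_avg w n) (?D (P (Suc j) - P j)))"
    using Suc by (simp only: sum.lessThan_Suc add_right_mono)
  finally show ?case .
qed

text \<open>The slack stands in for attainment of the infimum; an infinite infimum is met by any
  polynomial.\<close>

lemma near_best_approx:
  assumes "\<epsilon> > 0"
  obtains P where "P \<in> Pi_poly k" "wnorm p v (\<lambda>x. f x - poly P x) \<le> best_approx k f p v + ennreal \<epsilon>"
proof (cases "best_approx k f p v = top")
  case True
  have "0 \<in> Pi_poly k" by (simp add: Pi_poly_def)
  then show ?thesis using that True by simp
next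
  case False
  then have "best_approx k f p v < best_approx k f p v + ennreal \<epsilon>"
    using assms by (cases "best_approx k f p v") (auto simp flip: ennreal_plus simp: ennreal_less_iff)
  then obtain P where "P \<in> Pi_poly k" "wnorm p v (\<lambda>x. f x - poly P x) < best_approx k f p v + ennreal \<epsilon>"
    by (subst (asm) (1) best_approx_def) (auto simp: INF_less_iff)
  then show ?thesis using that by (auto intro: less_imp_le)
qed

lemma wnorm_minus_commute: "wnorm p v (\<lambda>x. f x - g x) = wnorm p v (\<lambda>x. g x - f x)"
  by (simp add: wnorm_def abs_minus_commute)

text \<open>In K, the summand with \<open>shift_const\<close> comes from the remainder f - P_J and
  the other from the dyadic increments. The 4 is the cost of passing to a weight of at most twice
  the index, 5 = 1 + 4 arises from splitting an increment at f, and 2^r bounds one step of the gains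
  s. The further 2^(r+3) is the condensation constant.\<close>

lemma inverse_estimate:
  fixes f :: "real \<Rightarrow> real"
  assumes f: "f \<in> borel_measurable leb1" and n: "n \<ge> 1"
  defines "e \<equiv> real r - 1 / lam p"
    and "K \<equiv> 2 ^ r * (4 * (2 ^ r * (2 * shift_const \<tau> r)) + 5 * poly_const \<tau> r)"
  shows "modulus_phi r f (1 / real n) p (weight_avg w n)
    \<le> ennreal (K * 2 ^ (r + 3) / real n powr e) * (\<Sum>k=1..n. ennreal (real k powr (e - 1)) * best_approx k f p (weight_avg w k))"
proof -
  define KB where "KB = 2 ^ r * (2 * shift_const \<tau> r)"
  define KD where "KD = poly_const \<tau> r"
  have KB: "KB \<ge> 0" using shift_const_ge_1[of \<tau> r] by (simp add: KB_def)
  have KD: "KD > 0" unfolding KD_def by (rule poly_const_pos)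
  have K: "K > 0" unfolding K_def KB_def[symmetric] KD_def[symmetric] using KB KD by (simp add: add_nonneg_pos)
  have l1: "lam p \<ge> 1" by (rule lam_ge_1[OF p])
  then have e0: "0 \<le> e" "e \<le> real r" using r by (auto simp: e_def divide_le_eq_1 intro: order_trans[of _ 1])
  let ?E = "\<lambda>k. best_approx k f p (weight_avg w k)"
  \<comment> \<open>n is less than twice 2^J, so passing from the weight at 2^J to the one at n
    costs only 4.\<close>
  obtain J where J: "2 ^ J \<le> n" "n < 2 ^ Suc J" using ex_power_ivl1[of 2 n] n by auto
  \<comment> \<open>The gain of \<open>wnorm_symm_difference_poly_le\<close> for m = 2^j.\<close>
  define s where "s j = (2 ^ j / real n) powr e" for j :: nat
  have n0: "real n > 0" using n by simp
  have Jr: "(2::real) ^ J \<le> real n" "real n < 2 ^ Suc J"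
    using of_nat_mono[OF J(1), where 'a=real] of_nat_less_iff[of n "2 ^ Suc J", where 'a=real] J(2) by auto
  have s0: "s j \<ge> 0" for j by (simp add: s_def)
  have s1: "s j \<le> 1" if "j \<le> J" for j
  proof -
    have "(2::real) ^ j \<le> 2 ^ J" using that by (intro power_increasing) auto
    then have "2 ^ j / real n \<le> 1" using order_trans[OF _ Jr(1)] by (simp only: divide_le_eq_1_pos n0)
    then show ?thesis unfolding s_def using e0 n0 by (intro powr_le1) auto
  qed
  have p2: "2 powr e \<le> 2 ^ r" using powr_mono[OF e0(2), of 2] by (simp add: powr_realpow)
  have sS: "s (Suc j) \<le> 2 ^ r * s j" for j
  proof -
    have "s (Suc j) = 2 powr e * s j" unfolding s_def power_Suc times_divide_eq_right[symmetric] by (rule powr_mult)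
    then show ?thesis using p2 s0 by (simp add: mult_right_mono)
  qed
  \<comment> \<open>The remainder f - P_J comes without a gain, but s J is bounded below, so its
    term fits into the same sum.\<close>
  have sJ: "1 \<le> 2 ^ r * s J"
  proof -
    have "1 \<le> (2 * (2 ^ J / real n)) powr e" using Jr n0 e0 by (intro ge_one_powr_ge_zero) (auto simp: le_divide_eq)
    also have "\<dots> = 2 powr e * s J" unfolding s_def by (rule powr_mult)
    also have "\<dots> \<le> 2 ^ r * s J" using p2 s0 by (intro mult_right_mono)
    finally show ?thesis .
  qed
  have main: "wnorm p (weight_avg w n) (\<lambda>x. symm_difference r (h * phi x) f x)
      \<le> ennreal K * (\<Sum>j\<le>J. ennreal (s j) * (?E (2 ^ j) + ennreal \<epsilon>))"
    if h: "0 < h" "h \<le> 1 / real n" and eps: "\<epsilon> > 0" for h \<epsilon> :: real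
  proof -
    have "\<exists>P. P \<in> Pi_poly (2 ^ j) \<and> wnorm p (weight_avg w (2 ^ j)) (\<lambda>x. f x - poly P x) \<le> ?E (2 ^ j) + ennreal \<epsilon>" for j
      using near_best_approx[OF eps, of "2 ^ j" "weight_avg w (2 ^ j)" f] by blast
    then obtain P where P: "\<And>j. P j \<in> Pi_poly (2 ^ j)"
      "\<And>j. wnorm p (weight_avg w (2 ^ j)) (\<lambda>x. f x - poly (P j) x) \<le> ?E (2 ^ j) + ennreal \<epsilon>"
      by metis
    define N where "N j = wnorm p (weight_avg w (2 ^ j)) (\<lambda>x. f x - poly (P j) x)" for j
    define S where "S = (\<Sum>j\<le>J. ennreal (s j) * N j)"
    have deg: "degree (P j) \<le> 2 ^ j - 1" for j using P(1)[of j] by (simp add: Pi_poly_def)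
    have fP: "(\<lambda>x. f x - poly (P j) x) \<in> borel_measurable leb1" for j
      using f poly_leb1_measurable by (rule borel_measurable_diff)
    have S1: "ennreal (s j) * N j \<le> S" if "j \<le> J" for j
      unfolding S_def using that by (intro member_le_sum) auto
    let ?D = "\<lambda>g. wnorm p (weight_avg w n) (\<lambda>x. symm_difference r (h * phi x) g x)"
    have A: "?D (poly (P (Suc j) - P j)) \<le> ennreal KD * (ennreal (s (Suc j)) * N (Suc j) + ennreal (4 * 2 ^ r) * (ennreal (s j) * N j))"
      if j: "j < J" for j
    proof -
      have "(2::nat) ^ Suc j \<le> 2 ^ J" using j by (intro power_increasing) auto
      then have m: "1 \<le> (2::nat) ^ Suc j" "2 ^ Suc j \<le> n" using J by auto
      have "degree (P (Suc j) - P j) \<le> 2 ^ Suc j"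
        using deg[of j] deg[of "Suc j"] by (intro degree_diff_le) auto
      from wnorm_symm_difference_poly_le[OF m this h]
      have "?D (poly (P (Suc j) - P j)) \<le> ennreal (KD * s (Suc j)) * wnorm p (weight_avg w (2 ^ Suc j)) (poly (P (Suc j) - P j))"
        by (simp add: KD_def s_def e_def)
      also have "\<dots> \<le> ennreal (KD * s (Suc j)) * (N (Suc j) + 4 * N j)"
      proof (intro mult_left_mono)
        \<comment> \<open>Splitting the increment at f leaves only approximation errors; that of
          \<open>P j\<close> is carried over to the weight of the next dyadic index.\<close>
        have "poly (P (Suc j) - P j) = (\<lambda>x. (poly (P (Suc j)) x - f x) + (f x - poly (P j) x))" by auto
        then have "wnorm p (weight_avg w (2 ^ Suc j)) (poly (P (Suc j) - P j))
          \<le> wnorm p (weight_avg w (2 ^ Suc j)) (\<lambda>x. poly (P (Suc j)) x - f x) + wnorm p (weight_avg w (2 ^ Suc j)) (\<lambda>x. f x - poly (P j) x)"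
          using f poly_leb1_measurable weight_avg_measurable[OF m(1)] weight_avg_nonneg[OF dw _ m(1)]
          by (simp only:) (intro wnorm_triangle p borel_measurable_diff)
        moreover have "wnorm p (weight_avg w (2 ^ Suc j)) (\<lambda>x. poly (P (Suc j)) x - f x) = N (Suc j)"
          unfolding N_def by (rule wnorm_minus_commute)
        moreover have "wnorm p (weight_avg w (2 ^ Suc j)) (\<lambda>x. f x - poly (P j) x) \<le> 4 * N j"
          unfolding N_def by (intro wnorm_weight_avg_le_4 fP) auto
        ultimately show "wnorm p (weight_avg w (2 ^ Suc j)) (poly (P (Suc j) - P j)) \<le> N (Suc j) + 4 * N j"
          by (metis add_left_mono order_trans)
      qed simp
      also have "\<dots> = ennreal KD * (ennreal (s (Suc j)) * N (Suc j) + ennreal (s (Suc j)) * (4 * N j))"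
        using KD s0 by (simp add: ennreal_mult distrib_left mult.assoc)
      also have "\<dots> \<le> ennreal KD * (ennreal (s (Suc j)) * N (Suc j) + ennreal (2 ^ r * s j) * (4 * N j))"
        using sS by (intro mult_left_mono add_left_mono mult_right_mono ennreal_leI) auto
      also have "ennreal (2 ^ r * s j) * (4 * N j) = ennreal (4 * 2 ^ r) * (ennreal (s j) * N j)"
        using s0 by (simp add: ennreal_mult mult_ac)
      finally show ?thesis .
    qed
    have "(\<lambda>x. symm_difference r (h * phi x) f x) = (\<lambda>x. symm_difference r (h * phi x) (\<lambda>y. f y - poly (P J) y) x + symm_difference r (h * phi x) (poly (P J)) x)"
      by (subst symm_difference_add[symmetric]) simp
    then have "?D f \<le> ?D (\<lambda>y. f y - poly (P J) y) + ?D (poly (P J))"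
      using wnorm_triangle[OF weight_avg_measurable[OF n] weight_avg_nonneg[OF dw _ n] p
          symm_difference_measurable[OF dw tau p r n h fP] symm_difference_measurable[OF dw tau p r n h poly_leb1_measurable]]
      by simp
    moreover have "?D (\<lambda>y. f y - poly (P J) y) \<le> ennreal (2 ^ r * (4 * KB)) * S"
    proof -
      have "?D (\<lambda>y. f y - poly (P J) y) \<le> ennreal KB * wnorm p (weight_avg w n) (\<lambda>y. f y - poly (P J) y)"
        unfolding KB_def by (rule wnorm_symm_difference_le[OF dw tau p r n h fP])
      also have "\<dots> \<le> ennreal KB * (4 * N J)"
        unfolding N_def using J by (intro mult_left_mono wnorm_weight_avg_le_4 fP) auto
      also have "\<dots> \<le> ennreal KB * (4 * (ennreal (2 ^ r * s J) * N J))"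
      proof (intro mult_left_mono)
        have "ennreal 1 * N J \<le> ennreal (2 ^ r * s J) * N J" using sJ by (intro mult_right_mono ennreal_leI) auto
        then show "N J \<le> ennreal (2 ^ r * s J) * N J" by simp
      qed auto
      also have "\<dots> = ennreal (2 ^ r * (4 * KB)) * (ennreal (s J) * N J)"
        using KB s0 by (simp add: ennreal_mult mult_ac)
      also have "\<dots> \<le> ennreal (2 ^ r * (4 * KB)) * S" by (intro mult_left_mono S1) auto
      finally show ?thesis .
    qed
    moreover have "?D (poly (P J)) \<le> ennreal (2 ^ r * (5 * KD)) * S"
    proof -
      have "degree (P 0) = 0" using deg[of 0] by simp
      from wnorm_symm_difference_telescope[where P = P and J = J, OF n h this]
      have "?D (poly (P J)) \<le> (\<Sum>j<J. ?D (poly (P (Suc j) - P j)))" .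
      also have "\<dots> \<le> (\<Sum>j<J. ennreal KD * (ennreal (s (Suc j)) * N (Suc j) + ennreal (4 * 2 ^ r) * (ennreal (s j) * N j)))"
        by (intro sum_mono A) auto
      also have "\<dots> = ennreal KD * ((\<Sum>j<J. ennreal (s (Suc j)) * N (Suc j)) + ennreal (4 * 2 ^ r) * (\<Sum>j<J. ennreal (s j) * N j))"
        by (simp only: sum_distrib_left sum.distrib distrib_left)
      also have "\<dots> \<le> ennreal KD * (ennreal (2 ^ r) * S + ennreal (4 * 2 ^ r) * S)"
      proof (intro mult_left_mono add_mono)
        have "(\<Sum>j<J. ennreal (s (Suc j)) * N (Suc j)) \<le> S"
          unfolding S_def sum.atMost_shift[of _ J] by simp
        also have "S \<le> ennreal (2 ^ r) * S"
        proof -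
          have "ennreal 1 * S \<le> ennreal (2 ^ r) * S" by (intro mult_right_mono ennreal_leI) auto
          then show ?thesis by simp
        qed
        finally show "(\<Sum>j<J. ennreal (s (Suc j)) * N (Suc j)) \<le> ennreal (2 ^ r) * S" .
        show "(\<Sum>j<J. ennreal (s j) * N j) \<le> S" unfolding S_def by (rule sum_mono2) auto
      qed auto
      also have "\<dots> = ennreal KD * (ennreal (5 * 2 ^ r) * S)"
      proof -
        have "ennreal (2 ^ r) + ennreal (4 * 2 ^ r) = ennreal (2 ^ r + 4 * 2 ^ r)"
          by (rule ennreal_plus[symmetric]) auto
        then show ?thesis by (simp flip: distrib_right)
      qed
      also have "\<dots> = ennreal (2 ^ r * (5 * KD)) * S"
      proof -
        have "ennreal KD * ennreal (5 * 2 ^ r) = ennreal (KD * (5 * 2 ^ r))"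
          using KD by (intro ennreal_mult[symmetric]) auto
        also have "KD * (5 * 2 ^ r) = 2 ^ r * (5 * KD)" by simp
        finally show ?thesis by (simp only: mult.assoc[symmetric, of "ennreal KD"])
      qed
      finally show ?thesis .
    qed
    ultimately have "?D f \<le> ennreal (2 ^ r * (4 * KB)) * S + ennreal (2 ^ r * (5 * KD)) * S"
      by (meson add_mono order_trans)
    also have "\<dots> = ennreal K * S"
    proof -
      have "ennreal (2 ^ r * (4 * KB)) + ennreal (2 ^ r * (5 * KD)) = ennreal (2 ^ r * (4 * KB) + 2 ^ r * (5 * KD))"
        using KB KD by (intro ennreal_plus[symmetric]) auto
      also have "2 ^ r * (4 * KB) + 2 ^ r * (5 * KD) = K" by (simp add: K_def KB_def KD_def distrib_left)
      finally show ?thesis by (simp flip: distrib_right)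
    qed
    also have "\<dots> \<le> ennreal K * (\<Sum>j\<le>J. ennreal (s j) * (?E (2 ^ j) + ennreal \<epsilon>))"
      unfolding S_def N_def by (intro mult_left_mono sum_mono P) auto
    finally show ?thesis .
  qed
  let ?R = "ennreal K * (\<Sum>j\<le>J. ennreal (s j) * ?E (2 ^ j))"
  have D: "wnorm p (weight_avg w n) (\<lambda>x. symm_difference r (h * phi x) f x) \<le> ?R" if h: "0 < h" "h \<le> 1 / real n" for h
  proof (rule ennreal_le_epsilon)
    fix \<delta> :: real assume d: "\<delta> > 0"
    \<comment> \<open>There are J + 1 slack terms, with s j \<le> 1, all multiplied by K.\<close>
    define \<epsilon> where "\<epsilon> = \<delta> / (K * (real J + 1))"
    have eps: "\<epsilon> > 0" using d K by (simp add: \<epsilon>_def)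
    have "(\<Sum>j\<le>J. ennreal (s j) * ennreal \<epsilon>) \<le> (\<Sum>j\<le>J. ennreal \<epsilon>)"
    proof (rule sum_mono)
      fix j assume "j \<in> {..J}"
      then have "s j * \<epsilon> \<le> 1 * \<epsilon>" using s1 eps by (intro mult_right_mono) auto
      then show "ennreal (s j) * ennreal \<epsilon> \<le> ennreal \<epsilon>"
        using s0 eps by (simp add: ennreal_mult[symmetric] ennreal_leI)
    qed
    also have "\<dots> = ennreal ((real J + 1) * \<epsilon>)"
      using eps by (simp add: ennreal_mult ennreal_of_nat_eq_real_of_nat add.commute)
    finally have "ennreal K * (\<Sum>j\<le>J. ennreal (s j) * ennreal \<epsilon>) \<le> ennreal K * ennreal ((real J + 1) * \<epsilon>)"
      by (intro mult_left_mono) auto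
    also have "\<dots> = ennreal (K * ((real J + 1) * \<epsilon>))" using K eps by (intro ennreal_mult[symmetric]) auto
    also have "K * ((real J + 1) * \<epsilon>) = \<delta>"
    proof -
      have "K * (real J + 1) \<noteq> 0" using K by auto
      then show ?thesis by (simp add: \<epsilon>_def)
    qed
    finally have "?R + ennreal K * (\<Sum>j\<le>J. ennreal (s j) * ennreal \<epsilon>) \<le> ?R + ennreal \<delta>" by (rule add_left_mono)
    then show "wnorm p (weight_avg w n) (\<lambda>x. symm_difference r (h * phi x) f x) \<le> ?R + ennreal \<delta>"
      using main[OF h eps] by (simp only: distrib_left sum.distrib order_trans)
  qed
  have "modulus_phi r f (1 / real n) p (weight_avg w n) \<le> ?R"
    unfolding modulus_phi_def by (rule SUP_least) (auto intro: D)
  also have "(\<Sum>j\<le>J. ennreal (s j) * ?E (2 ^ j)) = ennreal (1 / real n powr e) * (\<Sum>j\<le>J. ennreal ((2 ^ j) powr e) * ?E (2 ^ j))"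
    unfolding sum_distrib_left
  proof (rule sum.cong)
    fix j
    have "s j = 1 / real n powr e * (2 ^ j) powr e" by (simp add: s_def powr_divide)
    then have "ennreal (s j) = ennreal (1 / real n powr e) * ennreal ((2 ^ j) powr e)"
      by (simp only: ennreal_mult divide_nonneg_nonneg powr_ge_zero zero_le_one)
    then show "ennreal (s j) * ?E (2 ^ j) = ennreal (1 / real n powr e) * (ennreal ((2 ^ j) powr e) * ?E (2 ^ j))"
      by (simp only: mult.assoc)
  qed simp
  also have "ennreal K * (ennreal (1 / real n powr e) * (\<Sum>j\<le>J. ennreal ((2 ^ j) powr e) * ?E (2 ^ j)))
    \<le> ennreal K * (ennreal (1 / real n powr e) * (ennreal (2 ^ (r + 3)) * (\<Sum>k=1..2 ^ J. ennreal (real k powr (e - 1)) * ?E k)))"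
    by (intro mult_left_mono dyadic_sum_le f e0) auto
  also have "\<dots> \<le> ennreal K * (ennreal (1 / real n powr e) * (ennreal (2 ^ (r + 3)) * (\<Sum>k=1..n. ennreal (real k powr (e - 1)) * ?E k)))"
    using J by (intro mult_left_mono sum_mono2) auto
  also have "\<dots> = (ennreal K * (ennreal (1 / real n powr e) * ennreal (2 ^ (r + 3)))) * (\<Sum>k=1..n. ennreal (real k powr (e - 1)) * ?E k)"
    by (simp only: mult.assoc)
  also have "ennreal K * (ennreal (1 / real n powr e) * ennreal (2 ^ (r + 3))) = ennreal (K * (1 / real n powr e * 2 ^ (r + 3)))"
    using K by (subst ennreal_mult[symmetric], simp, simp, subst ennreal_mult[symmetric]) auto
  also have "K * (1 / real n powr e * 2 ^ (r + 3)) = K * 2 ^ (r + 3) / real n powr e" by simp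
  finally show ?thesis .
qed

end

theorem corollary7p4:
  fixes r :: nat and p :: ennreal and L :: real
  assumes "r \<ge> 1" and "1 \<le> p"
  shows "\<exists>c::real. c > 0 \<and>
    (\<forall>(w :: real \<Rightarrow> real) (f :: real \<Rightarrow> real) (n :: nat).
       doubling_weight L w \<longrightarrow> f \<in> Lp_space p \<longrightarrow> n \<ge> 1 \<longrightarrow>
       modulus_phi r f (1 / real n) p (weight_avg w n)
         \<le> ennreal (c / real n powr (real r - 1 / lam p)) *
           (\<Sum>k=1..n. ennreal (real k powr (real r - 1 - 1 / lam p)) *
                      best_approx k f p (weight_avg w k)))"
proof -
  \<comment> \<open>\<tau> is chosen from L alone, so the constant below is uniform in w, f and
    n.\<close>
  obtain \<tau> where tau: "max L 1 < (5 / 4) ^ \<tau>"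
    using real_arch_pow[of "5 / 4" "max L 1"] by auto
  define c where "c = 2 ^ r * (4 * (2 ^ r * (2 * shift_const \<tau> r)) + 5 * poly_const \<tau> r) * 2 ^ (r + 3)"
  have "c > 0" unfolding c_def using shift_const_ge_1[of \<tau> r] poly_const_pos[of \<tau> r]
    by (intro mult_pos_pos add_nonneg_pos) auto
  moreover have "modulus_phi r f (1 / real n) p (weight_avg w n)
         \<le> ennreal (c / real n powr (real r - 1 / lam p)) *
           (\<Sum>k=1..n. ennreal (real k powr (real r - 1 - 1 / lam p)) * best_approx k f p (weight_avg w k))"
    if "doubling_weight L w" "f \<in> Lp_space p" "n \<ge> 1" for w f n
  proof -
    have f: "f \<in> borel_measurable leb1" using that(2) by (simp add: Lp_space_def)
    have "real r - 1 - 1 / lam p = real r - 1 / lam p - 1" by simp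
    then show ?thesis
      unfolding c_def using inverse_estimate[OF that(1) less_imp_le[OF tau] assms(2,1) f that(3)] by (simp only:)
  qed
  ultimately show ?thesis by blast
qed

end
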